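(* Let $X$ be a surface with local coordinates $(x,y)$ centred at $p\in X$ in which $\sigma=xy\,\partial_x\wedge\partial_y$, let $k\geq1$ and $n=\tfrac12k(k+1)$, and let $\sigma^{[n]}$ be Bottacin's Poisson structure on the triangular chart $U_\triangle\subset X^{[n]}$ around the subscheme defined by $\mathfrak{m}_p^k$, which is a quadratic Poisson structure in the Ellingsrud–Strømme coordinates $E_i^j$. Let $(\mathbb{C}^\times)^{(k+1)\times k}$ act by independent dilation of the coordinates $E_i^j$, and let $\sigma^{[n]}_\Delta$ be the torus-invariant part of $\sigma^{[n]}$. Then there exists a rank-one subtorus $G\cong\mathbb{C}^\times\hookrightarrow(\mathbb{C}^\times)^{(k+1)\times k}$ such that $$\lim_{g\in G,\ g\to0}g\cdot\sigma^{[n]}=\sigma^{[n]}_\Delta .$$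
   Context: $X^{[n]}$ is the Hilbert scheme (Douady space) of length-$n$ zero-dimensional subschemes of $X$. $\sigma^{[n]}$ is the Poisson structure lifting the one induced by $\sigma$ on $X^{(n)}=X^n/S_n$ along the Hilbert–Chow morphism. For $E\in\mathbb{C}^{(k+1)\times k}$ with $(j,i)$-entry $E_i^j$ ($0\le j\le k$, $0\le i\le k-1$), let $Z(E)$ be the vanishing locus of the maximal minors of $S_E(x,y)=E-x\begin{pmatrix} I_k \\ 0 \end{pmatrix}+y\begin{pmatrix} 0 \\ I_k \end{pmatrix}$. The map $E\mapsto Z(E)$ identifies a neighbourhood of $0$ in $\mathbb{C}^{(k+1)\times k}$ with the open neighbourhood $U_\triangle$ of the subscheme defined by $\mathfrak{m}_p^k$, consisting of those $Z$ for which the monomials $x^jy^l$, $j+l<k$, form a basis of functions on $Z$. The entries $E_i^j$ are the Ellingsrud–Strømme coordinates. A bivector is quadratic if its coefficients are homogeneous quadratic polynomials in the $E_i^j$. The torus $(\mathbb{C}^\times)^{(k+1)\times k}$ acts on the finite-dimensional space of quadratic bivectors, which decomposes into weight spaces. The torus-invariant part is the projection onto the weight-zero subspace, i.e. the part of the form $\sum\Pi_{ia}^{jb}E_i^jE_a^b\,\partial_{E_i^j}\wedge\partial_{E_a^b}$ with constants $\Pi_{ia}^{jb}$. *)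

theory Defs
  imports
    "HOL-Complex_Analysis.Complex_Analysis"
    "HOL-Library.Multiset"
    "HOL-Library.FuncSet"
    "Jordan_Normal_Form.Determinant"
begin

section \<open>Holomorphic functions and bivectors in finitely many coordinates\<close>

text \<open>
  A point of \<open>\<complex>\<^sup>I\<close>, for a finite set \<open>I\<close> of coordinate labels, is an element of
  \<^term>\<open>I \<rightarrow>\<^sub>E (UNIV :: complex set)\<close>.  All coordinate spaces below (the triangular chart and
  \<open>X\<^sup>n\<close>) use labels in \<^typ>\<open>nat \<times> nat\<close>.
\<close>

type_synonym label = "nat \<times> nat"
type_synonym pt = "label \<Rightarrow> complex"

text \<open>Several complex variables: continuous and separately holomorphic (Osgood).\<close>

definition holo_on :: "label set \<Rightarrow> pt set \<Rightarrow> (pt \<Rightarrow> complex) \<Rightarrow> bool" where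
  "holo_on I U f \<longleftrightarrow>
     continuous_on U f \<and>
     (\<forall>E\<in>U. \<forall>a\<in>I. (\<lambda>t. f (E(a := t))) holomorphic_on {t. E(a := t) \<in> U})"

definition partial :: "label \<Rightarrow> (pt \<Rightarrow> complex) \<Rightarrow> pt \<Rightarrow> complex" where
  "partial a f E = deriv (\<lambda>t. f (E(a := t))) (E a)"

text \<open>
  A bivector field is given by its matrix of coefficients: \<open>B E a b\<close> is the bracket of the
  coordinates \<open>a\<close> and \<open>b\<close> at \<open>E\<close>, so that \<open>B\<close> stands for
  \<open>\<Sum>\<^sub>a\<^sub>b \<onehalf> B\<^sub>a\<^sub>b \<partial>\<^sub>a \<and> \<partial>\<^sub>b\<close> (sum over ordered pairs).
\<close>

type_synonym bivector = "pt \<Rightarrow> label \<Rightarrow> label \<Rightarrow> complex"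

definition bracket ::
  "label set \<Rightarrow> bivector \<Rightarrow> (pt \<Rightarrow> complex) \<Rightarrow> (pt \<Rightarrow> complex) \<Rightarrow> pt \<Rightarrow> complex" where
  "bracket I B f g E = (\<Sum>a\<in>I. \<Sum>b\<in>I. B E a b * partial a f E * partial b g E)"

definition poisson_on :: "label set \<Rightarrow> pt set \<Rightarrow> bivector \<Rightarrow> bool" where
  "poisson_on I U B \<longleftrightarrow>
     (\<forall>a\<in>I. \<forall>b\<in>I. holo_on I U (\<lambda>E. B E a b)) \<and>
     (\<forall>E\<in>U. \<forall>a\<in>I. \<forall>b\<in>I. B E a b = - B E b a) \<and>
     (\<forall>E\<in>U. \<forall>a\<in>I. \<forall>b\<in>I. \<forall>c\<in>I.
        bracket I B (\<lambda>E. E a) (\<lambda>E. B E b c) E +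
        bracket I B (\<lambda>E. E b) (\<lambda>E. B E c a) E +
        bracket I B (\<lambda>E. E c) (\<lambda>E. B E a b) E = 0)"

section \<open>The triangular chart\<close>

text \<open>
  Bivariate polynomials are elements of \<^typ>\<open>complex poly poly\<close>: the inner variable is \<open>x\<close>, the
  outer variable is \<open>y\<close>.
\<close>

definition mono_xy :: "nat \<Rightarrow> nat \<Rightarrow> complex poly poly" where
  "mono_xy j l = Polynomial.monom (Polynomial.monom 1 j) l"

definition eval_xy :: "complex poly poly \<Rightarrow> complex \<times> complex \<Rightarrow> complex" where
  "eval_xy f p = poly (poly f [:snd p:]) (fst p)"

text \<open>The label \<open>(j, i)\<close> stands for the coordinate \<open>E\<^sub>i\<^sup>j\<close>: row \<open>j\<close>, column \<open>i\<close>.\<close>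

definition es_labels :: "nat \<Rightarrow> label set" where
  "es_labels k = {..k} \<times> {..<k}"

definition S_entry :: "pt \<Rightarrow> nat \<Rightarrow> nat \<Rightarrow> complex poly poly" where
  "S_entry E j i =
     [:[:E (j, i):]:] - (if j = i then mono_xy 1 0 else 0) + (if j = Suc i then mono_xy 0 1 else 0)"

text \<open>The maximal minor of \<open>S\<^sub>E\<close> obtained by deleting row \<open>r\<close>.\<close>

definition maximal_minor :: "nat \<Rightarrow> pt \<Rightarrow> nat \<Rightarrow> complex poly poly" where
  "maximal_minor k E r =
     Determinant.det (Matrix.mat k k (\<lambda>(a, i). S_entry E (if a < r then a else Suc a) i))"

text \<open>The subscheme \<open>Z(E)\<close> is represented by its ideal in \<open>\<complex>[x,y]\<close>.\<close>

definition ideal_Z :: "nat \<Rightarrow> pt \<Rightarrow> complex poly poly set" where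
  "ideal_Z k E = {f. \<exists>q. f = (\<Sum>r\<le>k. q r * maximal_minor k E r)}"

definition zero_set :: "complex poly poly set \<Rightarrow> (complex \<times> complex) set" where
  "zero_set J = {p. \<forall>f\<in>J. eval_xy f p = 0}"

text \<open>\<open>B\<close> is (a finite set of representatives of) a \<open>\<complex>\<close>-basis of \<open>\<complex>[x,y]/J\<close>.\<close>

definition basis_mod :: "complex poly poly set \<Rightarrow> complex poly poly set \<Rightarrow> bool" where
  "basis_mod J B \<longleftrightarrow>
     finite B \<and>
     (\<forall>f. \<exists>c. f - (\<Sum>b\<in>B. Polynomial.smult [:c b:] b) \<in> J) \<and>
     (\<forall>c. (\<Sum>b\<in>B. Polynomial.smult [:c b:] b) \<in> J \<longrightarrow> (\<forall>b\<in>B. c b = 0))"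

definition colength :: "complex poly poly set \<Rightarrow> nat" where
  "colength J = (if \<exists>B. basis_mod J B then card (SOME B. basis_mod J B) else 0)"

text \<open>
  \<open>V\<close> is the open subset of \<open>\<complex>\<^sup>2\<close> onto which the coordinates \<open>(x,y)\<close> map their domain in the
  surface.  The set below is \<open>U\<^sub>\<triangle>\<close>, the subschemes of that domain for which the monomials of
  degree less than \<open>k\<close> form a basis of functions, read in the coordinates \<open>E\<^sub>i\<^sup>j\<close>.
\<close>

definition triangular_chart :: "nat \<Rightarrow> (complex \<times> complex) set \<Rightarrow> pt set" where
  "triangular_chart k V =
     {E \<in> es_labels k \<rightarrow>\<^sub>E UNIV.
        zero_set (ideal_Z k E) \<subseteq> V \<and>
        basis_mod (ideal_Z k E) {mono_xy j l | j l. j + l < k}}"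

section \<open>The Hilbert--Chow morphism and the lifted Poisson structure\<close>

text \<open>
  Kernel of \<open>\<complex>[x,y] \<rightarrow> (\<complex>[x,y]/J)\<^sub>p\<close>.  If \<open>J\<close> has finite colength this map is onto, so the
  colength of the kernel is the multiplicity of the scheme of \<open>J\<close> at \<open>p\<close>.
\<close>

definition local_ideal :: "complex poly poly set \<Rightarrow> complex \<times> complex \<Rightarrow> complex poly poly set" where
  "local_ideal J p = {f. \<exists>h. eval_xy h p \<noteq> 0 \<and> h * f \<in> J}"

text \<open>Points of \<open>X\<^sup>(\<^sup>n\<^sup>)\<close> are multisets of \<open>n\<close> points of \<open>X\<close>.\<close>

definition hilbert_chow :: "nat \<Rightarrow> pt \<Rightarrow> (complex \<times> complex) multiset" where
  "hilbert_chow k E = Abs_multiset (\<lambda>p. colength (local_ideal (ideal_Z k E) p))"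

text \<open>On \<open>X\<^sup>n\<close> the labels \<open>(i, 0)\<close> and \<open>(i, 1)\<close> are the coordinates \<open>x\<^sub>i\<close> and \<open>y\<^sub>i\<close>.\<close>

definition power_labels :: "nat \<Rightarrow> label set" where
  "power_labels n = {..<n} \<times> {0, 1}"

definition power_set :: "nat \<Rightarrow> (complex \<times> complex) set \<Rightarrow> pt set" where
  "power_set n V = {z \<in> power_labels n \<rightarrow>\<^sub>E UNIV. \<forall>i<n. (z (i, 0), z (i, 1)) \<in> V}"

definition cycle :: "nat \<Rightarrow> pt \<Rightarrow> (complex \<times> complex) multiset" where
  "cycle n z = mset (map (\<lambda>i. (z (i, 0), z (i, 1))) [0..<n])"

text \<open>The product bivector on \<open>X\<^sup>n\<close> induced by \<open>h(x,y) \<partial>\<^sub>x \<and> \<partial>\<^sub>y\<close> on \<open>X\<close>.\<close>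

definition product_bivector :: "(complex \<times> complex \<Rightarrow> complex) \<Rightarrow> bivector" where
  "product_bivector h z a b =
     (if fst a \<noteq> fst b then 0
      else if snd a = 0 \<and> snd b = 1 then h (z (fst a, 0), z (fst a, 1))
      else if snd a = 1 \<and> snd b = 0 then - h (z (fst a, 0), z (fst a, 1))
      else 0)"

text \<open>
  Holomorphic functions on \<open>V\<^sup>(\<^sup>n\<^sup>) = V\<^sup>n/S\<^sub>n\<close> are those with holomorphic pullback to \<open>V\<^sup>n\<close>, and
  the bracket of the quotient is computed upstairs.  A Poisson structure on the chart
  is a lift if pullback along the Hilbert--Chow morphism preserves brackets of functions.
\<close>

definition lifted_poisson ::
  "nat \<Rightarrow> (complex \<times> complex) set \<Rightarrow> (complex \<times> complex \<Rightarrow> complex) \<Rightarrow> bivector \<Rightarrow> bool" where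
  "lifted_poisson k V h B \<longleftrightarrow>
     poisson_on (es_labels k) (triangular_chart k V) B \<and>
     (let n = k * (k + 1) div 2 in
        \<forall>F G. holo_on (power_labels n) (power_set n V) (F \<circ> cycle n) \<longrightarrow>
              holo_on (power_labels n) (power_set n V) (G \<circ> cycle n) \<longrightarrow>
          (\<forall>E\<in>triangular_chart k V. \<forall>z\<in>power_set n V.
             cycle n z = hilbert_chow k E \<longrightarrow>
             bracket (es_labels k) B (F \<circ> hilbert_chow k) (G \<circ> hilbert_chow k) E =
             bracket (power_labels n) (product_bivector h) (F \<circ> cycle n) (G \<circ> cycle n) z))"

section \<open>Quadratic bivectors and the torus action\<close>

text \<open>
  A quadratic bivector is given by its coefficients: \<open>Q a b c d\<close> is the coefficient of
  \<open>E\<^sub>c E\<^sub>d\<close> in the bracket of \<open>E\<^sub>a\<close> and \<open>E\<^sub>b\<close>, the sum being over ordered pairs \<open>(c, d)\<close>.  The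
  symmetry conditions make the coefficients unique.  Limits of such coefficient families in the
  product topology of the function type are coefficientwise limits, i.e. limits in the
  finite-dimensional space of quadratic bivectors.
\<close>

type_synonym quad = "label \<Rightarrow> label \<Rightarrow> label \<Rightarrow> label \<Rightarrow> complex"

definition quadratic_bivector :: "nat \<Rightarrow> quad \<Rightarrow> bool" where
  "quadratic_bivector k Q \<longleftrightarrow>
     (\<forall>a b c d. Q a b c d = - Q b a c d) \<and>
     (\<forall>a b c d. Q a b c d = Q a b d c) \<and>
     (\<forall>a b c d. \<not> {a, b, c, d} \<subseteq> es_labels k \<longrightarrow> Q a b c d = 0)"

definition bivector_field :: "nat \<Rightarrow> quad \<Rightarrow> bivector" where
  "bivector_field k Q E a b = (\<Sum>c\<in>es_labels k. \<Sum>d\<in>es_labels k. Q a b c d * E c * E d)"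

text \<open>Pushforward along the dilation \<open>E\<^sub>a \<mapsto> g\<^sub>a E\<^sub>a\<close>.\<close>

definition torus_act :: "(label \<Rightarrow> complex) \<Rightarrow> quad \<Rightarrow> quad" where
  "torus_act g Q a b c d = g a * g b / (g c * g d) * Q a b c d"

lemma bivector_field_torus_act:
  "bivector_field k (torus_act g Q) E a b =
     g a * g b * bivector_field k Q (\<lambda>e. E e / g e) a b"
  by (simp add: bivector_field_def torus_act_def sum_distrib_left field_simps)

text \<open>The weight of \<open>E\<^sub>c E\<^sub>d \<partial>\<^sub>a \<and> \<partial>\<^sub>b\<close>.\<close>

definition weight :: "label \<Rightarrow> label \<Rightarrow> label \<Rightarrow> label \<Rightarrow> label \<Rightarrow> int" where
  "weight a b c d e = of_bool (e = a) + of_bool (e = b) - of_bool (e = c) - of_bool (e = d)"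

definition torus_invariant_part :: "quad \<Rightarrow> quad" where
  "torus_invariant_part Q a b c d = (if weight a b c d = (\<lambda>_. 0) then Q a b c d else 0)"

lemma torus_act_weight:
  assumes Q: "quadratic_bivector k Q" and g: "\<And>e. e \<in> es_labels k \<Longrightarrow> g e \<noteq> 0"
  shows "torus_act g Q a b c d = (\<Prod>e\<in>es_labels k. g e powi weight a b c d e) * Q a b c d"
proof (cases "{a, b, c, d} \<subseteq> es_labels k")
  case True
  have fin: "finite (es_labels k)" by (simp add: es_labels_def)
  have one: "(\<Prod>e\<in>es_labels k. g e powi of_bool (e = u)) = g u" if "u \<in> es_labels k" for u
  proof -
    have "(\<Prod>e\<in>es_labels k. g e powi of_bool (e = u)) = (\<Prod>e\<in>es_labels k. if e = u then g e else 1)"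
      by (rule prod.cong) auto
    then show ?thesis using that fin by simp
  qed
  have "(\<Prod>e\<in>es_labels k. g e powi weight a b c d e) =
      (\<Prod>e\<in>es_labels k. g e powi of_bool (e = a) * g e powi of_bool (e = b) /
         (g e powi of_bool (e = c) * g e powi of_bool (e = d)))"
    by (rule prod.cong) (simp_all add: weight_def power_int_add power_int_diff g)
  also have "\<dots> = g a * g b / (g c * g d)"
    using True by (simp add: prod.distrib prod_dividef one)
  finally show ?thesis by (simp add: torus_act_def)
next
  case False
  then have "Q a b c d = 0" using Q unfolding quadratic_bivector_def by blast
  then show ?thesis by (simp add: torus_act_def)
qed

lemma torus_invariant_iff:
  assumes Q: "quadratic_bivector k Q"
  shows "torus_invariant_part Q = Q \<longleftrightarrow>
     (\<forall>g. (\<forall>e\<in>es_labels k. g e \<noteq> 0) \<longrightarrow> torus_act g Q = Q)"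
proof
  assume inv: "torus_invariant_part Q = Q"
  show "\<forall>g. (\<forall>e\<in>es_labels k. g e \<noteq> 0) \<longrightarrow> torus_act g Q = Q"
  proof (intro allI impI ext)
    fix g :: "label \<Rightarrow> complex" and a b c d
    assume g: "\<forall>e\<in>es_labels k. g e \<noteq> 0"
    show "torus_act g Q a b c d = Q a b c d"
    proof (cases "weight a b c d = (\<lambda>_. 0)")
      case True
      then show ?thesis using torus_act_weight[OF Q, of g a b c d] g by simp
    next
      case False
      then have "Q a b c d = 0"
        using fun_cong[OF fun_cong[OF fun_cong[OF fun_cong[OF inv, of a], of b], of c], of d]
        by (simp add: torus_invariant_part_def)
      then show ?thesis by (simp add: torus_act_def)
    qed
  qed
next
  assume act: "\<forall>g. (\<forall>e\<in>es_labels k. g e \<noteq> 0) \<longrightarrow> torus_act g Q = Q"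
  show "torus_invariant_part Q = Q"
  proof (intro ext)
    fix a b c d
    show "torus_invariant_part Q a b c d = Q a b c d"
    proof (cases "Q a b c d = 0")
      case False
      then have lab: "{a, b, c, d} \<subseteq> es_labels k" using Q unfolding quadratic_bivector_def by blast
      have "weight a b c d e = 0" for e
      proof (cases "e \<in> es_labels k")
        case True
        define g :: "label \<Rightarrow> complex" where "g = (\<lambda>u. if u = e then 2 else 1)"
        have "(\<Prod>u\<in>es_labels k. g u powi weight a b c d u) = 1"
          using act[rule_format, of g] torus_act_weight[OF Q, of g a b c d] False
          by (auto simp: g_def)
        moreover have "(\<Prod>u\<in>es_labels k. g u powi weight a b c d u) =
            (\<Prod>u\<in>es_labels k. if u = e then 2 powi weight a b c d u else 1)"
          by (rule prod.cong) (auto simp: g_def)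
        ultimately have "(2::complex) powi weight a b c d e = 1"
          using True by (simp add: es_labels_def)
        then have "norm ((2::complex) powi weight a b c d e) = 1" by simp
        then have "(2::real) powi weight a b c d e = 2 powi 0" by (simp add: norm_power_int)
        then show ?thesis
          using power_int_strict_increasing[of "weight a b c d e" 0 "2::real"]
            power_int_strict_increasing[of 0 "weight a b c d e" "2::real"]
          by (cases "weight a b c d e" "0::int" rule: linorder_cases) auto
      next
        case False
        then show ?thesis using lab by (auto simp: weight_def)
      qed
      then show ?thesis by (simp add: torus_invariant_part_def fun_eq_iff)
    qed (simp add: torus_invariant_part_def)
  qed
qed

text \<open>
  Embeddings of algebraic groups \<open>\<complex>\<^sup>\<times> \<hookrightarrow> (\<complex>\<^sup>\<times>)\<^bsup>(k+1)\<times>k\<^esup>\<close>; the algebraic homomorphisms are the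
  cocharacters.  The values at \<open>t = 0\<close> are irrelevant.
\<close>

definition rank_one_subtorus :: "nat \<Rightarrow> (complex \<Rightarrow> label \<Rightarrow> complex) \<Rightarrow> bool" where
  "rank_one_subtorus k \<phi> \<longleftrightarrow>
     (\<exists>m :: label \<Rightarrow> int. \<forall>t. t \<noteq> 0 \<longrightarrow>
        \<phi> t = (\<lambda>a. if a \<in> es_labels k then t powi m a else 1)) \<and>
     inj_on \<phi> (- {0})"

end

theory Submission
  imports Defs
begin

text \<open>
  Covectors of the chart are \<open>k \<times> (k+1)\<close> matrices \<open>\<xi>\<close>, paired with \<open>E\<close> by the trace.
  Write \<open>S = E - x J\<^sub>0 + y J\<^sub>1\<close>, where \<open>J\<^sub>0\<close> and \<open>J\<^sub>1\<close> are the identity with a zero row added below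
  and above.  A simple zero \<open>p\<close> of the maximal minors \<open>M\<^sub>r\<close> moves with \<open>E\<close> so that
  \<open>dM\<^sub>r(p) = - (\<partial>\<^sub>x M\<^sub>r dx + \<partial>\<^sub>y M\<^sub>r dy)\<close>, where the matrix \<open>dM\<^sub>r(p)\<close> of cofactors of \<open>S(p)\<close> is
  annihilated by \<open>S(p)\<close> on both sides.  So where \<open>Z(E)\<close> consists of distinct points, the lifting
  property prescribes the brackets of all \<open>dM\<^sub>r(p)\<close>, and these covectors span the cotangent space: if
  all of them kill \<open>A\<close>, then the derivatives of the minors along \<open>A\<close>, which have degree less than
  \<open>k\<close>, vanish, and differentiating the Hilbert--Burch syzygies \<open>\<Sum>\<^sub>r (-1)\<^sup>r M\<^sub>r S\<^sub>r\<^sub>i = 0\<close> gives \<open>A = 0\<close>.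

  The bracket \<open>\<xi> \<mapsto> xy (J\<^sub>0 \<xi> J\<^sub>1 - J\<^sub>1 \<xi> J\<^sub>0)\<close>, reduced to a constant matrix modulo left and right
  multiples of \<open>S\<close>, has the prescribed values, so it is \<open>\<sigma>\<^bsup>[n]\<^esup>\<close> on a nonempty open set and hence
  everywhere.  Put \<open>u = 2j - k\<close> and \<open>v = 2i - k + 1\<close>.  Every monomial of this explicit bracket is torus
  invariant, or lowers \<open>v\<^sup>2 - u\<^sup>2\<close> strictly, or exchanges the columns of the two labels; the exchanges
  that survive cancellation lower \<open>- uv\<close>.  So the one-parameter subgroup with exponents
  \<open>N (v\<^sup>2 - u\<^sup>2) - uv\<close> and large \<open>N\<close> contracts \<open>\<sigma>\<^bsup>[n]\<^esup>\<close> onto its torus-invariant part.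
\<close>

section \<open>Determinants as functions of their rows\<close>

text \<open>The Hilbert-Chow morphism is given by colengths, which are easy to compute only where
  the ideal is that of \<open>npts k\<close> distinct points. One such configuration is enough: the
  bracket of two coordinates is quadratic, so its coefficients are recovered from its values near a
  single point, along affine lines. A grid of points close to the origin provides that configuration
  inside \<open>V\<close>, and its zeros have to be followed in one complex parameter only.

  The \<open>k + 1\<close> minors overdetermine the two coordinates of a zero. A nonvanishing
  cofactor lets two of the minors cut out the locus where the rank drops, so that the inverse
  function theorem applies.

  In the weights, \<open>u\<close> and \<open>v\<close> are the row and column indices, doubled and
  centred. The difference \<open>v - u\<close> is odd, hence never zero, which makes the moves that
  couple a row with a column strict. An exchange of columns preserves the rows and the columns as
  multisets, so \<open>v\<^sup>2 - u\<^sup>2\<close> cannot detect it; the product \<open>uv\<close>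
  can, and this is why the weight has two levels.\<close>

definition det_rows :: "nat \<Rightarrow> (nat \<Rightarrow> nat \<Rightarrow> 'a::comm_ring_1) \<Rightarrow> 'a" where
  "det_rows k f = Determinant.det (Matrix.mat k k (\<lambda>(a, i). f a i))"

definition unit_row :: "nat \<Rightarrow> nat \<Rightarrow> 'a::comm_ring_1" where
  "unit_row i = (\<lambda>c. if c = i then 1 else 0)"

lemma permutes_atLeastLessThan_less:
  assumes "p permutes {0..<k}" "a < k"
  shows "p a < (k::nat)"
  using permutes_in_image[OF assms(1), of a] assms(2) by simp

lemma det_rows_leibniz: "det_rows k f = (\<Sum>p | p permutes {0..<k}. signof p * (\<Prod>a = 0..<k. f a (p a)))"
proof -
  have "det_rows k f = (\<Sum>p | p permutes {0..<k}. signof p * (\<Prod>a = 0..<k. Matrix.mat k k (\<lambda>(a, i). f a i)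
      $$ (a, p a)))"
    unfolding det_rows_def by (rule det_def') simp
  also have "\<dots> = (\<Sum>p | p permutes {0..<k}. signof p * (\<Prod>a = 0..<k. f a (p a)))"
    by (intro sum.cong refl arg_cong2[where f="(*)"] prod.cong) (auto simp: permutes_atLeastLessThan_less)
  finally show ?thesis .
qed

lemma det_rows_upd_leibniz:
  assumes "a < k"
  shows "det_rows k (f(a := v)) =
    (\<Sum>p | p permutes {0..<k}. v (p a) * (signof p * (\<Prod>b\<in>{0..<k}-{a}. f b (p b))))"
  unfolding det_rows_leibniz
proof (intro sum.cong refl)
  fix p
  have "(\<Prod>b = 0..<k. (f(a := v)) b (p b)) = (f(a := v)) a (p a) * (\<Prod>b\<in>{0..<k}-{a}. (f(a := v)) b (p b))"
    using assms by (intro prod.remove) auto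
  also have "(\<Prod>b\<in>{0..<k}-{a}. (f(a := v)) b (p b)) = (\<Prod>b\<in>{0..<k}-{a}. f b (p b))"
    by (intro prod.cong) auto
  finally show "signof p * (\<Prod>b = 0..<k. (f(a := v)) b (p b)) =
      v (p a) * (signof p * (\<Prod>b\<in>{0..<k}-{a}. f b (p b)))"
    by (simp add: algebra_simps)
qed

lemma det_rows_row_expand:
  assumes "a < k"
  shows "det_rows k (f(a := v)) = (\<Sum>i<k. v i * det_rows k (f(a := unit_row i)))"
proof -
  have "(\<Sum>i<k. v i * det_rows k (f(a := unit_row i))) =
     (\<Sum>p | p permutes {0..<k}. (\<Sum>i<k. v i * unit_row i (p a)) * (signof p * (\<Prod>b\<in>{0..<k}-{a}. f b (p b))))"
    unfolding det_rows_upd_leibniz[OF assms] sum_distrib_left sum_distrib_right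
    by (subst sum.swap) (simp add: algebra_simps)
  also have "\<dots> = (\<Sum>p | p permutes {0..<k}. v (p a) * (signof p * (\<Prod>b\<in>{0..<k}-{a}. f b (p b))))"
    using assms
    by (intro sum.cong refl arg_cong2[where f="(*)"])
      (auto simp: unit_row_def permutes_atLeastLessThan_less if_distrib cong: if_cong)
  finally show ?thesis unfolding det_rows_upd_leibniz[OF assms] by simp
qed

lemma cofactor_eq_det_rows:
  assumes "a < k" "q < k"
  shows "cofactor (Matrix.mat k k (\<lambda>(a, i). f a i)) a q = det_rows k (f(a := unit_row q))"
proof -
  define B where "B = Matrix.mat k k (\<lambda>(b, i). (f(a := unit_row q)) b i)"
  have "det_rows k (f(a := unit_row q)) = (\<Sum>j<k. B $$ (a, j) * cofactor B a j)"
    unfolding det_rows_def B_def using assms by (intro laplace_expansion_row) auto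
  also have "\<dots> = (\<Sum>j<k. (if j = q then cofactor B a j else 0))"
    using assms by (intro sum.cong) (auto simp: unit_row_def B_def)
  also have "\<dots> = cofactor B a q" using assms by simp
  also have "\<dots> = cofactor (Matrix.mat k k (\<lambda>(a, i). f a i)) a q"
  proof -
    have "mat_delete B a q = mat_delete (Matrix.mat k k (\<lambda>(a, i). f a i)) a q"
      using assms by (intro eq_matI) (auto simp: mat_delete_def B_def)
    then show ?thesis unfolding cofactor_def by (rule arg_cong)
  qed
  finally show ?thesis by simp
qed

text \<open>This is adj(A) A = det(A) 1 read entrywise: a determinant with one row replaced by a
  unit row is a cofactor.\<close>

lemma det_rows_column:
  assumes "i < k" "q < k"
  shows "(\<Sum>a<k. f a i * det_rows k (f(a := unit_row q))) = (if i = q then det_rows k f else 0)"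
proof -
  let ?A = "Matrix.mat k k (\<lambda>(a, i). f a i)"
  have A: "?A \<in> carrier_mat k k" by simp
  have "(adj_mat ?A * ?A) $$ (q, i) = (\<Sum>a<k. cofactor ?A a q * f a i)"
    using assms by (simp add: adj_mat_def scalar_prod_def atLeast0LessThan)
  also have "\<dots> = (\<Sum>a<k. f a i * det_rows k (f(a := unit_row q)))"
    using assms by (intro sum.cong refl) (simp add: cofactor_eq_det_rows mult.commute)
  finally show ?thesis using adj_mat(3)[OF A] assms by (auto simp: det_rows_def)
qed

lemma det_rows_zero_iff:
  fixes f :: "nat \<Rightarrow> nat \<Rightarrow> 'a::idom"
  shows "det_rows k f = 0 \<longleftrightarrow> (\<exists>v. (\<exists>i<k. v i \<noteq> 0) \<and> (\<forall>a<k. (\<Sum>i<k. f a i * v i) = 0))" (is "_ \<longleftrightarrow> ?R")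
proof -
  let ?A = "Matrix.mat k k (\<lambda>(a, i). f a i)"
  have "det_rows k f = 0 \<longleftrightarrow> (\<exists>v. v \<in> carrier_vec k \<and> v \<noteq> 0\<^sub>v k \<and> ?A *\<^sub>v v = 0\<^sub>v k)"
    unfolding det_rows_def by (rule det_0_iff_vec_prod_zero) simp
  also have "\<dots> \<longleftrightarrow> ?R"
  proof
    assume "\<exists>v. v \<in> carrier_vec k \<and> v \<noteq> 0\<^sub>v k \<and> ?A *\<^sub>v v = 0\<^sub>v k"
    then obtain v where v: "v \<in> carrier_vec k" "v \<noteq> 0\<^sub>v k" "?A *\<^sub>v v = 0\<^sub>v k" by blast
    have "\<exists>i<k. v $ i \<noteq> 0"
    proof (rule ccontr)
      assume "\<not> (\<exists>i<k. v $ i \<noteq> 0)"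
      then have "v = 0\<^sub>v k" using v(1) by (intro eq_vecI) auto
      then show False using v(2) by simp
    qed
    moreover have "(\<Sum>i<k. f a i * v $ i) = 0" if "a < k" for a
    proof -
      have "(?A *\<^sub>v v) $ a = (\<Sum>i<k. f a i * v $ i)"
        using that v(1) by (simp add: scalar_prod_def atLeast0LessThan)
      then show ?thesis using that v(3) by simp
    qed
    ultimately show ?R by (intro exI[of _ "\<lambda>i. v $ i"]) simp
  next
    assume ?R
    then obtain v where v: "\<exists>i<k. v i \<noteq> 0" "\<forall>a<k. (\<Sum>i<k. f a i * v i) = 0" by blast
    show "\<exists>v. v \<in> carrier_vec k \<and> v \<noteq> 0\<^sub>v k \<and> ?A *\<^sub>v v = 0\<^sub>v k"
    proof (intro exI conjI)
      show "Matrix.vec k v \<in> carrier_vec k" by simp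
      show "Matrix.vec k v \<noteq> 0\<^sub>v k"
      proof
        assume e: "Matrix.vec k v = 0\<^sub>v k"
        obtain i where "i < k" "v i \<noteq> 0" using v(1) by blast
        then show False using e by (metis index_vec index_zero_vec(1))
      qed
      show "?A *\<^sub>v Matrix.vec k v = 0\<^sub>v k"
        using v(2) by (intro eq_vecI) (auto simp: scalar_prod_def atLeast0LessThan)
    qed
  qed
  finally show ?thesis .
qed

lemma det_rows_hom:
  assumes "comm_ring_hom h"
  shows "h (det_rows k f) = det_rows k (\<lambda>a i. h (f a i))"
proof -
  interpret comm_ring_hom h by fact
  have "h (det_rows k f) = Determinant.det (map_mat h (Matrix.mat k k (\<lambda>(a, i). f a i)))"
    by (simp add: det_rows_def)
  also have "map_mat h (Matrix.mat k k (\<lambda>(a, i). f a i)) = Matrix.mat k k (\<lambda>(a, i). h (f a i))"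
    by (intro eq_matI) auto
  finally show ?thesis by (simp add: det_rows_def)
qed

text \<open>Deleting row \<open>r\<close> from a matrix with two adjacent diagonals leaves rows that
  are lower bidiagonal before \<open>r\<close> and upper bidiagonal from \<open>r\<close> on. A
  permutation with nonzero contribution is forced to be the identity, by upward induction before
  \<open>r\<close> and by downward induction from \<open>k - 1\<close> to \<open>r\<close>.\<close>

lemma det_rows_bidiagonal:
  assumes lo: "\<And>a i. a < r \<Longrightarrow> i < k \<Longrightarrow> i \<noteq> a \<Longrightarrow> Suc i \<noteq> a \<Longrightarrow> f a i = 0"
    and up: "\<And>a i. r \<le> a \<Longrightarrow> a < k \<Longrightarrow> i < k \<Longrightarrow> i \<noteq> a \<Longrightarrow> i \<noteq> Suc a \<Longrightarrow> f a i = 0"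
  shows "det_rows k f = (\<Prod>a<k. f a a)"
proof -
  have z: "(\<Prod>a = 0..<k. f a (p a)) = 0" if p: "p permutes {0..<k}" and ne: "p \<noteq> id" for p
  proof (rule ccontr)
    assume "(\<Prod>a = 0..<k. f a (p a)) \<noteq> 0"
    then have nz: "f a (p a) \<noteq> 0" if "a < k" for a using that by (metis atLeastLessThan_iff
        finite_atLeastLessThan prod_zero zero_le)
    have lt: "p a < k" if "a < k" for a using p that by (auto simp: permutes_atLeastLessThan_less)
    have inj: "p a = p b \<Longrightarrow> a = b" for a b using permutes_inj[OF p] by (auto dest: injD)
    have l: "a < r \<Longrightarrow> a < k \<Longrightarrow> p a = a" for a
    proof (induction a rule: less_induct)
      case (less a)
      have "p a = a \<or> Suc (p a) = a" using lo[of a "p a"] nz lt less.prems by blast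
      then show ?case
      proof
        assume s: "Suc (p a) = a"
        then have "p (p a) = p a" using less.IH[of "p a"] less.prems by simp
        then have "p a = a" by (rule inj)
        then show ?thesis .
      qed
    qed
    have u: "r \<le> a \<Longrightarrow> a < k \<Longrightarrow> p a = a" for a
    proof (induction "k - a" arbitrary: a rule: less_induct)
      case less
      have "p a = a \<or> p a = Suc a" using up[of a "p a"] nz lt less.prems by blast
      then show ?case
      proof
        assume s: "p a = Suc a"
        then have "Suc a < k" using lt[of a] less.prems by simp
        then have "p (Suc a) = Suc a" using less.hyps[of "Suc a"] less.prems by simp
        then show ?thesis using inj[of a "Suc a"] s by simp
      qed
    qed
    have "p a = a" for a
      using l[of a] u[of a] permutes_not_in[OF p, of a] by (cases "a < k"; cases "a < r") auto
    then show False using ne by auto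
  qed
  have "det_rows k f = (\<Sum>p | p permutes {0..<k}. if p = id then (\<Prod>a = 0..<k. f a a) else 0)"
    unfolding det_rows_leibniz using z by (intro sum.cong) auto
  also have "\<dots> = (\<Prod>a = 0..<k. f a a)"
    using finite_permutations[of "{0..<k}"] by (simp add: permutes_id)
  finally show ?thesis by (simp add: atLeast0LessThan)
qed

text \<open>Jacobi's formula for the derivative of a determinant, with the cofactors written as
  determinants with a unit row.\<close>

lemma det_rows_has_derivative:
  fixes f :: "'v::real_normed_vector \<Rightarrow> nat \<Rightarrow> nat \<Rightarrow> complex"
  assumes "\<And>a i. a < k \<Longrightarrow> i < k \<Longrightarrow> ((\<lambda>x. f x a i) has_derivative f' a i) (at x)"
  shows "((\<lambda>x. det_rows k (f x)) has_derivative
     (\<lambda>h. \<Sum>a<k. \<Sum>i<k. f' a i h * det_rows k ((f x)(a := unit_row i)))) (at x)"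
proof -
  have "((\<lambda>x. det_rows k (f x)) has_derivative
     (\<lambda>h. \<Sum>p | p permutes {0..<k}. signof p *
        (\<Sum>a\<in>{0..<k}. f' a (p a) h * (\<Prod>b\<in>{0..<k}-{a}. f x b (p b))))) (at x)"
    unfolding det_rows_leibniz
    by (intro has_derivative_sum has_derivative_mult_right has_derivative_prod assms)
      (auto simp: permutes_atLeastLessThan_less)
  also have "(\<lambda>h. \<Sum>p | p permutes {0..<k}. signof p *
        (\<Sum>a\<in>{0..<k}. f' a (p a) h * (\<Prod>b\<in>{0..<k}-{a}. f x b (p b)))) =
     (\<lambda>h. \<Sum>a<k. \<Sum>i<k. f' a i h * det_rows k ((f x)(a := unit_row i)))"
  proof (rule ext)
    fix h
    have "(\<Sum>a<k. \<Sum>i<k. f' a i h * det_rows k ((f x)(a := unit_row i))) =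
       (\<Sum>a<k. det_rows k ((f x)(a := (\<lambda>i. f' a i h))))"
      by (intro sum.cong refl) (simp add: det_rows_row_expand[of _ k "f x" "\<lambda>i. f' _ i h"])
    also have "\<dots> = (\<Sum>a<k. \<Sum>p | p permutes {0..<k}. f' a (p a) h * (signof p * (\<Prod>b\<in>{0..<k}-{a}. f x b (p b))))"
      by (intro sum.cong refl) (simp add: det_rows_upd_leibniz)
    also have "\<dots> = (\<Sum>p | p permutes {0..<k}. \<Sum>a<k. f' a (p a) h * (signof p * (\<Prod>b\<in>{0..<k}-{a}. f x b (p b))))"
      by (rule sum.swap)
    finally show "(\<Sum>p | p permutes {0..<k}. signof p *
        (\<Sum>a\<in>{0..<k}. f' a (p a) h * (\<Prod>b\<in>{0..<k}-{a}. f x b (p b)))) =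
      (\<Sum>a<k. \<Sum>i<k. f' a i h * det_rows k ((f x)(a := unit_row i)))"
      by (simp add: sum_distrib_left algebra_simps atLeast0LessThan)
  qed
  finally show ?thesis .
qed

lemma det_rows_continuous:
  fixes f :: "'v::t2_space \<Rightarrow> nat \<Rightarrow> nat \<Rightarrow> complex"
  assumes "\<And>a i. a < k \<Longrightarrow> i < k \<Longrightarrow> continuous F (\<lambda>x. f x a i)"
  shows "continuous F (\<lambda>x. det_rows k (f x))"
  unfolding det_rows_leibniz
  by (intro continuous_intros assms) (auto simp: permutes_atLeastLessThan_less)

section \<open>Minors of S and the locus where its rank drops\<close>

definition skip :: "nat \<Rightarrow> nat \<Rightarrow> nat" where
  "skip r a = (if a < r then a else Suc a)"

text \<open>Inverse of \<open>skip r\<close> away from the deleted row; the value at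
  \<open>j = r\<close> is a dummy.\<close>

definition unskip :: "nat \<Rightarrow> nat \<Rightarrow> nat" where
  "unskip r j = (if j < r then j else j - 1)"

lemma unskip_skip [simp]: "unskip r (skip r a) = a"
  by (auto simp: skip_def unskip_def)

lemma skip_unskip [simp]: "j \<noteq> r \<Longrightarrow> skip r (unskip r j) = j"
  by (auto simp: skip_def unskip_def)

lemma skip_neq [simp]: "skip r a \<noteq> r" "r \<noteq> skip r a"
  by (auto simp: skip_def)

lemma skip_le: "a < k \<Longrightarrow> skip r a \<le> k"
  by (auto simp: skip_def)

lemma unskip_less: "j \<le> k \<Longrightarrow> r \<le> k \<Longrightarrow> j \<noteq> r \<Longrightarrow> unskip r j < k"
  by (auto simp: unskip_def)

lemma sum_skip:
  assumes "r \<le> k"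
  shows "(\<Sum>a<k. g (skip r a)) = (\<Sum>j\<in>{..k} - {r}. g j)"
  by (rule sum.reindex_bij_witness[of _ "unskip r" "skip r"])
    (use assms in \<open>auto simp: skip_le unskip_less\<close>)

definition S_at :: "pt \<Rightarrow> complex \<Rightarrow> complex \<Rightarrow> nat \<Rightarrow> nat \<Rightarrow> complex" where
  "S_at E x y j i = E (j, i) - (if j = i then x else 0) + (if j = Suc i then y else 0)"

definition minor_at :: "nat \<Rightarrow> pt \<Rightarrow> complex \<Rightarrow> complex \<Rightarrow> nat \<Rightarrow> complex" where
  "minor_at k E x y r = det_rows k (\<lambda>a. S_at E x y (skip r a))"

text \<open>The partial derivative of \<^term>\<open>minor_at k E x y r\<close> with respect to the entry \<open>(j, i)\<close>.\<close>

definition minor_cofactor :: "nat \<Rightarrow> pt \<Rightarrow> complex \<Rightarrow> complex \<Rightarrow> nat \<Rightarrow> nat \<Rightarrow> nat \<Rightarrow> complex" where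
  "minor_cofactor k E x y r i j =
     (if j = r then 0 else det_rows k ((\<lambda>a. S_at E x y (skip r a))(unskip r j := unit_row i)))"

lemma minor_at_has_derivative:
  fixes E :: "'v::real_normed_vector \<Rightarrow> pt"
  assumes r: "r \<le> k"
    and d: "\<And>j i. j \<le> k \<Longrightarrow> i < k \<Longrightarrow> ((\<lambda>p. S_at (E p) (x p) (y p) j i) has_derivative S' j i) (at p)"
  shows "((\<lambda>p. minor_at k (E p) (x p) (y p) r) has_derivative
    (\<lambda>h. \<Sum>j\<le>k. \<Sum>i<k. S' j i h * minor_cofactor k (E p) (x p) (y p) r i j)) (at p)"
proof -
  have "((\<lambda>p. minor_at k (E p) (x p) (y p) r) has_derivative
    (\<lambda>h. \<Sum>a<k. \<Sum>i<k. S' (skip r a) i h *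
       det_rows k ((\<lambda>a. S_at (E p) (x p) (y p) (skip r a))(a := unit_row i)))) (at p)"
    unfolding minor_at_def using r by (intro det_rows_has_derivative d) (auto simp: skip_le)
  also have "(\<lambda>h. \<Sum>a<k. \<Sum>i<k. S' (skip r a) i h *
       det_rows k ((\<lambda>a. S_at (E p) (x p) (y p) (skip r a))(a := unit_row i))) =
     (\<lambda>h. \<Sum>j\<le>k. \<Sum>i<k. S' j i h * minor_cofactor k (E p) (x p) (y p) r i j)"
  proof (rule ext)
    fix h
    let ?g = "\<lambda>j. \<Sum>i<k. S' j i h * minor_cofactor k (E p) (x p) (y p) r i j"
    have "(\<Sum>a<k. \<Sum>i<k. S' (skip r a) i h *
       det_rows k ((\<lambda>a. S_at (E p) (x p) (y p) (skip r a))(a := unit_row i))) = (\<Sum>a<k. ?g (skip r a))"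
      by (intro sum.cong refl) (simp add: minor_cofactor_def)
    also have "\<dots> = (\<Sum>j\<in>{..k} - {r}. ?g j)" by (rule sum_skip[OF r])
    also have "\<dots> = (\<Sum>j\<le>k. ?g j)"
      by (rule sum.mono_neutral_left) (auto simp: minor_cofactor_def)
    finally show "(\<Sum>a<k. \<Sum>i<k. S' (skip r a) i h *
       det_rows k ((\<lambda>a. S_at (E p) (x p) (y p) (skip r a))(a := unit_row i))) = (\<Sum>j\<le>k. ?g j)" .
  qed
  finally show ?thesis .
qed

definition rank_drops_kernel :: "nat \<Rightarrow> pt \<Rightarrow> complex \<Rightarrow> complex \<Rightarrow> (nat \<Rightarrow> complex) \<Rightarrow> bool" where
  "rank_drops_kernel k E x y v \<longleftrightarrow> (\<forall>j\<le>k. (\<Sum>i<k. S_at E x y j i * v i) = 0)"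

definition rank_drops :: "nat \<Rightarrow> pt \<Rightarrow> complex \<Rightarrow> complex \<Rightarrow> bool" where
  "rank_drops k E x y \<longleftrightarrow> (\<exists>v. (\<exists>i<k. v i \<noteq> 0) \<and> rank_drops_kernel k E x y v)"

lemma rank_drops_minor_at: "rank_drops k E x y \<Longrightarrow> minor_at k E x y r = 0"
  unfolding rank_drops_def rank_drops_kernel_def minor_at_def det_rows_zero_iff by (meson skip_le)

text \<open>Putting row \<open>j\<close> of S in place of the unit row gives a square matrix all of
  whose rows are rows of S. A nonzero kernel vector of S makes its determinant vanish.\<close>

lemma rank_drops_minor_cofactor_kernel:
  assumes s: "rank_drops k E x y" and "r \<le> k" "p \<le> k"
  shows "rank_drops_kernel k E x y (\<lambda>i. minor_cofactor k E x y r i p)"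
  unfolding rank_drops_kernel_def
proof (intro allI impI)
  fix j assume j: "j \<le> k"
  show "(\<Sum>i<k. S_at E x y j i * minor_cofactor k E x y r i p) = 0"
  proof (cases "p = r")
    case False
    have a: "unskip r p < k" using unskip_less assms False by simp
    have "(\<Sum>i<k. S_at E x y j i * minor_cofactor k E x y r i p) =
        det_rows k ((\<lambda>a. S_at E x y (skip r a))(unskip r p := S_at E x y j))"
      unfolding det_rows_row_expand[OF a, of _ "S_at E x y j"] using False by (simp add: minor_cofactor_def)
    also have "\<dots> = 0"
    proof -
      obtain v where "\<exists>i<k. v i \<noteq> 0" "\<forall>j\<le>k. (\<Sum>i<k. S_at E x y j i * v i) = 0"
        using s unfolding rank_drops_def rank_drops_kernel_def by blast
      then show ?thesis unfolding det_rows_zero_iff using j skip_le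
        by (intro exI[of _ v]) (auto simp: fun_upd_def)
    qed
    finally show ?thesis .
  qed (simp add: minor_cofactor_def)
qed

text \<open>By the adjugate identity the product is zero or the minor itself, and the minor vanishes
  where the rank drops.\<close>

lemma rank_drops_minor_cofactor_cokernel:
  assumes s: "rank_drops k E x y" and r: "r \<le> k" and iq: "i < k" "q < k"
  shows "(\<Sum>j\<le>k. minor_cofactor k E x y r q j * S_at E x y j i) = 0"
proof -
  let ?g = "\<lambda>j. minor_cofactor k E x y r q j * S_at E x y j i"
  have "(\<Sum>j\<le>k. ?g j) = (\<Sum>j\<in>{..k} - {r}. ?g j)"
    by (rule sum.mono_neutral_right) (auto simp: minor_cofactor_def)
  also have "\<dots> = (\<Sum>a<k. ?g (skip r a))" by (rule sum_skip[OF r, symmetric])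
  also have "\<dots> = (\<Sum>a<k. S_at E x y (skip r a) i *
      det_rows k ((\<lambda>a. S_at E x y (skip r a))(a := unit_row q)))"
    by (intro sum.cong refl) (simp add: minor_cofactor_def mult.commute)
  also have "\<dots> = (if i = q then minor_at k E x y r else 0)"
    unfolding minor_at_def by (rule det_rows_column[OF iq])
  finally show ?thesis using rank_drops_minor_at[OF s] by simp
qed

text \<open>The cofactor is the determinant of the rows other than \<open>r\<close> and
  \<open>s\<close> together with the unit row at \<open>c\<close>. If it is nonzero, only the zero
  vector is killed by all of these rows.\<close>

lemma minor_cofactor_nonzero_inj:
  assumes nz: "minor_cofactor k E x y r c s \<noteq> 0" and le: "r \<le> k" "s \<le> k" and c: "c < k" "v c = 0"
    and v: "\<And>j. j \<le> k \<Longrightarrow> j \<noteq> r \<Longrightarrow> j \<noteq> s \<Longrightarrow> (\<Sum>i<k. S_at E x y j i * v i) = 0"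
    and i: "i < k"
  shows "v i = 0"
proof (rule ccontr)
  assume "v i \<noteq> 0"
  have rs: "s \<noteq> r" using nz by (auto simp: minor_cofactor_def)
  have "det_rows k ((\<lambda>a. S_at E x y (skip r a))(unskip r s := unit_row c)) = 0"
    unfolding det_rows_zero_iff
  proof (intro exI[of _ v] conjI allI impI)
    show "\<exists>i<k. v i \<noteq> 0" using i \<open>v i \<noteq> 0\<close> by blast
    fix a assume a: "a < k"
    show "(\<Sum>i<k. ((\<lambda>a. S_at E x y (skip r a))(unskip r s := unit_row c)) a i * v i) = 0"
    proof (cases "a = unskip r s")
      case True
      have "(\<Sum>i<k. unit_row c i * v i) = (\<Sum>i<k. if i = c then v i else 0)"
        by (intro sum.cong) (auto simp: unit_row_def)
      then show ?thesis using True c by simp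
    next
      case False
      then have "skip r a \<noteq> s" using unskip_skip by metis
      then show ?thesis using False v[of "skip r a"] skip_le[OF a] by simp
    qed
  qed
  then show False using nz rs by (simp add: minor_cofactor_def)
qed

text \<open>The combination \<open>v c * w i - w c * v i\<close> has zero entry at \<open>c\<close>,
  so the common kernel of the rows other than \<open>r\<close> and \<open>s\<close> is at most
  one-dimensional.\<close>

lemma minor_cofactor_nonzero_proportional:
  assumes nz: "minor_cofactor k E x y r c s \<noteq> 0" and le: "r \<le> k" "s \<le> k" "c < k"
    and v: "\<And>j. j \<le> k \<Longrightarrow> j \<noteq> r \<Longrightarrow> j \<noteq> s \<Longrightarrow> (\<Sum>i<k. S_at E x y j i * v i) = 0"
    and w: "\<And>j. j \<le> k \<Longrightarrow> j \<noteq> r \<Longrightarrow> j \<noteq> s \<Longrightarrow> (\<Sum>i<k. S_at E x y j i * w i) = 0"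
    and i: "i < k"
  shows "v c * w i = w c * v i"
proof -
  have "(\<lambda>i. v c * w i - w c * v i) i = 0"
  proof (rule minor_cofactor_nonzero_inj[OF nz])
    fix j assume j: "j \<le> k" "j \<noteq> r" "j \<noteq> s"
    have "(\<Sum>i<k. S_at E x y j i * (v c * w i - w c * v i)) =
       v c * (\<Sum>i<k. S_at E x y j i * w i) - w c * (\<Sum>i<k. S_at E x y j i * v i)"
      by (simp add: sum_distrib_left sum_subtractf algebra_simps)
    then show "(\<Sum>i<k. S_at E x y j i * (v c * w i - w c * v i)) = 0" using v w j by simp
  qed (use le i in auto)
  then show ?thesis by simp
qed

text \<open>Each vanishing minor gives a kernel vector of S with one row removed. Both vectors lie
  on the line cut out by the remaining \<open>k - 1\<close> rows, so one and the same vector is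
  killed by every row. Following a zero thereby becomes a problem of two equations in two
  unknowns.\<close>

lemma two_minors_rank_drops:
  assumes nz: "minor_cofactor k E x y r c s \<noteq> 0" and le: "r \<le> k" "s \<le> k" "c < k"
    and z: "minor_at k E x y r = 0" "minor_at k E x y s = 0"
  shows "rank_drops k E x y"
proof -
  have rs: "s \<noteq> r" using nz by (auto simp: minor_cofactor_def)
  have ex: "\<exists>v. (\<exists>i<k. v i \<noteq> 0) \<and> (\<forall>j\<le>k. j \<noteq> q \<longrightarrow> (\<Sum>i<k. S_at E x y j i * v i) = 0)"
    if q: "q \<le> k" and mq: "minor_at k E x y q = 0" for q
  proof -
    obtain v where v: "\<exists>i<k. v i \<noteq> 0" "\<forall>a<k. (\<Sum>i<k. S_at E x y (skip q a) i * v i) = 0"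
      using mq unfolding minor_at_def det_rows_zero_iff by blast
    have "(\<Sum>i<k. S_at E x y j i * v i) = 0" if "j \<le> k" "j \<noteq> q" for j
      using v(2) unskip_less[OF that(1) q that(2)] skip_unskip[OF that(2)] by force
    then show ?thesis using v(1) by blast
  qed
  obtain v where v: "\<exists>i<k. v i \<noteq> 0" "\<And>j. j \<le> k \<Longrightarrow> j \<noteq> r \<Longrightarrow> (\<Sum>i<k. S_at E x y j i * v i) = 0"
    using ex[OF le(1) z(1)] by blast
  obtain w where w: "\<exists>i<k. w i \<noteq> 0" "\<And>j. j \<le> k \<Longrightarrow> j \<noteq> s \<Longrightarrow> (\<Sum>i<k. S_at E x y j i * w i) = 0"
    using ex[OF le(2) z(2)] by blast
  have wc: "w c \<noteq> 0"
    using minor_cofactor_nonzero_inj[OF nz le(1,2), of w] le w by metis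
  have vw: "v c * w i = w c * v i" if "i < k" for i
    by (rule minor_cofactor_nonzero_proportional[OF nz le]) (use v w that in auto)
  have "(\<Sum>i<k. S_at E x y r i * v i) = 0"
  proof -
    have "w c * (\<Sum>i<k. S_at E x y r i * v i) = (\<Sum>i<k. S_at E x y r i * (w c * v i))"
      by (simp add: sum_distrib_left algebra_simps)
    also have "\<dots> = (\<Sum>i<k. S_at E x y r i * (v c * w i))"
      using vw by (intro sum.cong) auto
    also have "\<dots> = v c * (\<Sum>i<k. S_at E x y r i * w i)"
      by (simp add: sum_distrib_left algebra_simps)
    also have "\<dots> = 0" using w(2)[of r] le rs by simp
    finally show ?thesis using wc by simp
  qed
  then have "rank_drops_kernel k E x y v" unfolding rank_drops_kernel_def using v(2) by metis
  then show ?thesis using v(1) unfolding rank_drops_def by blast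
qed

lemma rank_drops_kernel_proportional:
  assumes nz: "minor_cofactor k E x y r c s \<noteq> 0" and le: "r \<le> k" "s \<le> k" "c < k"
    and v: "rank_drops_kernel k E x y v" and w: "rank_drops_kernel k E x y w" and i: "i < k" "i' < k"
  shows "v i * w i' = v i' * w i"
proof -
  have p: "v c * w i = w c * v i" if "i < k" for i
    by (rule minor_cofactor_nonzero_proportional[OF nz le]) (use v w that in \<open>auto simp:
        rank_drops_kernel_def\<close>)
  show ?thesis
  proof (cases "v c = 0")
    case True
    then have "v i = 0" if "i < k" for i
      using minor_cofactor_nonzero_inj[OF nz le(1,2,3), of v] v that by (auto simp: rank_drops_kernel_def)
    then show ?thesis using i by simp
  next
    case False
    have "v c * (v i * w i') = v c * (v i' * w i)"
      using p[OF i(1)] p[OF i(2)] by (metis mult.assoc mult.commute)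
    then show ?thesis using False by simp
  qed
qed

section \<open>Simple zeros move holomorphically\<close>

text \<open>By the chain rule: \<open>x\<close> occurs in S at the entries \<open>(i, i)\<close>
  with sign minus, and \<open>y\<close> at the entries \<open>(i + 1, i)\<close> with sign
  plus.\<close>

definition minor_at_dx :: "nat \<Rightarrow> pt \<Rightarrow> complex \<Rightarrow> complex \<Rightarrow> nat \<Rightarrow> complex" where
  "minor_at_dx k E x y r = - (\<Sum>i<k. minor_cofactor k E x y r i i)"

definition minor_at_dy :: "nat \<Rightarrow> pt \<Rightarrow> complex \<Rightarrow> complex \<Rightarrow> nat \<Rightarrow> complex" where
  "minor_at_dy k E x y r = (\<Sum>i<k. minor_cofactor k E x y r i (Suc i))"

definition minor_at_dir :: "nat \<Rightarrow> pt \<Rightarrow> pt \<Rightarrow> complex \<Rightarrow> complex \<Rightarrow> nat \<Rightarrow> complex" where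
  "minor_at_dir k A E x y r = (\<Sum>j\<le>k. \<Sum>i<k. A (j, i) * minor_cofactor k E x y r i j)"

definition minor_jacobian :: "nat \<Rightarrow> pt \<Rightarrow> complex \<Rightarrow> complex \<Rightarrow> nat \<Rightarrow> nat \<Rightarrow> complex" where
  "minor_jacobian k E x y r s =
     minor_at_dx k E x y r * minor_at_dy k E x y s - minor_at_dy k E x y r * minor_at_dx k E x y s"

definition affine_line :: "pt \<Rightarrow> pt \<Rightarrow> complex \<Rightarrow> pt" where
  "affine_line E A t = (\<lambda>b. E b + t * A b)"

text \<open>The same pair \<open>r\<close>, \<open>s\<close> serves twice: the cofactor makes these
  two minors local equations of the rank drop, and the Jacobian allows them to be solved for
  \<open>x\<close> and \<open>y\<close>.\<close>

definition nondeg_zero :: "nat \<Rightarrow> pt \<Rightarrow> complex \<Rightarrow> complex \<Rightarrow> bool" where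
  "nondeg_zero k E x y \<longleftrightarrow> rank_drops k E x y \<and>
     (\<exists>r s c. r \<le> k \<and> s \<le> k \<and> c < k \<and> minor_cofactor k E x y r c s \<noteq> 0 \<and> minor_jacobian k E x y r s \<noteq> 0)"

lemma minor_at_along_has_derivative:
  fixes x y t :: "'v::real_normed_vector \<Rightarrow> complex"
  assumes r: "r \<le> k" and t: "(t has_derivative t') (at p)"
    and x: "(x has_derivative x') (at p)" and y: "(y has_derivative y') (at p)"
  shows "((\<lambda>p. minor_at k (affine_line E A (t p)) (x p) (y p) r) has_derivative
    (\<lambda>h. t' h * minor_at_dir k A (affine_line E A (t p)) (x p) (y p) r +
         x' h * minor_at_dx k (affine_line E A (t p)) (x p) (y p) r +
         y' h * minor_at_dy k (affine_line E A (t p)) (x p) (y p) r)) (at p)"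
proof -
  let ?Z = "\<lambda>i j. minor_cofactor k (affine_line E A (t p)) (x p) (y p) r i j"
  let ?S = "\<lambda>(j::nat) (i::nat) h. t' h * A (j, i) - (if j = i then x' h else 0) + (if j = Suc i then y'
      h else 0)"
  have "((\<lambda>p. minor_at k (affine_line E A (t p)) (x p) (y p) r) has_derivative
    (\<lambda>h. \<Sum>j\<le>k. \<Sum>i<k. ?S j i h * ?Z i j)) (at p)"
  proof (rule minor_at_has_derivative[OF r])
    fix j i :: nat
    have 1: "((\<lambda>p. if j = i then x p else 0) has_derivative (\<lambda>h. if j = i then x' h else 0)) (at p)"
      using x by (cases "j = i") auto
    have 2: "((\<lambda>p. if j = Suc i then y p else 0) has_derivative (\<lambda>h. if j = Suc i then y' h else 0)) (at p)"
      using y by (cases "j = Suc i") auto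
    show "((\<lambda>p. S_at (affine_line E A (t p)) (x p) (y p) j i) has_derivative ?S j i) (at p)"
      using has_derivative_add[OF has_derivative_diff[OF has_derivative_add[OF
          has_derivative_const[of "E (j, i)"] has_derivative_mult_left[OF t, of "A (j, i)"]] 1] 2]
      by (simp add: S_at_def affine_line_def)
  qed
  also have "(\<lambda>h. \<Sum>j\<le>k. \<Sum>i<k. ?S j i h * ?Z i j) =
    (\<lambda>h. t' h * minor_at_dir k A (affine_line E A (t p)) (x p) (y p) r +
         x' h * minor_at_dx k (affine_line E A (t p)) (x p) (y p) r +
         y' h * minor_at_dy k (affine_line E A (t p)) (x p) (y p) r)"
  proof (rule ext)
    fix h
    have 1: "(\<Sum>j\<le>k. \<Sum>i<k. (if j = i then x' h else 0) * ?Z i j) = (\<Sum>i<k. x' h * ?Z i i)"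
      by (subst sum.swap, intro sum.cong refl) (simp add: if_distribR if_distrib[of "\<lambda>u. u * _"] cong:
          if_cong)
    have 2: "(\<Sum>j\<le>k. \<Sum>i<k. (if j = Suc i then y' h else 0) * ?Z i j) = (\<Sum>i<k. y' h * ?Z i (Suc i))"
      by (subst sum.swap, intro sum.cong refl) (simp add: if_distribR if_distrib[of "\<lambda>u. u * _"] cong:
          if_cong)
    show "(\<Sum>j\<le>k. \<Sum>i<k. ?S j i h * ?Z i j) = t' h * minor_at_dir k A (affine_line E A (t p)) (x p) (y p) r +
         x' h * minor_at_dx k (affine_line E A (t p)) (x p) (y p) r +
         y' h * minor_at_dy k (affine_line E A (t p)) (x p) (y p) r"
      unfolding minor_at_dir_def minor_at_dx_def minor_at_dy_def
      by (simp only: distrib_right left_diff_distrib sum.distrib sum_subtractf 1 2)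
        (simp add: sum_distrib_left algebra_simps sum_negf)
  qed
  finally show ?thesis .
qed

lemma minor_cofactor_along_continuous:
  fixes x y t :: "'v::t2_space \<Rightarrow> complex"
  assumes t: "continuous F t" and x: "continuous F x" and y: "continuous F y"
  shows "continuous F (\<lambda>p. minor_cofactor k (affine_line E A (t p)) (x p) (y p) r i j)"
proof (cases "j = r")
  case False
  have 1: "continuous F (\<lambda>p. if j' = i' then x p else 0)" for j' i' :: nat using x by (cases "j' = i'") auto
  have 2: "continuous F (\<lambda>p. if j' = Suc i' then y p else 0)" for j' i' using y by (cases "j' = Suc i'") auto
  have S: "continuous F (\<lambda>p. S_at (affine_line E A (t p)) (x p) (y p) j' i')" for j' i'
    unfolding S_at_def affine_line_def by (intro continuous_intros t 1 2)
  have "continuous F (\<lambda>p. det_rows k ((\<lambda>a. S_at (affine_line E A (t p)) (x p) (y p) (skip r a))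
      (unskip r j := unit_row i)))"
  proof (rule det_rows_continuous)
    fix a c
    show "continuous F (\<lambda>p. ((\<lambda>a. S_at (affine_line E A (t p)) (x p) (y p) (skip r a))
      (unskip r j := unit_row i)) a c)"
      using S by (cases "a = unskip r j") auto
  qed
  then show ?thesis using False by (simp add: minor_cofactor_def)
qed (simp add: minor_cofactor_def)

lemma minor_at_partials_along_continuous:
  fixes x y t :: "'v::t2_space \<Rightarrow> complex"
  assumes "continuous F t" "continuous F x" "continuous F y"
  shows "continuous F (\<lambda>p. minor_at_dx k (affine_line E A (t p)) (x p) (y p) r)"
    and "continuous F (\<lambda>p. minor_at_dy k (affine_line E A (t p)) (x p) (y p) r)"
    and "continuous F (\<lambda>p. minor_at_dir k B (affine_line E A (t p)) (x p) (y p) r)"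
  unfolding minor_at_dx_def minor_at_dy_def minor_at_dir_def
  by (intro continuous_intros minor_cofactor_along_continuous assms)+

lemma affine_line_0 [simp]: "affine_line E A 0 = E"
  by (simp add: affine_line_def)

text \<open>The inverse function theorem is applied to the map from \<open>(t, x, y)\<close> to
  \<open>t\<close> and the minors \<open>r\<close> and \<open>s\<close>; carrying \<open>t\<close>
  along makes it an implicit function theorem. The last property relates the velocity
  \<open>(X, Y)\<close> of the zero to the variation of every minor, not only of the two used as
  equations.\<close>

lemma nondeg_zero_persists:
  assumes nd: "nondeg_zero k E x0 y0"
  obtains \<xi> \<eta> X Y where "\<xi> 0 = x0" "\<eta> 0 = y0"
    "(\<xi> has_field_derivative X) (at 0)" "(\<eta> has_field_derivative Y) (at 0)"
    "\<forall>\<^sub>F t in nhds 0. nondeg_zero k (affine_line E A t) (\<xi> t) (\<eta> t)"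
    "\<And>r. r \<le> k \<Longrightarrow> minor_at_dir k A E x0 y0 r + X * minor_at_dx k E x0 y0 r + Y * minor_at_dy k E x0 y0 r = 0"
proof -
  from nd obtain r s c where le: "r \<le> k" "s \<le> k" "c < k" and nz: "minor_cofactor k E x0 y0 r c s \<noteq> 0"
    and jac: "minor_jacobian k E x0 y0 r s \<noteq> 0" and sg: "rank_drops k E x0 y0"
    unfolding nondeg_zero_def by blast
  define \<Phi> where "\<Phi> r p = minor_at k (affine_line E A (fst p)) (fst (snd p)) (snd (snd p)) r"
    for r and p :: "complex \<times> complex \<times> complex"
  define g1 where "g1 r p = minor_at_dir k A (affine_line E A (fst p)) (fst (snd p)) (snd (snd p)) r"
    for r and p :: "complex \<times> complex \<times> complex"
  define g2 where "g2 r p = minor_at_dx k (affine_line E A (fst p)) (fst (snd p)) (snd (snd p)) r"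
    for r and p :: "complex \<times> complex \<times> complex"
  define g3 where "g3 r p = minor_at_dy k (affine_line E A (fst p)) (fst (snd p)) (snd (snd p)) r"
    for r and p :: "complex \<times> complex \<times> complex"
  define F where "F p = (fst p, \<Phi> r p, \<Phi> s p)" for p
  define F1 where "F1 p h = (fst h, fst h * g1 r p + fst (snd h) * g2 r p + snd (snd h) * g3 r p,
      fst h * g1 s p + fst (snd h) * g2 s p + snd (snd h) * g3 s p)"
    for p and h :: "complex \<times> complex \<times> complex"
  have bl: "bounded_linear (F1 p)" for p
    unfolding F1_def by (intro bounded_linear_intros)
  define F' where "F' p = Blinfun (F1 p)" for p
  have F'_apply: "blinfun_apply (F' p) = F1 p" for p
    unfolding F'_def by (rule bounded_linear_Blinfun_apply[OF bl])
  have d\<Phi>: "(\<Phi> q has_derivative (\<lambda>h. fst h * g1 q p + fst (snd h) * g2 q p + snd (snd h) * g3 q p)) (at p)"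
    if "q \<le> k" for q p
    unfolding \<Phi>_def g1_def g2_def g3_def
    by (intro minor_at_along_has_derivative that derivative_intros)
  have dF: "(F has_derivative blinfun_apply (F' p)) (at p)" for p
    unfolding F'_apply unfolding F_def F1_def
    by (intro has_derivative_Pair d\<Phi> le has_derivative_fst has_derivative_ident)
  have cont: "continuous_on UNIV (g1 q)" "continuous_on UNIV (g2 q)" "continuous_on UNIV (g3 q)" for q
    unfolding continuous_on_eq_continuous_within g1_def g2_def g3_def
    by (intro ballI minor_at_partials_along_continuous continuous_intros)+
  have contF: "continuous_on UNIV F'"
    by (rule continuous_on_blinfun_componentwise)
      (unfold F'_apply F1_def, intro continuous_intros cont)
  define p0 where "p0 = (0::complex, x0, y0)"
  define J where "J = minor_jacobian k E x0 y0 r s"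
  have gp0: "g2 q p0 = minor_at_dx k E x0 y0 q" "g3 q p0 = minor_at_dy k E x0 y0 q"
    "g1 q p0 = minor_at_dir k A E x0 y0 q" for q
    by (simp_all add: g1_def g2_def g3_def p0_def)
  have J: "J = g2 r p0 * g3 s p0 - g3 r p0 * g2 s p0" and J0: "J \<noteq> 0"
    using jac by (simp_all add: J_def minor_jacobian_def gp0)
  \<comment> \<open>Cramer's rule: the inverse of \<open>F1 p0\<close>, a block triangular map whose
    lower block has determinant \<open>J\<close>.\<close>
  define G1 where "G1 h = (fst h,
     ((fst (snd h) - fst h * g1 r p0) * (g3 s p0 / J) - (snd (snd h) - fst h * g1 s p0) * (g3 r p0 / J)),
     ((snd (snd h) - fst h * g1 s p0) * (g2 r p0 / J) - (fst (snd h) - fst h * g1 r p0) * (g2 s p0 / J)))"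
    for h :: "complex \<times> complex \<times> complex"
  have blG: "bounded_linear G1"
    unfolding G1_def by (intro bounded_linear_intros)
  have GF: "G1 (F1 p0 h) = h" for h
  proof -
    have 1: "(u * a + v * b) * (d / J) - (u * c + v * d) * (b / J) = u"
      and 2: "(u * c + v * d) * (a / J) - (u * a + v * b) * (c / J) = v"
      if "J = a * d - b * c" for u v a b c d
    proof -
      have "(u * a + v * b) * (d / J) - (u * c + v * d) * (b / J) = u * (a * d - b * c) / J"
        by (simp add: diff_divide_distrib algebra_simps add_divide_distrib)
      then show "(u * a + v * b) * (d / J) - (u * c + v * d) * (b / J) = u" using that J0 by simp
      have "(u * c + v * d) * (a / J) - (u * a + v * b) * (c / J) = v * (a * d - b * c) / J"
        by (simp add: diff_divide_distrib algebra_simps add_divide_distrib)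
      then show "(u * c + v * d) * (a / J) - (u * a + v * b) * (c / J) = v" using that J0 by simp
    qed
    show ?thesis
      by (cases h) (simp add: G1_def F1_def 1[OF J, simplified] 2[OF J, simplified])
  qed
  have inv: "Blinfun G1 o\<^sub>L F' p0 = id_blinfun"
    by (rule blinfun_eqI) (simp add: bounded_linear_Blinfun_apply[OF blG] F'_apply GF)
  obtain U' V g g' where UV: "open U'" "p0 \<in> U'" "open V" "F p0 \<in> V" "homeomorphism U' V F g"
    and dg: "\<And>y. y \<in> V \<Longrightarrow> (g has_derivative (g' y)) (at y)"
    and g'eq: "\<And>y. y \<in> V \<Longrightarrow> g' y = Hilbert_Choice.inv (blinfun_apply (F' (g y)))"
    and bij: "\<And>y. y \<in> V \<Longrightarrow> bij (blinfun_apply (F' (g y)))"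
    using inverse_function_theorem[OF open_UNIV dF contF UNIV_I inv] by metis
  have Fp0: "F p0 = (0, 0, 0)"
    using rank_drops_minor_at[OF sg] by (simp add: F_def \<Phi>_def p0_def)
  have V0: "(0, 0, 0) \<in> V" using UV Fp0 by simp
  have g0: "g (0, 0, 0) = p0"
    using UV Fp0 unfolding homeomorphism_def by metis
  have Fg: "F (g y) = y" if "y \<in> V" for y
    using UV(5) that unfolding homeomorphism_def by metis
  \<comment> \<open>The derivative of the local inverse is delivered as a choice-based inverse
    function; for a bijection it coincides with the left inverse \<open>G1\<close>.\<close>
  have g'0: "g' (0, 0, 0) = G1"
  proof (rule ext)
    fix h
    have b: "bij (F1 p0)" using bij[OF V0] by (simp add: g0 F'_apply)
    have "g' (0,0,0) h = Hilbert_Choice.inv (F1 p0) h" by (simp add: g'eq[OF V0] g0 F'_apply)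
    also have "\<dots> = G1 (F1 p0 (Hilbert_Choice.inv (F1 p0) h))" by (simp add: GF)
    also have "\<dots> = G1 h" using b by (simp add: bij_is_surj surj_f_inv_f)
    finally show "g' (0,0,0) h = G1 h" .
  qed
  define \<gamma> where "\<gamma> t = g (t, 0, 0)" for t :: complex
  have d\<gamma>: "(\<gamma> has_derivative (\<lambda>t. G1 (t, 0, 0))) (at 0)"
    unfolding \<gamma>_def
    by (rule has_derivative_compose[of "\<lambda>t. (t, 0, 0)" "\<lambda>t. (t, 0, 0)" 0 UNIV g G1])
      (use dg[OF V0] g'0 in \<open>auto intro!: derivative_intros\<close>)
  define X where "X = fst (snd (G1 (1, 0, 0)))"
  define Y where "Y = snd (snd (G1 (1, 0, 0)))"
  define \<xi> where "\<xi> t = fst (snd (\<gamma> t))" for t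
  define \<eta> where "\<eta> t = snd (snd (\<gamma> t))" for t
  have G1t: "fst (snd (G1 (t, 0, 0))) = X * t" "snd (snd (G1 (t, 0, 0))) = Y * t" for t
    by (simp_all add: G1_def X_def Y_def algebra_simps)
  have d\<xi>: "(\<xi> has_field_derivative X) (at 0)"
    unfolding \<xi>_def has_field_derivative_def
    using has_derivative_fst[OF has_derivative_snd[OF d\<gamma>]] by (simp add: G1t)
  have d\<eta>: "(\<eta> has_field_derivative Y) (at 0)"
    unfolding \<eta>_def has_field_derivative_def
    using has_derivative_snd[OF has_derivative_snd[OF d\<gamma>]] by (simp add: G1t)
  have ev: "\<forall>\<^sub>F t in nhds 0. (t::complex, 0, 0) \<in> V"
  proof -
    have "open ((\<lambda>t::complex. (t, 0::complex, 0::complex)) -` V)"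
      by (rule open_vimage[OF UV(3)]) (intro continuous_intros)
    then show ?thesis using V0 unfolding eventually_nhds by (metis vimage_eq)
  qed
  have \<gamma>F: "fst (\<gamma> t) = t" "\<Phi> r (\<gamma> t) = 0" "\<Phi> s (\<gamma> t) = 0" if "(t, 0, 0) \<in> V" for t
    using Fg[OF that] by (simp_all add: \<gamma>_def F_def)
  have cd: "continuous (at 0) \<xi>" "continuous (at 0) \<eta>"
    using d\<xi> d\<eta> by (simp_all add: DERIV_isCont)
  have \<xi>0: "\<xi> 0 = x0" "\<eta> 0 = y0" by (simp_all add: \<xi>_def \<eta>_def \<gamma>_def g0 p0_def)
  have nhds_ne: "\<forall>\<^sub>F t in nhds 0. f t \<noteq> 0" if "continuous (at 0) f" "f 0 \<noteq> 0" for f :: "complex \<Rightarrow> complex"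
    using that tendsto_imp_eventually_ne[of f "f 0" "nhds 0" 0] unfolding continuous_at
        tendsto_at_iff_tendsto_nhds by auto
  have e1: "\<forall>\<^sub>F t in nhds 0. minor_cofactor k (affine_line E A t) (\<xi> t) (\<eta> t) r c s \<noteq> 0"
    by (rule nhds_ne) (use nz \<xi>0 in \<open>auto intro!: minor_cofactor_along_continuous cd\<close>)
  have e2: "\<forall>\<^sub>F t in nhds 0. minor_jacobian k (affine_line E A t) (\<xi> t) (\<eta> t) r s \<noteq> 0"
    by (rule nhds_ne)
      (use jac \<xi>0 in \<open>auto simp: minor_jacobian_def intro!: continuous_intros
          minor_at_partials_along_continuous cd\<close>)
  have e3: "\<forall>\<^sub>F t in nhds 0. nondeg_zero k (affine_line E A t) (\<xi> t) (\<eta> t)"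
    using e1 e2 ev
  proof eventually_elim
    case (elim t)
    have "rank_drops k (affine_line E A t) (\<xi> t) (\<eta> t)"
      by (rule two_minors_rank_drops[OF elim(1) le])
        (use \<gamma>F[OF elim(3)] in \<open>simp_all add: \<Phi>_def \<xi>_def \<eta>_def\<close>)
    then show ?case using elim le unfolding nondeg_zero_def by blast
  qed
  \<comment> \<open>The rank drops along the whole curve, so every minor vanishes identically on it
    near \<open>t = 0\<close>; the relation is the derivative of that identity.\<close>
  have rel: "minor_at_dir k A E x0 y0 q + X * minor_at_dx k E x0 y0 q + Y * minor_at_dy k E x0 y0 q = 0"
      if q: "q \<le> k" for q
  proof -
    have "((\<lambda>t. minor_at k (affine_line E A t) (\<xi> t) (\<eta> t) q) has_derivative
      (\<lambda>h. h * minor_at_dir k A (affine_line E A 0) (\<xi> 0) (\<eta> 0) q +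
         X * h * minor_at_dx k (affine_line E A 0) (\<xi> 0) (\<eta> 0) q +
         Y * h * minor_at_dy k (affine_line E A 0) (\<xi> 0) (\<eta> 0) q)) (at 0)"
      by (rule minor_at_along_has_derivative[OF q])
        (use d\<xi> d\<eta> in \<open>auto simp: has_field_derivative_def\<close>)
    moreover have "\<forall>\<^sub>F t in nhds 0. minor_at k (affine_line E A t) (\<xi> t) (\<eta> t) q = 0"
      using e3 by eventually_elim (simp add: nondeg_zero_def rank_drops_minor_at)
    then have "((\<lambda>t. minor_at k (affine_line E A t) (\<xi> t) (\<eta> t) q) has_derivative (\<lambda>h. 0)) (at 0)"
      by (intro has_derivative_transform_eventually[OF has_derivative_const[of 0 "at 0"]])
        (auto simp: eventually_at_filter dest: eventually_nhds_x_imp_x elim: eventually_mono)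
    ultimately have "(\<lambda>h. h * minor_at_dir k A (affine_line E A 0) (\<xi> 0) (\<eta> 0) q +
         X * h * minor_at_dx k (affine_line E A 0) (\<xi> 0) (\<eta> 0) q +
         Y * h * minor_at_dy k (affine_line E A 0) (\<xi> 0) (\<eta> 0) q) = (\<lambda>h. 0)"
      by (rule has_derivative_unique)
    from fun_cong[OF this, of 1] show ?thesis by (simp add: \<xi>0)
  qed
  show thesis by (rule that[OF \<xi>0 d\<xi> d\<eta> e3 rel])
qed

section \<open>The explicit bracket\<close>

text \<open>
  The constant matrix congruent to \<open>y e\<^bsub>p,q\<^esub>\<close> modulo left and right multiples of \<open>S\<close>, obtained by
  telescoping \<open>y e\<^bsub>p,q\<^esub> - y e\<^bsub>p-1,q-1\<^esub> \<equiv> e\<^bsub>p-1,q\<^esub> E - E e\<^bsub>p-1,q\<^esub>\<close> along a diagonal, towards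
  smaller indices if \<open>q < p\<close> and towards larger ones otherwise.
\<close>

definition y_reduction :: "nat \<Rightarrow> pt \<Rightarrow> nat \<Rightarrow> nat \<Rightarrow> label \<Rightarrow> complex" where
  "y_reduction k E p q = (\<lambda>(b, a).
     if q < p then
       (if b < p \<and> p \<le> b + q + 1 then E (q + 1 + b - p, a) else 0) -
       (if a \<le> q then E (b, p + a - (q + 1)) else 0)
     else
       (if q < a then E (b, p + a - (q + 1)) else 0) -
       (if p \<le> b \<and> b + q < k + p then E (q + 1 + b - p, a) else 0))"

text \<open>
  Reducing once turns \<open>xy (J\<^sub>0 \<xi> J\<^sub>1 - J\<^sub>1 \<xi> J\<^sub>0)\<close> into \<open>y (E \<xi> J\<^sub>1 - J\<^sub>1 \<xi> E)\<close>; here \<open>\<xi>\<close> is the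
  differential of the coordinate \<open>(j, i)\<close>.
\<close>

definition hilb_bracket :: "nat \<Rightarrow> bivector" where
  "hilb_bracket k E = (\<lambda>(j, i) b.
     (if 1 \<le> j then \<Sum>p\<le>k. E (p, i) * y_reduction k E p (j - 1) b else 0) -
     (\<Sum>q<k. E (j, q) * y_reduction k E (i + 1) q b))"

text \<open>The equations \<open>Z S(x, y) = 0\<close> and \<open>S(x, y) Z = 0\<close>, solved for
  the terms containing \<open>E\<close>. The case distinctions come from the bottom row of
  \<open>J\<^sub>0\<close> and the top row of \<open>J\<^sub>1\<close>, which are zero.\<close>

definition annihilates :: "nat \<Rightarrow> pt \<Rightarrow> complex \<Rightarrow> complex \<Rightarrow> (nat \<Rightarrow> nat \<Rightarrow> complex) \<Rightarrow> bool" where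
  "annihilates k E x y Z \<longleftrightarrow>
     (\<forall>q<k. \<forall>i<k. (\<Sum>b\<le>k. Z q b * E (b, i)) = x * Z q i - y * Z q (Suc i)) \<and>
     (\<forall>j\<le>k. \<forall>p\<le>k. (\<Sum>a<k. E (j, a) * Z a p) =
        (if j < k then x * Z j p else 0) - (if 1 \<le> j then y * Z (j - 1) p else 0))"

text \<open>Pairing with \<open>Z\<close> turns the reduction into entries of \<open>E Z\<close> and
  \<open>Z E\<close> along one diagonal, which annihilation rewrites. For \<open>q < p\<close> the
  \<open>x\<close>-terms cancel and the \<open>y\<close>-terms telescope, stopping at row 0, where
  \<open>J\<^sub>1\<close> is zero. Otherwise all \<open>y\<close>-terms but one cancel and the
  \<open>x\<close>-terms telescope, stopping at row \<open>k\<close>, where \<open>J\<^sub>0\<close>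
  is zero.\<close>

lemma y_reduction_pairing:
  assumes Z: "annihilates k E x y Z" and p: "p \<le> k" and q: "q < k"
  shows "(\<Sum>b\<le>k. \<Sum>a<k. y_reduction k E p q (b, a) * Z a b) = y * Z q p"
proof -
  define EZ where "EZ j p = (\<Sum>a<k. E (j, a) * Z a p)" for j p
  define ZE where "ZE q i = (\<Sum>b\<le>k. Z q b * E (b, i))" for q i
  have EZ: "EZ j p = (if j < k then x * Z j p else 0) - (if 1 \<le> j then y * Z (j - 1) p else 0)"
    if "j \<le> k" "p \<le> k" for j p using Z that unfolding annihilates_def EZ_def by blast
  have ZE: "ZE q i = x * Z q i - y * Z q (Suc i)" if "q < k" "i < k" for q i
    using Z that unfolding annihilates_def ZE_def by blast
  have sE: "(\<Sum>b\<le>k. \<Sum>a<k. (if P b then E (f b, a) else 0) * Z a b) = (\<Sum>b | b \<le> k \<and> P b. EZ (f b) b)"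
    for P f
  proof -
    have "(\<Sum>b\<le>k. \<Sum>a<k. (if P b then E (f b, a) else 0) * Z a b) = (\<Sum>b\<le>k. if P b then EZ (f b) b else 0)"
      by (intro sum.cong) (auto simp: EZ_def)
    also have "\<dots> = (\<Sum>b | b \<le> k \<and> P b. EZ (f b) b)"
      by (subst sum.inter_filter[symmetric]) (auto intro!: sum.cong)
    finally show ?thesis .
  qed
  have sF: "(\<Sum>b\<le>k. \<Sum>a<k. (if P a then E (b, f a) else 0) * Z a b) = (\<Sum>a | a < k \<and> P a. ZE a (f a))"
    for P f
  proof -
    have "(\<Sum>b\<le>k. \<Sum>a<k. (if P a then E (b, f a) else 0) * Z a b) = (\<Sum>a<k. if P a then ZE a (f a) else 0)"
      by (subst sum.swap, intro sum.cong) (auto simp: ZE_def mult.commute)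
    also have "\<dots> = (\<Sum>a | a < k \<and> P a. ZE a (f a))"
      by (subst sum.inter_filter[symmetric]) (auto intro!: sum.cong)
    finally show ?thesis .
  qed
  show ?thesis
  proof (cases "q < p")
    case True
    define c where "c = p - (q + 1)"
    have pc: "p = c + q + 1" using True by (simp add: c_def)
    have "(\<Sum>b\<le>k. \<Sum>a<k. y_reduction k E p q (b, a) * Z a b) =
       (\<Sum>b | b \<le> k \<and> (b < p \<and> p \<le> b + q + 1). EZ (q + 1 + b - p) b) -
       (\<Sum>a | a < k \<and> a \<le> q. ZE a (p + a - (q + 1)))"
      unfolding sE[symmetric] sF[symmetric] using True
      by (simp add: y_reduction_def left_diff_distrib sum_subtractf)
    also have "(\<Sum>b | b \<le> k \<and> (b < p \<and> p \<le> b + q + 1). EZ (q + 1 + b - p) b) = (\<Sum>a\<le>q. EZ a (c + a))"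
      by (rule sum.reindex_bij_witness[of _ "\<lambda>a. c + a" "\<lambda>b. b - c"]) (use p q pc in auto)
    also have "(\<Sum>a | a < k \<and> a \<le> q. ZE a (p + a - (q + 1))) = (\<Sum>a\<le>q. ZE a (c + a))"
      by (rule sum.cong) (use q pc in auto)
    also have "(\<Sum>a\<le>q. EZ a (c + a)) - (\<Sum>a\<le>q. ZE a (c + a)) = (\<Sum>a\<le>q. EZ a (c + a) - ZE a (c + a))"
      by (simp add: sum_subtractf)
    also have "\<dots> = (\<Sum>a\<le>q. y * Z a (Suc (c + a)) - (if 1 \<le> a then y * Z (a - 1) (c + a) else 0))"
      using p q pc by (intro sum.cong refl) (auto simp: EZ ZE)
    also have "\<dots> = y * Z q (Suc (c + q))" by (induction q) auto
    finally show ?thesis using pc by simp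
  next
    case False
    define d where "d = q + 1 - p"
    have qd: "q + 1 = d + p" using False by (simp add: d_def)
    have "(\<Sum>b\<le>k. \<Sum>a<k. y_reduction k E p q (b, a) * Z a b) =
       (\<Sum>a | a < k \<and> q < a. ZE a (p + a - (q + 1))) -
       (\<Sum>b | b \<le> k \<and> (p \<le> b \<and> b + q < k + p). EZ (q + 1 + b - p) b)"
      unfolding sE[symmetric] sF[symmetric] using False
      by (simp add: y_reduction_def left_diff_distrib sum_subtractf)
    also have "(\<Sum>b | b \<le> k \<and> (p \<le> b \<and> b + q < k + p). EZ (q + 1 + b - p) b) =
       (\<Sum>a\<in>{q..<k}. EZ (Suc a) (Suc a - d))"
      by (rule sum.reindex_bij_witness[of _ "\<lambda>a. Suc a - d" "\<lambda>b. b + d - 1"]) (use p q qd False in \<open>auto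
          simp: add.commute\<close>)
    also have "(\<Sum>a | a < k \<and> q < a. ZE a (p + a - (q + 1))) = (\<Sum>a\<in>{Suc q..<k}. ZE a (a - d))"
      by (rule sum.cong) (use q qd False in auto)
    also have "(\<Sum>a\<in>{Suc q..<k}. ZE a (a - d)) - (\<Sum>a\<in>{q..<k}. EZ (Suc a) (Suc a - d)) = y * Z q p"
    proof -
      \<comment> \<open>Truncating both sums at \<open>n\<close> makes the induction possible; the
        price is the boundary term \<open>x * Z n (n - d)\<close>, which is absent at
        \<open>n = k\<close>.\<close>
      have "(\<Sum>a\<in>{Suc q..<n}. ZE a (a - d)) - (\<Sum>a\<in>{q..<n}. EZ (Suc a) (Suc a - d)) =
          y * Z q p - (if n < k then x * Z n (n - d) else 0)" if "q < n" "n \<le> k" for n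
        using that
      proof (induction n)
        case (Suc n)
        show ?case
        proof (cases "n = q")
          case True
          have "EZ (Suc q) (Suc q - d) = (if Suc q < k then x * Z (Suc q) (Suc q - d) else 0) - y * Z q
              (Suc q - d)"
            using EZ[of "Suc q" "Suc q - d"] Suc.prems True by simp
          moreover have "Suc q - d = p" using qd by simp
          ultimately show ?thesis using True by simp
        next
          case False
          then have n: "q < n" "n < k" using Suc.prems by auto
          have e: "Suc (n - d) = Suc n - d" using n qd by simp
          have "EZ (Suc n) (Suc n - d) = (if Suc n < k then x * Z (Suc n) (Suc n - d) else 0) - y * Z n
              (Suc n - d)"
            using EZ[of "Suc n" "Suc n - d"] n by simp
          moreover have "ZE n (n - d) = x * Z n (n - d) - y * Z n (Suc n - d)"
            using ZE[of n "n - d"] n e by simp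
          moreover have "(\<Sum>a\<in>{Suc q..<n}. ZE a (a - d)) =
              (\<Sum>a\<in>{q..<n}. EZ (Suc a) (Suc a - d)) + (y * Z q p - x * Z n (n - d))"
            using Suc.IH n by (simp add: algebra_simps)
          ultimately show ?thesis using n by (cases "Suc n < k") simp_all
        qed
      qed simp
      from this[of k] show ?thesis using q by simp
    qed
    finally show ?thesis .
  qed
qed

text \<open>The terms quadratic in \<open>y\<close>, both multiples of
  \<open>Z (j - 1) (i + 1)\<close>, cancel. What remains is the pairing of \<open>Z\<close> with the
  unreduced matrix
  \<open>xy (J\<^sub>0 \<xi> J\<^sub>1 - J\<^sub>1 \<xi> J\<^sub>0)\<close>.\<close>

lemma hilb_bracket_pairing:
  assumes Z: "annihilates k E x y Z" and j: "j \<le> k" and i: "i < k"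
  shows "(\<Sum>b\<le>k. \<Sum>a<k. hilb_bracket k E (j, i) (b, a) * Z a b) =
     x * y * ((if 1 \<le> j then Z (j - 1) i else 0) - (if j < k then Z j (Suc i) else 0))"
proof -
  have 1: "(\<Sum>b\<le>k. \<Sum>a<k. (if 1 \<le> j then \<Sum>p\<le>k. E (p, i) * y_reduction k E p (j - 1) (b, a) else 0) * Z a b) =
     (if 1 \<le> j then y * (x * Z (j - 1) i - y * Z (j - 1) (Suc i)) else 0)"
  proof (cases "1 \<le> j")
    case True
    have "(\<Sum>b\<le>k. \<Sum>a<k. (\<Sum>p\<le>k. E (p, i) * y_reduction k E p (j - 1) (b, a)) * Z a b) =
       (\<Sum>b\<le>k. \<Sum>a<k. \<Sum>p\<le>k. E (p, i) * (y_reduction k E p (j - 1) (b, a) * Z a b))"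
      by (simp add: sum_distrib_right mult.assoc)
    also have "\<dots> = (\<Sum>b\<le>k. \<Sum>p\<le>k. \<Sum>a<k. E (p, i) * (y_reduction k E p (j - 1) (b, a) * Z a b))"
      by (intro sum.cong refl sum.swap)
    also have "\<dots> = (\<Sum>p\<le>k. \<Sum>b\<le>k. \<Sum>a<k. E (p, i) * (y_reduction k E p (j - 1) (b, a) * Z a b))"
      by (rule sum.swap)
    also have "\<dots> = (\<Sum>p\<le>k. E (p, i) * (y * Z (j - 1) p))"
      using True j by (intro sum.cong refl) (simp add: sum_distrib_left[symmetric] y_reduction_pairing[OF Z])
    also have "\<dots> = y * (\<Sum>p\<le>k. Z (j - 1) p * E (p, i))"
      by (simp add: sum_distrib_left algebra_simps)
    also have "\<dots> = y * (x * Z (j - 1) i - y * Z (j - 1) (Suc i))"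
      using Z True j i by (simp add: annihilates_def)
    finally show ?thesis using True by simp
  qed simp
  have 2: "(\<Sum>b\<le>k. \<Sum>a<k. (\<Sum>q<k. E (j, q) * y_reduction k E (i + 1) q (b, a)) * Z a b) =
     y * ((if j < k then x * Z j (Suc i) else 0) - (if 1 \<le> j then y * Z (j - 1) (Suc i) else 0))"
  proof -
    have "(\<Sum>b\<le>k. \<Sum>a<k. (\<Sum>q<k. E (j, q) * y_reduction k E (i + 1) q (b, a)) * Z a b) =
       (\<Sum>b\<le>k. \<Sum>a<k. \<Sum>q<k. E (j, q) * (y_reduction k E (i + 1) q (b, a) * Z a b))"
      by (simp add: sum_distrib_right mult.assoc)
    also have "\<dots> = (\<Sum>b\<le>k. \<Sum>q<k. \<Sum>a<k. E (j, q) * (y_reduction k E (i + 1) q (b, a) * Z a b))"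
      by (intro sum.cong refl sum.swap)
    also have "\<dots> = (\<Sum>q<k. \<Sum>b\<le>k. \<Sum>a<k. E (j, q) * (y_reduction k E (i + 1) q (b, a) * Z a b))"
      by (rule sum.swap)
    also have "\<dots> = (\<Sum>q<k. E (j, q) * (y * Z q (i + 1)))"
      using i by (intro sum.cong refl) (simp add: sum_distrib_left[symmetric] y_reduction_pairing[OF Z])
    also have "\<dots> = y * (\<Sum>q<k. E (j, q) * Z q (Suc i))"
      by (simp add: sum_distrib_left algebra_simps)
    also have "(\<Sum>q<k. E (j, q) * Z q (Suc i)) =
        (if j < k then x * Z j (Suc i) else 0) - (if 1 \<le> j then y * Z (j - 1) (Suc i) else 0)"
      using Z i j unfolding annihilates_def by simp
    finally show ?thesis .
  qed
  have "(\<Sum>b\<le>k. \<Sum>a<k. hilb_bracket k E (j, i) (b, a) * Z a b) =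
     (if 1 \<le> j then y * (x * Z (j - 1) i - y * Z (j - 1) (Suc i)) else 0) -
     y * ((if j < k then x * Z j (Suc i) else 0) - (if 1 \<le> j then y * Z (j - 1) (Suc i) else 0))"
    unfolding 1[symmetric] 2[symmetric]
    by (simp add: hilb_bracket_def left_diff_distrib sum_subtractf)
  then show ?thesis by (cases "1 \<le> j"; cases "j < k") (simp_all add: algebra_simps)
qed

text \<open>The bivector evaluated on two covectors; the trace pairing transposes, so the entry
  \<open>Z i j\<close> goes with the label \<open>(j, i)\<close>.\<close>

definition matrix_bracket :: "nat \<Rightarrow> bivector \<Rightarrow> pt \<Rightarrow> (nat \<Rightarrow> nat \<Rightarrow> complex) \<Rightarrow> (nat \<Rightarrow> nat \<Rightarrow> complex) \<Rightarrow>
    complex" where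
  "matrix_bracket k B E Z Z' = (\<Sum>j\<le>k. \<Sum>i<k. \<Sum>b\<le>k. \<Sum>a<k. B E (j, i) (b, a) * Z i j * Z' a b)"

text \<open>The two double sums are the traces of \<open>Z J\<^sub>1 Z' J\<^sub>0\<close> and
  \<open>Z J\<^sub>0 Z' J\<^sub>1\<close>.\<close>

lemma hilb_matrix_bracket:
  assumes Z': "annihilates k E x y Z'"
  shows "matrix_bracket k (hilb_bracket k) E Z Z' =
    x * y * ((\<Sum>i<k. \<Sum>j<k. Z i (Suc j) * Z' j i) - (\<Sum>i<k. \<Sum>j<k. Z i j * Z' j (Suc i)))"
proof -
  have "matrix_bracket k (hilb_bracket k) E Z Z' =
     (\<Sum>j\<le>k. \<Sum>i<k. Z i j * (\<Sum>b\<le>k. \<Sum>a<k. hilb_bracket k E (j, i) (b, a) * Z' a b))"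
    unfolding matrix_bracket_def sum_distrib_left by (simp add: algebra_simps)
  also have "\<dots> = (\<Sum>j\<le>k. \<Sum>i<k. Z i j * (x * y * ((if 1 \<le> j then Z' (j - 1) i else 0) - (if j < k then Z'
      j (Suc i) else 0))))"
    by (intro sum.cong refl) (simp add: hilb_bracket_pairing[OF Z'])
  also have "\<dots> = x * y * ((\<Sum>i<k. \<Sum>j\<le>k. if 1 \<le> j then Z i j * Z' (j - 1) i else 0) -
      (\<Sum>i<k. \<Sum>j\<le>k. if j < k then Z i j * Z' j (Suc i) else 0))"
    unfolding sum.swap[of _ _ "{..k}"] sum_subtractf[symmetric] sum_distrib_left
    by (intro sum.cong refl) (auto simp: right_diff_distrib)
  finally have 0: "matrix_bracket k (hilb_bracket k) E Z Z' = \<dots>" .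
  have 1: "(\<Sum>j\<le>k. if 1 \<le> j then Z i j * Z' (j - 1) i else 0) = (\<Sum>j<k. Z i (Suc j) * Z' j i)" for i
    by (cases k) (simp_all add: sum.atMost_shift lessThan_Suc_atMost)
  have 2: "(\<Sum>j\<le>k. if j < k then Z i j * Z' j (Suc i) else 0) = (\<Sum>j<k. Z i j * Z' j (Suc i))" for i
    by (simp add: lessThan_Suc_atMost[symmetric])
  show ?thesis unfolding 0 1 2 ..
qed

text \<open>Sandwiching S between \<open>Z\<close> and \<open>Z'\<close> gives zero at either point,
  and the two values of S differ only in the terms with \<open>J\<^sub>0\<close> and
  \<open>J\<^sub>1\<close>. Hence \<open>(x - x') Z J\<^sub>0 Z' = (y - y') Z J\<^sub>1 Z'\<close>,
  and likewise with the factors exchanged. Taking traces against \<open>J\<^sub>0\<close> and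
  \<open>J\<^sub>1\<close> shows that \<open>x - x'\<close> and \<open>y - y'\<close> both kill the
  difference \<open>T1 - T2\<close> of the two traces.\<close>

lemma hilb_matrix_bracket_distinct:
  assumes Z: "annihilates k E x y Z" and Z': "annihilates k E x' y' Z'" and ne: "(x, y) \<noteq> (x', y')"
  shows "matrix_bracket k (hilb_bracket k) E Z Z' = 0"
proof -
  have key: "(u - u') * (\<Sum>i<k. W q i * W' i p) = (v - v') * (\<Sum>i<k. W q (Suc i) * W' i p)"
    if W: "annihilates k E u v W" and W': "annihilates k E u' v' W'" and qp: "q < k" "p \<le> k"
    for u v u' v' W W' q p
  proof -
    have "(\<Sum>i<k. (\<Sum>b\<le>k. W q b * E (b, i)) * W' i p) = (\<Sum>i<k. (u * W q i - v * W q (Suc i)) * W' i p)"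
      using W qp by (intro sum.cong refl) (simp add: annihilates_def)
    moreover have "(\<Sum>i<k. (\<Sum>b\<le>k. W q b * E (b, i)) * W' i p) = (\<Sum>b\<le>k. W q b * (\<Sum>i<k. E (b, i) * W' i p))"
      unfolding sum_distrib_left sum_distrib_right by (subst sum.swap) (simp add: mult.assoc)
    moreover have "\<dots> = (\<Sum>b\<le>k. W q b * ((if b < k then u' * W' b p else 0) - (if 1 \<le> b then v' * W' (b -
        1) p else 0)))"
      using W' qp by (intro sum.cong refl) (simp add: annihilates_def)
    moreover have "\<dots> = (\<Sum>b\<le>k. if b < k then W q b * (u' * W' b p) else 0) - (\<Sum>b\<le>k. if 1 \<le> b then W q b *
        (v' * W' (b - 1) p) else 0)"
      unfolding sum_subtractf[symmetric] by (intro sum.cong refl) (auto simp: algebra_simps)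
    moreover have "(\<Sum>b\<le>k. if b < k then W q b * (u' * W' b p) else 0) = (\<Sum>b<k. W q b * (u' * W' b p))"
      by (simp add: lessThan_Suc_atMost[symmetric])
    moreover have "(\<Sum>b\<le>k. if 1 \<le> b then W q b * (v' * W' (b - 1) p) else 0) = (\<Sum>b<k. W q (Suc b) * (v' *
        W' b p))"
      by (cases k) (simp_all add: sum.atMost_shift lessThan_Suc_atMost)
    ultimately have "(\<Sum>i<k. (u * W q i - v * W q (Suc i)) * W' i p) = (\<Sum>b<k. W q b * (u' * W' b p)) -
        (\<Sum>b<k. W q (Suc b) * (v' * W' b p))"
      by simp
    then show ?thesis
      by (simp add: left_diff_distrib sum_subtractf sum_distrib_left algebra_simps)
  qed
  define T1 where "T1 = (\<Sum>i<k. \<Sum>j<k. Z i (Suc j) * Z' j i)"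
  define T2 where "T2 = (\<Sum>i<k. \<Sum>j<k. Z i j * Z' j (Suc i))"
  define A where "A = (\<Sum>i<k. \<Sum>j<k. Z i j * Z' j i)"
  define B where "B = (\<Sum>i<k. \<Sum>j<k. Z i (Suc j) * Z' j (Suc i))"
  have dist: "c * (\<Sum>i<k. f i) = d * (\<Sum>i<k. g i)" if "\<And>i. i < k \<Longrightarrow> c * f i = d * g i"
    for c d :: complex and f g
    unfolding sum_distrib_left using that by (intro sum.cong) auto
  have A': "A = (\<Sum>j<k. \<Sum>i<k. Z' j i * Z i j)" and T2': "T2 = (\<Sum>j<k. \<Sum>i<k. Z' j (Suc i) * Z i j)"
    and T1': "T1 = (\<Sum>j<k. \<Sum>i<k. Z' j i * Z i (Suc j))" and B': "B = (\<Sum>j<k. \<Sum>i<k. Z' j (Suc i) * Z i (Suc j))"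
    unfolding A_def T1_def T2_def B_def by (subst sum.swap, simp only: mult.commute)+
  have neg: "(u - v) * C = (u' - v') * D" if "(v - u) * C = (v' - u') * D" for u v u' v' C D :: complex
    using that by (metis minus_diff_eq mult_minus_left)
  have "(x - x') * A = (y - y') * T1"
    unfolding A_def T1_def by (rule dist, rule key[OF Z Z']) auto
  moreover have "(x - x') * T2 = (y - y') * B"
    unfolding B_def T2_def by (rule dist, rule key[OF Z Z']) auto
  moreover have "(x - x') * A = (y - y') * T2"
    unfolding A' T2' by (rule neg, rule dist, rule key[OF Z' Z]) auto
  moreover have "(x - x') * T1 = (y - y') * B"
    unfolding T1' B' by (rule neg, rule dist, rule key[OF Z' Z]) auto
  ultimately have "(x - x') * (T1 - T2) = 0" "(y - y') * (T1 - T2) = 0"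
    by (auto simp: right_diff_distrib)
  then have "T1 = T2" using ne by auto
  then show ?thesis unfolding hilb_matrix_bracket[OF Z'] T1_def T2_def by simp
qed

text \<open>The hypothesis \<open>pr\<close> says that every column of \<open>Z\<close> is parallel
  to every column of \<open>Z'\<close>, as happens where S has a one-dimensional kernel. Exchanging
  the row indices factors each trace of a product into a product of traces.\<close>

lemma hilb_matrix_bracket_same:
  assumes Z': "annihilates k E x y Z'"
    and pr: "\<And>i i' j j'. i < k \<Longrightarrow> i' < k \<Longrightarrow> j \<le> k \<Longrightarrow> j' \<le> k \<Longrightarrow> Z i j * Z' i' j' = Z i' j * Z' i j'"
  shows "matrix_bracket k (hilb_bracket k) E Z Z' =
    x * y * ((\<Sum>j<k. Z j (Suc j)) * (\<Sum>i<k. Z' i i) - (\<Sum>j<k. Z j j) * (\<Sum>i<k. Z' i (Suc i)))"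
proof -
  have "(\<Sum>i<k. \<Sum>j<k. Z i (Suc j) * Z' j i) = (\<Sum>i<k. \<Sum>j<k. Z j (Suc j) * Z' i i)"
    using pr by (intro sum.cong refl) simp
  also have "\<dots> = (\<Sum>j<k. Z j (Suc j)) * (\<Sum>i<k. Z' i i)"
    unfolding sum_product by (rule sum.swap)
  finally have 1: "(\<Sum>i<k. \<Sum>j<k. Z i (Suc j) * Z' j i) = (\<Sum>j<k. Z j (Suc j)) * (\<Sum>i<k. Z' i i)" .
  have "(\<Sum>i<k. \<Sum>j<k. Z i j * Z' j (Suc i)) = (\<Sum>i<k. \<Sum>j<k. Z j j * Z' i (Suc i))"
    using pr by (intro sum.cong refl) simp
  also have "\<dots> = (\<Sum>j<k. Z j j) * (\<Sum>i<k. Z' i (Suc i))"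
    unfolding sum_product by (rule sum.swap)
  finally show ?thesis unfolding hilb_matrix_bracket[OF Z'] 1 by simp
qed

lemma minor_cofactor_annihilates:
  assumes s: "rank_drops k E x y" and r: "r \<le> k"
  shows "annihilates k E x y (minor_cofactor k E x y r)"
  unfolding annihilates_def
proof (intro conjI allI impI)
  let ?Z = "minor_cofactor k E x y r"
  fix q i assume qi: "q < k" "i < k"
  have "(\<Sum>j\<le>k. ?Z q j * S_at E x y j i) = (\<Sum>j\<le>k. ?Z q j * E (j, i)) -
     (\<Sum>j\<le>k. if j = i then ?Z q j * x else 0) + (\<Sum>j\<le>k. if j = Suc i then ?Z q j * y else 0)"
    unfolding S_at_def sum.distrib[symmetric] sum_subtractf[symmetric]
    by (intro sum.cong refl) (auto simp: algebra_simps)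
  then show "(\<Sum>b\<le>k. ?Z q b * E (b, i)) = x * ?Z q i - y * ?Z q (Suc i)"
    using rank_drops_minor_cofactor_cokernel[OF s r qi(2,1)] qi by (simp add: algebra_simps)
next
  let ?Z = "minor_cofactor k E x y r"
  fix j p assume jp: "j \<le> k" "p \<le> k"
  have "(\<Sum>i<k. S_at E x y j i * ?Z i p) = (\<Sum>i<k. E (j, i) * ?Z i p) -
     (\<Sum>i<k. if i = j then x * ?Z i p else 0) + (\<Sum>i<k. if Suc i = j then y * ?Z i p else 0)"
    unfolding S_at_def sum.distrib[symmetric] sum_subtractf[symmetric]
    by (intro sum.cong refl) (auto simp: algebra_simps)
  also have "(\<Sum>i<k. if Suc i = j then y * ?Z i p else 0) = (if 1 \<le> j then y * ?Z (j - 1) p else 0)"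
    using jp by (cases j) auto
  finally show "(\<Sum>a<k. E (j, a) * ?Z a p) = (if j < k then x * ?Z j p else 0) - (if 1 \<le> j then y * ?Z (j
      - 1) p else 0)"
    using rank_drops_minor_cofactor_kernel[OF s r jp(2)] jp unfolding rank_drops_kernel_def by (auto
        simp: algebra_simps)
qed

section \<open>The ideal of maximal minors\<close>

text \<open>A bound on the total degree, \<open>j\<close> being the exponent of \<open>x\<close> and
  \<open>l\<close> that of \<open>y\<close>. Being strict, it admits the zero polynomial for every
  \<open>d\<close>, and nothing else for \<open>d = 0\<close>.\<close>

definition tdeg_less :: "nat \<Rightarrow> complex poly poly \<Rightarrow> bool" where
  "tdeg_less d f \<longleftrightarrow> (\<forall>j l. poly.coeff (poly.coeff f l) j \<noteq> 0 \<longrightarrow> j + l < d)"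

lemma tdeg_less_mono: "tdeg_less d f \<Longrightarrow> d \<le> d' \<Longrightarrow> tdeg_less d' f"
  unfolding tdeg_less_def by (meson less_le_trans)

lemma tdeg_less_0 [simp]: "tdeg_less d 0"
  by (simp add: tdeg_less_def)

lemma tdeg_less_add: "tdeg_less d f \<Longrightarrow> tdeg_less d g \<Longrightarrow> tdeg_less d (f + g)"
  unfolding tdeg_less_def by (metis add.right_neutral coeff_add)

lemma tdeg_less_uminus: "tdeg_less d f \<Longrightarrow> tdeg_less d (- f)"
  unfolding tdeg_less_def by simp

lemma tdeg_less_diff: "tdeg_less d f \<Longrightarrow> tdeg_less d g \<Longrightarrow> tdeg_less d (f - g)"
  using tdeg_less_add[OF _ tdeg_less_uminus] by fastforce

lemma tdeg_less_sum: "(\<And>a. a \<in> A \<Longrightarrow> tdeg_less d (f a)) \<Longrightarrow> tdeg_less d (sum f A)"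
  by (induction A rule: infinite_finite_induct) (auto intro: tdeg_less_add)

text \<open>The successor on one side only expresses degree at most \<open>d\<close> times degree
  less than \<open>d'\<close>.\<close>

lemma tdeg_less_mult:
  assumes "tdeg_less (Suc d) f" "tdeg_less d' g"
  shows "tdeg_less (d + d') (f * g)"
  unfolding tdeg_less_def
proof (intro allI impI)
  fix j l assume "poly.coeff (poly.coeff (f * g) l) j \<noteq> 0"
  then have "(\<Sum>i\<le>l. \<Sum>p\<le>j. poly.coeff (poly.coeff f i) p * poly.coeff (poly.coeff g (l - i)) (j - p)) \<noteq> 0"
    by (simp add: coeff_mult coeff_sum)
  then obtain i where i: "i \<le> l"
    "(\<Sum>p\<le>j. poly.coeff (poly.coeff f i) p * poly.coeff (poly.coeff g (l - i)) (j - p)) \<noteq> 0"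
    by (metis (no_types, lifting) atMost_iff sum.neutral)
  then obtain p where p: "p \<le> j"
    "poly.coeff (poly.coeff f i) p * poly.coeff (poly.coeff g (l - i)) (j - p) \<noteq> 0"
    by (metis (no_types, lifting) atMost_iff sum.neutral)
  then have "poly.coeff (poly.coeff f i) p \<noteq> 0" "poly.coeff (poly.coeff g (l - i)) (j - p) \<noteq> 0"
    by auto
  then have "p + i < Suc d" "(j - p) + (l - i) < d'"
    using assms unfolding tdeg_less_def by blast+
  then show "j + l < d + d'" using i(1) p(1) by linarith
qed

lemma tdeg_less_const: "tdeg_less (Suc d) [:[:c:]:]"
  by (auto simp: tdeg_less_def coeff_pCons split: nat.splits)

lemma coeff_mono_xy: "poly.coeff (poly.coeff (mono_xy j l) l') j' = (if j = j' \<and> l = l' then 1 else 0)"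
  by (auto simp: mono_xy_def)

lemma tdeg_less_mono_xy: "j + l < d \<Longrightarrow> tdeg_less d (mono_xy j l)"
  by (auto simp: tdeg_less_def coeff_mono_xy)

lemma smult_const_eq: "Polynomial.smult [:c:] f = [:[:c:]:] * f"
  by simp

lemma coeff_smult_const: "poly.coeff (poly.coeff (Polynomial.smult [:c:] f) l) j = c * poly.coeff
    (poly.coeff f l) j"
  by simp

lemma tdeg_less_smult: "tdeg_less d f \<Longrightarrow> tdeg_less d (Polynomial.smult [:c:] f)"
  unfolding tdeg_less_def coeff_smult_const by auto

lemma mono_xy_mult: "mono_xy j l * mono_xy j' l' = mono_xy (j + j') (l + l')"
  by (simp add: mono_xy_def mult_monom)

definition tri_labels :: "nat \<Rightarrow> label set" where
  "tri_labels k = {(j, l). j + l < k}"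

lemma finite_tri_labels [simp]: "finite (tri_labels k)"
proof -
  have "tri_labels k \<subseteq> {..<k} \<times> {..<k}" by (auto simp: tri_labels_def)
  then show ?thesis by (rule Finite_Set.finite_subset) simp
qed

lemma card_tri_labels: "card (tri_labels k) = k * (k + 1) div 2"
proof (induction k)
  case (Suc k)
  have e: "tri_labels (Suc k) = tri_labels k \<union> (\<lambda>j. (j, k - j)) ` {..k}"
    by (auto simp: tri_labels_def image_iff)
  have "card (tri_labels (Suc k)) = card (tri_labels k) + card ((\<lambda>j. (j, k - j)) ` {..k})"
    unfolding e by (rule card_Un_disjoint) (simp, simp, auto simp: tri_labels_def)
  also have "card ((\<lambda>j. (j, k - j)) ` {..k}) = Suc k"
    by (subst card_image) (auto simp: inj_on_def)
  finally show ?case using Suc by simp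
qed (simp add: tri_labels_def)

lemma tdeg_less_expand:
  assumes "tdeg_less d f"
  shows "f = (\<Sum>(j, l)\<in>tri_labels d. Polynomial.smult [:poly.coeff (poly.coeff f l) j:] (mono_xy j l))"
    (is "f = ?R")
proof (rule poly_eqI, rule poly_eqI)
  fix l j
  have "poly.coeff (poly.coeff ?R l) j =
     (\<Sum>p\<in>tri_labels d. if p = (j, l) then poly.coeff (poly.coeff f l) j else 0)"
    unfolding coeff_sum by (intro sum.cong refl) (auto simp: coeff_mono_xy split: if_splits)
  also have "\<dots> = (if (j, l) \<in> tri_labels d then poly.coeff (poly.coeff f l) j else 0)"
    by (simp add: case_prod_unfold)
  also have "\<dots> = poly.coeff (poly.coeff f l) j"
    using assms by (auto simp: tdeg_less_def tri_labels_def)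
  finally show "poly.coeff (poly.coeff f l) j = poly.coeff (poly.coeff ?R l) j" by simp
qed

lemma eval_xy_add [simp]: "eval_xy (f + g) p = eval_xy f p + eval_xy g p"
  and eval_xy_mult [simp]: "eval_xy (f * g) p = eval_xy f p * eval_xy g p"
  and eval_xy_diff [simp]: "eval_xy (f - g) p = eval_xy f p - eval_xy g p"
  and eval_xy_uminus [simp]: "eval_xy (- f) p = - eval_xy f p"
  and eval_xy_0 [simp]: "eval_xy 0 p = 0"
  and eval_xy_1 [simp]: "eval_xy 1 p = 1"
  and eval_xy_const [simp]: "eval_xy [:[:c:]:] p = c"
  by (simp_all add: eval_xy_def)

lemma eval_xy_sum [simp]: "eval_xy (sum f A) p = (\<Sum>a\<in>A. eval_xy (f a) p)"
  by (simp add: eval_xy_def poly_sum)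

lemma eval_xy_smult [simp]: "eval_xy (Polynomial.smult [:c:] f) p = c * eval_xy f p"
  by (simp add: eval_xy_def)

lemma eval_xy_mono [simp]: "eval_xy (mono_xy j l) p = fst p ^ j * snd p ^ l"
  by (simp add: eval_xy_def mono_xy_def poly_monom)

lemma eval_xy_hom: "comm_ring_hom (\<lambda>f. eval_xy f p)"
  by unfold_locales simp_all

lemma eval_tdeg_less:
  assumes "tdeg_less d f"
  shows "eval_xy f p = (\<Sum>(j, l)\<in>tri_labels d. poly.coeff (poly.coeff f l) j * (fst p ^ j * snd p ^ l))"
  by (subst tdeg_less_expand[OF assms]) (simp add: case_prod_unfold)

lemma maximal_minor_det_rows: "maximal_minor k E r = det_rows k (\<lambda>a. S_entry E (skip r a))"
  unfolding maximal_minor_def det_rows_def skip_def by simp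

lemma eval_S_entry: "eval_xy (S_entry E j i) (x, y) = S_at E x y j i"
  by (simp add: S_entry_def S_at_def)

lemma eval_maximal_minor: "eval_xy (maximal_minor k E r) (x, y) = minor_at k E x y r"
  unfolding maximal_minor_det_rows minor_at_def det_rows_hom[OF eval_xy_hom] eval_S_entry ..

lemma signof_cases: "signof p = (1::'a::comm_ring_1) \<or> signof p = (-1::'a)"
  by (simp add: sign_def)

lemma tdeg_less_signof: "tdeg_less d f \<Longrightarrow> tdeg_less d (signof p * f)"
  using signof_cases[of p, where ?'a="complex poly poly"] by (auto intro: tdeg_less_uminus)

lemma tdeg_less_prod:
  "finite A \<Longrightarrow> (\<And>a. a \<in> A \<Longrightarrow> tdeg_less 2 (f a)) \<Longrightarrow> tdeg_less (Suc (card A)) (prod f A)"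
proof (induction A rule: finite_induct)
  case empty
  show ?case using tdeg_less_const[of 0 1] by (simp add: one_pCons)
next
  case (insert a A)
  have "tdeg_less (1 + Suc (card A)) (f a * prod f A)"
    by (rule tdeg_less_mult) (use insert in \<open>auto simp: numeral_2_eq_2\<close>)
  then show ?case using insert by simp
qed

text \<open>Changing factors of degree at most one by constants affects a product only below its top
  degree.\<close>

lemma tdeg_less_prod_diff:
  "finite A \<Longrightarrow> (\<And>a. a \<in> A \<Longrightarrow> tdeg_less 2 (f a)) \<Longrightarrow> (\<And>a. a \<in> A \<Longrightarrow> tdeg_less 2 (g a)) \<Longrightarrow>
   (\<And>a. a \<in> A \<Longrightarrow> tdeg_less 1 (f a - g a)) \<Longrightarrow> tdeg_less (card A) (prod f A - prod g A)"
proof (induction A rule: finite_induct)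
  case (insert a A)
  have "prod f (insert a A) - prod g (insert a A) =
      f a * (prod f A - prod g A) + (f a - g a) * prod g A"
    using insert by (simp add: algebra_simps)
  moreover have "tdeg_less (1 + card A) (f a * (prod f A - prod g A))"
    by (rule tdeg_less_mult) (use insert in \<open>auto simp: numeral_2_eq_2\<close>)
  moreover have "tdeg_less (0 + Suc (card A)) ((f a - g a) * prod g A)"
    by (rule tdeg_less_mult, use insert in simp, rule tdeg_less_prod) (use insert in auto)
  ultimately show ?case using insert by (auto intro: tdeg_less_add)
qed simp

definition lin_entry :: "nat \<Rightarrow> nat \<Rightarrow> complex poly poly" where
  "lin_entry j i = - (if j = i then mono_xy 1 0 else 0) + (if j = Suc i then mono_xy 0 1 else 0)"

lemma S_entry_lin: "S_entry E j i = [:[:E (j, i):]:] + lin_entry j i"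
  by (simp add: S_entry_def lin_entry_def)

lemma tdeg_less_lin_entry: "tdeg_less 2 (lin_entry j i)"
  unfolding lin_entry_def by (auto intro!: tdeg_less_add tdeg_less_uminus tdeg_less_mono_xy)

lemma tdeg_less_S_entry: "tdeg_less 2 (S_entry E j i)"
  unfolding S_entry_lin
  by (intro tdeg_less_add tdeg_less_lin_entry tdeg_less_mono[OF tdeg_less_const[of 0]]) simp

text \<open>The part of degree \<open>k\<close> comes from \<open>E = 0\<close>, where deleting row
  \<open>r\<close> leaves a bidiagonal matrix with \<open>r\<close> diagonal entries
  \<open>- x\<close> and \<open>k - r\<close> diagonal entries \<open>y\<close>. So the leading
  forms are, up to sign, exactly the monomials of degree \<open>k\<close>; both the division by the
  minors and their linear independence rest on this.\<close>

lemma maximal_minor_leading: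
  assumes r: "r \<le> k"
  shows "tdeg_less k (maximal_minor k E r - Polynomial.smult [:(-1) ^ r:] (mono_xy r (k - r)))"
proof -
  have "det_rows k (\<lambda>a. lin_entry (skip r a)) = (\<Prod>a<k. lin_entry (skip r a) a)"
    by (rule det_rows_bidiagonal[of r]) (auto simp: lin_entry_def skip_def)
  also have "\<dots> = (\<Prod>a<k. if a < r then - mono_xy 1 0 else mono_xy 0 1)"
    by (intro prod.cong refl) (auto simp: lin_entry_def skip_def)
  also have "\<dots> = (\<Prod>a<r. - mono_xy 1 0) * (\<Prod>a\<in>{r..<k}. mono_xy 0 1)"
  proof -
    have e: "{..<k} = {..<r} \<union> {r..<k}" using r by auto
    have "(\<Prod>a<r. if a < r then - mono_xy 1 0 else mono_xy 0 1) = (\<Prod>a<r. - mono_xy 1 0)"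
      "(\<Prod>a\<in>{r..<k}. if a < r then - mono_xy 1 0 else mono_xy 0 1) = (\<Prod>a\<in>{r..<k}. mono_xy 0 1)"
      by (auto intro!: prod.cong simp del: prod_constant)
    then show ?thesis unfolding e by (subst prod.union_disjoint) (auto simp del: prod_constant)
  qed
  also have "\<dots> = Polynomial.smult [:(-1) ^ r:] (mono_xy r (k - r))"
  proof -
    have "mono_xy 1 0 ^ n = mono_xy n 0" "mono_xy 0 1 ^ n = mono_xy 0 n" for n
      by (induction n) (simp_all add: mono_xy_mult, simp_all add: mono_xy_def monom_eq_1)
    moreover have "(- 1 :: complex poly poly) ^ r = [:[:(-1) ^ r:]:]"
      by (induction r) (simp_all add: one_pCons)
    ultimately show ?thesis
      by (simp add: power_minus[of "mono_xy (Suc 0) 0"] mono_xy_mult)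
  qed
  finally have top: "det_rows k (\<lambda>a. lin_entry (skip r a)) = Polynomial.smult [:(-1) ^ r:] (mono_xy r (k
      - r))" .
  have "tdeg_less k (det_rows k (\<lambda>a. S_entry E (skip r a)) - det_rows k (\<lambda>a. lin_entry (skip r a)))"
    unfolding det_rows_leibniz sum_subtractf[symmetric] right_diff_distrib[symmetric]
  proof (intro tdeg_less_sum tdeg_less_signof)
    fix p
    have "tdeg_less (card {0..<k}) ((\<Prod>a = 0..<k. S_entry E (skip r a) (p a)) - (\<Prod>a = 0..<k. lin_entry
        (skip r a) (p a)))"
      by (rule tdeg_less_prod_diff)
        (auto simp: tdeg_less_S_entry[unfolded S_entry_lin] tdeg_less_lin_entry S_entry_lin
            tdeg_less_const[of 0, simplified])
    then show "tdeg_less k ((\<Prod>a = 0..<k. S_entry E (skip r a) (p a)) - (\<Prod>a = 0..<k. lin_entry (skip r a)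
        (p a)))"
      by simp
  qed
  then show ?thesis unfolding maximal_minor_det_rows top .
qed

text \<open>The derivative of the minor along \<open>A\<close> by the product rule over rows, kept
  as a polynomial so that its degree can be bounded: one row has become constant.\<close>

definition minor_dir :: "nat \<Rightarrow> pt \<Rightarrow> pt \<Rightarrow> nat \<Rightarrow> complex poly poly" where
  "minor_dir k A E r = (\<Sum>a<k. det_rows k ((\<lambda>a. S_entry E (skip r a))(a := (\<lambda>i. [:[:A (skip r a, i):]:]))))"

lemma tdeg_less_minor_dir: "tdeg_less k (minor_dir k A E r)"
  unfolding minor_dir_def
proof (rule tdeg_less_sum)
  fix a assume "a \<in> {..<k}"
  then have a: "a < k" by simp
  show "tdeg_less k (det_rows k ((\<lambda>a. S_entry E (skip r a))(a := (\<lambda>i. [:[:A (skip r a, i):]:]))))"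
    unfolding det_rows_upd_leibniz[OF a] mult.left_commute[of "[:[:_:]:]"]
  proof (intro tdeg_less_sum tdeg_less_signof)
    fix p
    have "tdeg_less (0 + Suc (card ({0..<k} - {a}))) ([:[:A (skip r a, p a):]:] * (\<Prod>b\<in>{0..<k} - {a}.
        S_entry E (skip r b) (p b)))"
      by (intro tdeg_less_mult tdeg_less_prod tdeg_less_S_entry tdeg_less_const) auto
    then show "tdeg_less k ([:[:A (skip r a, p a):]:] * (\<Prod>b\<in>{0..<k} - {a}. S_entry E (skip r b) (p b)))"
      using a by simp
  qed
qed

lemma eval_minor_dir:
  assumes r: "r \<le> k"
  shows "eval_xy (minor_dir k A E r) (x, y) = minor_at_dir k A E x y r"
proof -
  let ?g = "\<lambda>j. \<Sum>i<k. A (j, i) * minor_cofactor k E x y r i j"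
  have upd: "(\<lambda>a' i. eval_xy (((\<lambda>a. S_entry E (skip r a))(a := (\<lambda>i. [:[:A (skip r a, i):]:]))) a' i) (x, y)) =
     (\<lambda>a. S_at E x y (skip r a))(a := (\<lambda>i. A (skip r a, i)))" for a
    by (auto simp: fun_eq_iff eval_S_entry)
  have "eval_xy (minor_dir k A E r) (x, y) =
     (\<Sum>a<k. det_rows k ((\<lambda>a. S_at E x y (skip r a))(a := (\<lambda>i. A (skip r a, i)))))"
    unfolding minor_dir_def eval_xy_sum det_rows_hom[OF eval_xy_hom] upd ..
  also have "\<dots> = (\<Sum>a<k. ?g (skip r a))"
  proof (intro sum.cong refl)
    fix a assume "a \<in> {..<k}"
    then have a: "a < k" by simp
    show "det_rows k ((\<lambda>a. S_at E x y (skip r a))(a := (\<lambda>i. A (skip r a, i)))) = ?g (skip r a)"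
      unfolding det_rows_row_expand[OF a, of _ "\<lambda>i. A (skip r a, i)"] by (simp add: minor_cofactor_def)
  qed
  also have "\<dots> = (\<Sum>j\<in>{..k} - {r}. ?g j)" by (rule sum_skip[OF r])
  also have "\<dots> = (\<Sum>j\<le>k. ?g j)"
    by (rule sum.mono_neutral_left) (auto simp: minor_cofactor_def)
  finally show ?thesis by (simp add: minor_at_dir_def)
qed

lemma ideal_Z_add: "f \<in> ideal_Z k E \<Longrightarrow> g \<in> ideal_Z k E \<Longrightarrow> f + g \<in> ideal_Z k E"
proof -
  assume "f \<in> ideal_Z k E" "g \<in> ideal_Z k E"
  then obtain q q' where "f = (\<Sum>r\<le>k. q r * maximal_minor k E r)" "g = (\<Sum>r\<le>k. q' r * maximal_minor k E r)"
    unfolding ideal_Z_def by blast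
  then have "f + g = (\<Sum>r\<le>k. (q r + q' r) * maximal_minor k E r)"
    by (simp add: sum.distrib distrib_right)
  then show ?thesis unfolding ideal_Z_def by (intro CollectI exI)
qed

lemma ideal_Z_mult: "f \<in> ideal_Z k E \<Longrightarrow> h * f \<in> ideal_Z k E"
proof -
  assume "f \<in> ideal_Z k E"
  then obtain q where "f = (\<Sum>r\<le>k. q r * maximal_minor k E r)"
    unfolding ideal_Z_def by blast
  then have "h * f = (\<Sum>r\<le>k. (h * q r) * maximal_minor k E r)"
    by (simp add: sum_distrib_left mult.assoc)
  then show ?thesis unfolding ideal_Z_def by (intro CollectI exI)
qed

lemma ideal_Z_minor: "r \<le> k \<Longrightarrow> maximal_minor k E r \<in> ideal_Z k E"
  unfolding ideal_Z_def
  by (intro CollectI exI[of _ "\<lambda>s. if s = r then 1 else 0"]) (simp add: if_distribR if_distrib[of "\<lambda>u. u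
      * _"] cong: if_cong)

lemma ideal_Z_0: "0 \<in> ideal_Z k E"
  unfolding ideal_Z_def by (intro CollectI exI[of _ "\<lambda>_. 0"]) simp

lemma ideal_Z_sum: "(\<And>a. a \<in> A \<Longrightarrow> f a \<in> ideal_Z k E) \<Longrightarrow> sum f A \<in> ideal_Z k E"
  by (induction A rule: infinite_finite_induct) (auto intro: ideal_Z_add ideal_Z_0)

text \<open>Every monomial of degree \<open>d \<ge> k\<close> is a multiple of the leading monomial
  of some minor, so the part of \<open>f\<close> of degree \<open>d\<close> can be subtracted
  away.\<close>

lemma ideal_Z_reduce_step:
  assumes f: "tdeg_less (Suc d) f" and d: "k \<le> d"
  shows "\<exists>g. tdeg_less d g \<and> f - g \<in> ideal_Z k E"
proof -
  define c where "c j = poly.coeff (poly.coeff f (d - j)) j" for j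
  \<comment> \<open>With this choice \<open>x ^ r * y ^ (k - r)\<close> divides
    \<open>x ^ j * y ^ (d - j)\<close> also when \<open>j > k\<close>.\<close>
  define r where "r j = min j k" for j
  define mm where "mm j = mono_xy (j - r j) (d - j - (k - r j))" for j
  define h where "h j = Polynomial.smult [:c j * (-1) ^ r j:] (mm j * maximal_minor k E (r j))" for j
  have hJ: "(\<Sum>j\<le>d. h j) \<in> ideal_Z k E"
    unfolding h_def smult_const_eq by (intro ideal_Z_sum ideal_Z_mult ideal_Z_minor) (simp add: r_def)
  have hj: "tdeg_less d (h j - Polynomial.smult [:c j:] (mono_xy j (d - j)))" if j: "j \<le> d" for j
  proof -
    have e: "mono_xy j (d - j) = mm j * mono_xy (r j) (k - r j)"
      using j d by (simp add: mm_def r_def mono_xy_mult min_def)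
    have s: "(- 1) ^ n * (u * (- 1) ^ n) = (u :: complex)" for n u
      by (induction n) auto
    have "h j - Polynomial.smult [:c j:] (mono_xy j (d - j)) =
       Polynomial.smult [:c j * (-1) ^ r j:] (mm j * (maximal_minor k E (r j) - Polynomial.smult [:(-1)
           ^ r j:] (mono_xy (r j) (k - r j))))"
      unfolding h_def e by (simp add: smult_diff_right right_diff_distrib s)
    moreover have "tdeg_less ((d - k) + k) (mm j * (maximal_minor k E (r j) - Polynomial.smult [:(-1) ^
        r j:] (mono_xy (r j) (k - r j))))"
      by (intro tdeg_less_mult maximal_minor_leading)
        (use j d in \<open>auto simp: mm_def r_def min_def intro!: tdeg_less_mono_xy\<close>)
    ultimately show ?thesis using d by (simp add: tdeg_less_smult)
  qed
  have "tdeg_less d (f - (\<Sum>j\<le>d. Polynomial.smult [:c j:] (mono_xy j (d - j))))"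
    unfolding tdeg_less_def
  proof (intro allI impI)
    fix j l
    assume nz: "poly.coeff (poly.coeff (f - (\<Sum>j\<le>d. Polynomial.smult [:c j:] (mono_xy j (d - j)))) l) j \<noteq> 0"
    have s: "poly.coeff (poly.coeff (\<Sum>j\<le>d. Polynomial.smult [:c j:] (mono_xy j (d - j))) l) j =
       (\<Sum>j'\<le>d. if j' = j then (if d - j = l then c j else 0) else 0)"
      unfolding coeff_sum by (intro sum.cong refl) (auto simp: coeff_mono_xy split: if_splits)
    show "j + l < d"
    proof (cases "j + l = d")
      case True
      then show ?thesis using nz s by (auto simp: c_def)
    next
      case False
      then have "\<not> (j \<le> d \<and> d - j = l)" by auto
      then have "poly.coeff (poly.coeff f l) j \<noteq> 0" using nz s by (auto split: if_splits)
      then show ?thesis using f False unfolding tdeg_less_def by force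
    qed
  qed
  then have "tdeg_less d ((f - (\<Sum>j\<le>d. Polynomial.smult [:c j:] (mono_xy j (d - j)))) -
      (\<Sum>j\<le>d. h j - Polynomial.smult [:c j:] (mono_xy j (d - j))))"
    by (rule tdeg_less_diff) (rule tdeg_less_sum, rule hj, simp)
  then have "tdeg_less d (f - (\<Sum>j\<le>d. h j))" by (simp add: sum_subtractf)
  then show ?thesis using hJ by (intro exI[of _ "f - (\<Sum>j\<le>d. h j)"]) simp
qed

lemma tdeg_less_exists: "\<exists>d. tdeg_less d f"
proof -
  define D where "D = (\<Sum>l\<le>Polynomial.degree f. Polynomial.degree (poly.coeff f l))"
  have "tdeg_less (Suc (D + Polynomial.degree f)) f"
    unfolding tdeg_less_def
  proof (intro allI impI)
    fix j l assume nz: "poly.coeff (poly.coeff f l) j \<noteq> 0"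
    then have "poly.coeff f l \<noteq> 0" by auto
    then have l: "l \<le> Polynomial.degree f" by (rule le_degree)
    have "j \<le> Polynomial.degree (poly.coeff f l)" using nz by (rule le_degree)
    also have "\<dots> \<le> D" unfolding D_def by (rule member_le_sum) (use l in auto)
    finally show "j + l < Suc (D + Polynomial.degree f)" using l by simp
  qed
  then show ?thesis ..
qed

text \<open>Thus the monomials of degree less than \<open>k\<close> span the quotient for every
  \<open>E\<close>; only their independence singles out the chart.\<close>

lemma ideal_Z_reduce: "\<exists>g. tdeg_less k g \<and> f - g \<in> ideal_Z k E"
proof -
  have *: "tdeg_less d f \<Longrightarrow> \<exists>g. tdeg_less k g \<and> f - g \<in> ideal_Z k E" for d f
  proof (induction d arbitrary: f)
    case 0
    then show ?case using tdeg_less_mono[of 0 f k] ideal_Z_0 by (intro exI[of _ f]) simp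
  next
    case (Suc d)
    show ?case
    proof (cases "k \<le> d")
      case True
      from ideal_Z_reduce_step[OF Suc.prems True] obtain g where g: "tdeg_less d g" "f - g \<in> ideal_Z k
          E" by blast
      from Suc.IH[OF g(1)] obtain g' where "tdeg_less k g'" "g - g' \<in> ideal_Z k E" by blast
      then show ?thesis using ideal_Z_add[OF g(2)] by fastforce
    next
      case False
      then show ?thesis using tdeg_less_mono[OF Suc.prems, of k] ideal_Z_0 by (intro exI[of _ f]) simp
    qed
  qed
  obtain d where "tdeg_less d f" using tdeg_less_exists by blast
  then show ?thesis by (rule *)
qed

section \<open>Configurations of distinct points\<close>

abbreviation npts :: "nat \<Rightarrow> nat" where "npts k \<equiv> k * (k + 1) div 2"

definition distinct_zeros :: "nat \<Rightarrow> pt \<Rightarrow> (nat \<Rightarrow> complex \<times> complex) \<Rightarrow> bool" where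
  "distinct_zeros k E P \<longleftrightarrow>
     inj_on P {..<npts k} \<and> (\<forall>m<npts k. rank_drops k E (fst (P m)) (snd (P m)))"

lemma interpolation_poly:
  assumes "finite F" "p \<notin> F"
  shows "\<exists>f. eval_xy f p = 1 \<and> (\<forall>q\<in>F. eval_xy f q = 0)"
  using assms
proof (induction F rule: finite_induct)
  case empty
  show ?case by (intro exI[of _ 1]) simp
next
  case (insert q F)
  then obtain f where f: "eval_xy f p = 1" "\<forall>q\<in>F. eval_xy f q = 0" by auto
  have "\<exists>g. eval_xy g p = 1 \<and> eval_xy g q = 0"
  proof (cases "fst p = fst q")
    case False
    then show ?thesis
      by (intro exI[of _ "[:[:1 / (fst p - fst q):]:] * (mono_xy 1 0 - [:[:fst q:]:])"])
        (simp del: mult_pCons_left)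
  next
    case True
    then have "snd p \<noteq> snd q" using insert by (auto simp: prod_eq_iff)
    then show ?thesis
      by (intro exI[of _ "[:[:1 / (snd p - snd q):]:] * (mono_xy 0 1 - [:[:snd q:]:])"])
        (simp del: mult_pCons_left)
  qed
  then obtain g where "eval_xy g p = 1" "eval_xy g q = 0" by blast
  then show ?case using f by (intro exI[of _ "f * g"]) simp
qed

lemma ideal_Z_eval:
  assumes "f \<in> ideal_Z k E" "rank_drops k E (fst p) (snd p)"
  shows "eval_xy f p = 0"
proof -
  obtain q where "f = (\<Sum>r\<le>k. q r * maximal_minor k E r)"
    using assms(1) unfolding ideal_Z_def by blast
  then show ?thesis
    using eval_maximal_minor[of k E _ "fst p" "snd p"] rank_drops_minor_at[OF assms(2)] by simp
qed

text \<open>Polynomials separating the points, reduced modulo the ideal, give polynomials of degree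
  less than \<open>k\<close> dual to the point evaluations. They form a right inverse of the matrix
  that evaluates monomials at the points. There are as many monomials as points, so the matrix is
  square and the inverse is two-sided: evaluation is injective.\<close>

lemma distinct_zeros_unisolvent:
  assumes P: "distinct_zeros k E P" and g: "tdeg_less k g"
    and z: "\<And>m. m < npts k \<Longrightarrow> eval_xy g (P m) = 0"
  shows "g = 0"
proof -
  define n where "n = npts k"
  obtain e where e: "bij_betw e {0..<n} (tri_labels k)"
    using ex_bij_betw_nat_finite[OF finite_tri_labels] unfolding card_tri_labels n_def by metis
  have ex: "\<exists>h. tdeg_less k h \<and> (\<forall>m<n. eval_xy h (P m) = (if m = m' then 1 else 0))" if "m' < n" for m'
  proof -
    have "P m' \<notin> P ` ({..<n} - {m'})"
      using P that unfolding distinct_zeros_def n_def by (auto dest: inj_onD)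
    from interpolation_poly[OF _ this] obtain f where
      f: "eval_xy f (P m') = 1" "\<forall>q\<in>P ` ({..<n} - {m'}). eval_xy f q = 0" by auto
    obtain h where h: "tdeg_less k h" "f - h \<in> ideal_Z k E" using ideal_Z_reduce by blast
    have "eval_xy h (P m) = eval_xy f (P m)" if "m < n" for m
      using ideal_Z_eval[OF h(2), of "P m"] P that unfolding distinct_zeros_def n_def by simp
    then show ?thesis using f h(1) by (intro exI[of _ h]) auto
  qed
  then obtain h where h: "\<And>m'. m' < n \<Longrightarrow> tdeg_less k (h m')"
    "\<And>m m'. m' < n \<Longrightarrow> m < n \<Longrightarrow> eval_xy (h m') (P m) = (if m = m' then 1 else 0)"
    by metis
  define cf where "cf f t = poly.coeff (poly.coeff f (snd (e t))) (fst (e t))" for f :: "complex poly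
      poly" and t
  define w where "w m t = fst (P m) ^ fst (e t) * snd (P m) ^ snd (e t)" for m t
  have ev: "eval_xy f (P m) = (\<Sum>t<n. cf f t * w m t)" if "tdeg_less k f" for f m
    unfolding eval_tdeg_less[OF that] cf_def w_def
    using sum.reindex_bij_betw[OF e, of "\<lambda>(j, l). poly.coeff (poly.coeff f l) j * (fst (P m) ^ j * snd
        (P m) ^ l)"]
    by (simp add: case_prod_unfold atLeast0LessThan)
  define W where "W = Matrix.mat n n (\<lambda>(m, t). w m t)"
  define C where "C = Matrix.mat n n (\<lambda>(t, m). cf (h m) t)"
  have WC: "W * C = 1\<^sub>m n"
  proof (rule eq_matI)
    fix m m' assume "m < dim_row (1\<^sub>m n :: complex mat)" "m' < dim_col (1\<^sub>m n :: complex mat)"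
    then have m: "m < n" "m' < n" by auto
    have "(W * C) $$ (m, m') = (\<Sum>t<n. w m t * cf (h m') t)"
      using m by (simp add: W_def C_def scalar_prod_def atLeast0LessThan)
    also have "\<dots> = eval_xy (h m') (P m)" using ev[OF h(1)[OF m(2)]] by (simp add: mult.commute)
    finally show "(W * C) $$ (m, m') = 1\<^sub>m n $$ (m, m')" using h(2) m by simp
  qed (auto simp: W_def C_def)
  have CW: "C * W = 1\<^sub>m n"
    by (rule mat_mult_left_right_inverse[OF _ _ WC]) (auto simp: W_def C_def)
  have cf0: "cf g t = 0" if t: "t < n" for t
  proof -
    have "(\<Sum>m<n. cf (h m) t * w m t') = (if t = t' then 1 else 0)" if "t' < n" for t'
    proof -
      have "(C * W) $$ (t, t') = (\<Sum>m<n. cf (h m) t * w m t')"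
        using t that by (simp add: W_def C_def scalar_prod_def atLeast0LessThan)
      then show ?thesis using CW t that by simp
    qed
    then have "(\<Sum>t'<n. (\<Sum>m<n. cf (h m) t * w m t') * cf g t') = cf g t"
      using t by (simp add: if_distribR if_distrib[of "\<lambda>u. u * _"] cong: if_cong)
    moreover have "(\<Sum>t'<n. (\<Sum>m<n. cf (h m) t * w m t') * cf g t') =
        (\<Sum>m<n. cf (h m) t * (\<Sum>t'<n. cf g t' * w m t'))"
      unfolding sum_distrib_left sum_distrib_right by (subst sum.swap) (simp add: algebra_simps)
    moreover have "\<dots> = 0"
    proof (intro sum.neutral ballI)
      fix m assume "m \<in> {..<n}"
      then have "eval_xy g (P m) = 0" using z[of m] unfolding n_def by simp
      then have "(\<Sum>t'<n. cf g t' * w m t') = 0" unfolding ev[OF g] .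
      then show "cf (h m) t * (\<Sum>t'<n. cf g t' * w m t') = 0" by simp
    qed
    ultimately show ?thesis by simp
  qed
  have "poly.coeff (poly.coeff g l) j = 0" for j l
  proof (cases "(j, l) \<in> tri_labels k")
    case True
    then obtain t where "t < n" "e t = (j, l)" using e unfolding bij_betw_def by (metis
        atLeastLessThan_iff imageE)
    then show ?thesis using cf0[of t] by (simp add: cf_def)
  next
    case False
    then show ?thesis using g by (auto simp: tri_labels_def tdeg_less_def)
  qed
  then show ?thesis by (intro poly_eqI) simp
qed

text \<open>The ideal is radical: if \<open>f\<close> vanishes at all the points, so does its
  remainder of degree less than \<open>k\<close>, which is then zero.\<close>

lemma distinct_zeros_ideal:
  assumes P: "distinct_zeros k E P"
  shows "f \<in> ideal_Z k E \<longleftrightarrow> (\<forall>m<npts k. eval_xy f (P m) = 0)"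
proof
  assume "f \<in> ideal_Z k E"
  then show "\<forall>m<npts k. eval_xy f (P m) = 0"
    using P ideal_Z_eval unfolding distinct_zeros_def by blast
next
  assume z: "\<forall>m<npts k. eval_xy f (P m) = 0"
  obtain g where g: "tdeg_less k g" "f - g \<in> ideal_Z k E" using ideal_Z_reduce by blast
  have "eval_xy g (P m) = 0" if "m < npts k" for m
    using ideal_Z_eval[OF g(2), of "P m"] P that z unfolding distinct_zeros_def by simp
  then have "g = 0" by (rule distinct_zeros_unisolvent[OF P g(1)])
  then show "f \<in> ideal_Z k E" using g(2) by simp
qed

lemma distinct_zeros_basis:
  assumes P: "distinct_zeros k E P"
  shows "basis_mod (ideal_Z k E) {mono_xy j l | j l. j + l < k}"
proof -
  let ?m = "\<lambda>(j, l). mono_xy j l"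
  have B: "{mono_xy j l | j l. j + l < k} = ?m ` tri_labels k"
    by (auto simp: tri_labels_def)
  have inj: "inj_on ?m (tri_labels k)"
  proof (rule inj_onI, clarify)
    fix j l j' l' assume "mono_xy j l = mono_xy j' l'"
    then have "poly.coeff (poly.coeff (mono_xy j l) l') j' = poly.coeff (poly.coeff (mono_xy j' l') l')
        j'" by simp
    then show "j = j' \<and> l = l'" by (simp add: coeff_mono_xy split: if_splits)
  qed
  have s: "(\<Sum>b\<in>?m ` tri_labels k. Polynomial.smult [:c b:] b) =
      (\<Sum>(j, l)\<in>tri_labels k. Polynomial.smult [:c (mono_xy j l):] (mono_xy j l))" for c
    by (subst sum.reindex[OF inj]) (simp add: case_prod_unfold)
  show ?thesis unfolding basis_mod_def B s
  proof (intro conjI allI impI)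
    fix f
    obtain g where g: "tdeg_less k g" "f - g \<in> ideal_Z k E" using ideal_Z_reduce by blast
    \<comment> \<open>Coefficients in \<open>basis_mod\<close> are indexed by the basis polynomials
      themselves, so the exponents are read off with \<open>inv_into\<close>.\<close>
    define c where "c b = (let (j, l) = inv_into (tri_labels k) ?m b in poly.coeff (poly.coeff g l) j)" for b
    have "c (mono_xy j l) = poly.coeff (poly.coeff g l) j" if "(j, l) \<in> tri_labels k" for j l
      using inv_into_f_f[OF inj that] by (simp add: c_def)
    then have "(\<Sum>(j, l)\<in>tri_labels k. Polynomial.smult [:c (mono_xy j l):] (mono_xy j l)) =
       (\<Sum>(j, l)\<in>tri_labels k. Polynomial.smult [:poly.coeff (poly.coeff g l) j:] (mono_xy j l))"
      by (intro sum.cong refl) auto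
    also have "\<dots> = g" using tdeg_less_expand[OF g(1)] by simp
    finally show "\<exists>c. f - (\<Sum>(j, l)\<in>tri_labels k. Polynomial.smult [:c (mono_xy j l):] (mono_xy j l)) \<in>
        ideal_Z k E"
      using g(2) by (intro exI[of _ c]) simp
  next
    fix c
    let ?g = "\<Sum>(j, l)\<in>tri_labels k. Polynomial.smult [:c (mono_xy j l):] (mono_xy j l)"
    assume "?g \<in> ideal_Z k E"
    moreover have "tdeg_less k ?g"
      by (intro tdeg_less_sum) (auto simp: tri_labels_def simp del: smult_pCons intro!: tdeg_less_smult
          tdeg_less_mono_xy)
    ultimately have g0: "?g = 0"
      using distinct_zeros_unisolvent[OF P] distinct_zeros_ideal[OF P] by blast
    have "c (mono_xy j l) = 0" if "(j, l) \<in> tri_labels k" for j l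
    proof -
      have "poly.coeff (poly.coeff ?g l) j = (\<Sum>p\<in>tri_labels k. if p = (j, l) then c (mono_xy j l) else 0)"
        unfolding coeff_sum by (intro sum.cong refl) (auto simp: coeff_mono_xy split: if_splits)
      then show ?thesis using g0 that by simp
    qed
    then show "\<forall>b\<in>?m ` tri_labels k. c b = 0" by auto
  qed simp
qed

lemma distinct_zeros_zero_set:
  assumes P: "distinct_zeros k E P"
  shows "zero_set (ideal_Z k E) = P ` {..<npts k}"
proof (intro equalityI subsetI)
  fix p assume p: "p \<in> zero_set (ideal_Z k E)"
  show "p \<in> P ` {..<npts k}"
  proof (rule ccontr)
    assume "p \<notin> P ` {..<npts k}"
    from interpolation_poly[OF _ this] obtain f where
      f: "eval_xy f p = 1" "\<forall>q\<in>P ` {..<npts k}. eval_xy f q = 0" by auto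
    then have "f \<in> ideal_Z k E" using distinct_zeros_ideal[OF P] by auto
    then show False using p f(1) by (auto simp: zero_set_def)
  qed
qed (use distinct_zeros_ideal[OF P] in \<open>auto simp: zero_set_def\<close>)

section \<open>Multiplicities and the Hilbert-Chow image of distinct points\<close>

lemma basis_mod_UNIV: "basis_mod UNIV B \<longleftrightarrow> B = {}"
proof
  assume B: "basis_mod UNIV B"
  have "\<forall>c. (\<Sum>b\<in>B. Polynomial.smult [:c b:] b) \<in> UNIV \<longrightarrow> (\<forall>b\<in>B. c b = 0)"
    using B unfolding basis_mod_def by (elim conjE)
  from spec[OF this, of "\<lambda>_. 1"] have "\<forall>b\<in>B. (1 :: complex) = 0" by simp
  then show "B = {}" by auto
next
  assume "B = {}"
  then show "basis_mod UNIV B" by (simp add: basis_mod_def)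
qed

text \<open>Since \<open>colength\<close> selects a basis by choice, the cardinality has to be known
  for every basis, not only for \<open>{1}\<close>.\<close>

lemma basis_mod_point:
  assumes "basis_mod {f. eval_xy f p = 0} B"
  shows "card B = 1"
proof -
  have fin: "finite B"
    and span: "\<And>f. \<exists>c. eval_xy (f - (\<Sum>b\<in>B. Polynomial.smult [:c b:] b)) p = 0"
    and ind: "\<And>c b. eval_xy (\<Sum>b\<in>B. Polynomial.smult [:c b:] b) p = 0 \<Longrightarrow> b \<in> B \<Longrightarrow> c b = 0"
    using assms unfolding basis_mod_def mem_Collect_eq by (elim conjE, simp only:)+
  obtain c where "eval_xy (1 - (\<Sum>b\<in>B. Polynomial.smult [:c b:] b)) p = 0" using span by blast
  then have "(\<Sum>b\<in>B. c b * eval_xy b p) \<noteq> 0" by simp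
  then obtain b where b: "b \<in> B" "eval_xy b p \<noteq> 0"
    by (metis (no_types, lifting) mult_zero_right sum.neutral)
  have "b' = b" if b': "b' \<in> B" for b'
  proof (rule ccontr)
    assume ne: "b' \<noteq> b"
    define c where "c u = (if u = b then eval_xy b' p else if u = b' then - eval_xy b p else 0)" for u
    have "eval_xy (\<Sum>u\<in>B. Polynomial.smult [:c u:] u) p = (\<Sum>u\<in>B. c u * eval_xy u p)" by simp
    also have "\<dots> = (\<Sum>u\<in>{b, b'}. c u * eval_xy u p)"
      by (rule sum.mono_neutral_right) (use fin b b' in \<open>auto simp: c_def\<close>)
    also have "\<dots> = 0" using ne by (simp add: c_def)
    finally have "c b' = 0" by (rule ind[OF _ b'])
    then show False using ne b by (simp add: c_def)
  qed
  then have "B = {b}" using b(1) by blast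
  then show ?thesis by simp
qed

lemma colength_UNIV: "colength UNIV = 0"
proof -
  have "basis_mod UNIV (SOME B. basis_mod UNIV B)"
    by (rule someI[of _ "{}"]) (simp add: basis_mod_UNIV)
  then have "(SOME B. basis_mod UNIV B) = {}" unfolding basis_mod_UNIV .
  then show ?thesis by (simp add: colength_def)
qed

lemma colength_point: "colength {f. eval_xy f p = 0} = 1"
proof -
  have ex: "basis_mod {f. eval_xy f p = 0} {1}"
    unfolding basis_mod_def
  proof (intro conjI allI impI)
    show "\<exists>c. f - (\<Sum>b\<in>{1}. Polynomial.smult [:c b:] b) \<in> {f. eval_xy f p = 0}" for f
      by (rule exI[of _ "\<lambda>_. eval_xy f p"]) simp
  next
    fix c assume "(\<Sum>b\<in>{1}. Polynomial.smult [:c b:] b) \<in> {f. eval_xy f p = 0}"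
    then have "eval_xy (Polynomial.smult [:c 1:] 1) p = 0" by simp
    then show "\<forall>b\<in>{1}. c b = 0" unfolding eval_xy_smult by simp
  qed simp
  then have "basis_mod {f. eval_xy f p = 0} (SOME B. basis_mod {f. eval_xy f p = 0} B)"
    by (rule someI)
  then show ?thesis using ex basis_mod_point by (auto simp: colength_def)
qed

text \<open>A polynomial that is 1 at \<open>p\<close> and 0 at the other points multiplies
  everything vanishing at \<open>p\<close> into the ideal. So the local ideal is the maximal ideal
  at each of the given points and the whole ring elsewhere, and each given point has multiplicity
  one.\<close>

lemma distinct_zeros_hilbert_chow:
  assumes P: "distinct_zeros k E P"
  shows "hilbert_chow k E = mset (map P [0..<npts k])"
proof -
  have inj: "inj_on P {..<npts k}" using P by (simp add: distinct_zeros_def)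
  have c: "colength (local_ideal (ideal_Z k E) p) = (if p \<in> P ` {..<npts k} then 1 else 0)" for p
  proof -
    have fin: "finite (P ` {..<npts k} - {p})" and ni: "p \<notin> P ` {..<npts k} - {p}" by auto
    obtain h where h: "eval_xy h p = 1" "\<forall>q\<in>P ` {..<npts k} - {p}. eval_xy h q = 0"
      using interpolation_poly[OF fin ni] by blast
    show ?thesis
    proof (cases "p \<in> P ` {..<npts k}")
      case True
      then obtain m where m: "m < npts k" "p = P m" by auto
      have "local_ideal (ideal_Z k E) p = {f. eval_xy f p = 0}"
      proof (intro equalityI subsetI CollectI)
        fix f assume "f \<in> local_ideal (ideal_Z k E) p"
        then obtain h' where "eval_xy h' p \<noteq> 0" "h' * f \<in> ideal_Z k E"
          unfolding local_ideal_def by blast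
        then show "eval_xy f p = 0" using distinct_zeros_ideal[OF P] m by fastforce
      next
        fix f assume "f \<in> {f. eval_xy f p = 0}"
        then have "eval_xy (h * f) (P m) = 0" if "m < npts k" for m
          using h that by (cases "P m = p") auto
        then have "h * f \<in> ideal_Z k E" using distinct_zeros_ideal[OF P] by blast
        then show "f \<in> local_ideal (ideal_Z k E) p" using h unfolding local_ideal_def by force
      qed
      then show ?thesis using True by (simp add: colength_point)
    next
      case False
      have "f \<in> local_ideal (ideal_Z k E) p" for f
      proof -
        have "eval_xy (h * f) (P m) = 0" if "m < npts k" for m
          using h that False by auto
        then have "h * f \<in> ideal_Z k E" using distinct_zeros_ideal[OF P] by blast
        then show ?thesis using h unfolding local_ideal_def by force
      qed
      then have "local_ideal (ideal_Z k E) p = UNIV" by blast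
      then show ?thesis using False by (simp add: colength_UNIV)
    qed
  qed
  have "hilbert_chow k E = Abs_multiset (\<lambda>p. if p \<in> P ` {..<npts k} then 1 else 0)"
    unfolding hilbert_chow_def c ..
  also have "\<dots> = mset_set (P ` {..<npts k})"
    by (rule multiset_eqI) (subst Abs_multiset_inverse, auto)
  also have "\<dots> = mset (map P [0..<npts k])"
    using image_mset_mset_set[OF inj] by (simp add: atLeast0LessThan)
  finally show ?thesis .
qed

lemma distinct_zeros_chart:
  assumes P: "distinct_zeros k E P" and V: "\<And>m. m < npts k \<Longrightarrow> P m \<in> V"
    and E: "E \<in> es_labels k \<rightarrow>\<^sub>E UNIV"
  shows "E \<in> triangular_chart k V"
  unfolding triangular_chart_def
proof (intro CollectI conjI)
  show "zero_set (ideal_Z k E) \<subseteq> V" unfolding distinct_zeros_zero_set[OF P] using V by auto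
qed (rule E, rule distinct_zeros_basis[OF P])

section \<open>Brackets prescribed by the lifting property\<close>

definition nondeg_config :: "nat \<Rightarrow> (complex \<times> complex) set \<Rightarrow> pt \<Rightarrow> (nat \<Rightarrow> complex \<times> complex) \<Rightarrow> bool" where
  "nondeg_config k V E P \<longleftrightarrow> inj_on P {..<npts k} \<and>
     (\<forall>m<npts k. P m \<in> V \<and> nondeg_zero k E (fst (P m)) (snd (P m)))"

lemma nondeg_config_distinct_zeros: "nondeg_config k V E P \<Longrightarrow> distinct_zeros k E P"
  by (simp add: nondeg_config_def distinct_zeros_def nondeg_zero_def)

text \<open>The zeros are followed one by one. Continuity keeps them in the open set
  \<open>V\<close>, Hausdorff separation keeps them apart, and finitely many such conditions hold on
  a common neighbourhood.\<close>

lemma nondeg_config_persists: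
  assumes g: "nondeg_config k V E P" and V: "open V"
  obtains \<Gamma> X Y where "\<And>m. m < npts k \<Longrightarrow> \<Gamma> m 0 = P m"
    "\<And>m. m < npts k \<Longrightarrow> ((\<lambda>t. fst (\<Gamma> m t)) has_field_derivative X m) (at 0)"
    "\<And>m. m < npts k \<Longrightarrow> ((\<lambda>t. snd (\<Gamma> m t)) has_field_derivative Y m) (at 0)"
    "\<forall>\<^sub>F t in nhds 0. nondeg_config k V (affine_line E A t) (\<lambda>m. \<Gamma> m t)"
    "\<And>m r. m < npts k \<Longrightarrow> r \<le> k \<Longrightarrow> minor_at_dir k A E (fst (P m)) (snd (P m)) r +
       X m * minor_at_dx k E (fst (P m)) (snd (P m)) r + Y m * minor_at_dy k E (fst (P m)) (snd (P m)) r = 0"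
proof -
  define n where "n = npts k"
  define curve where "curve m \<xi> \<eta> X Y \<longleftrightarrow> \<xi> 0 = fst (P m) \<and> \<eta> 0 = snd (P m) \<and>
    (\<xi> has_field_derivative X) (at 0) \<and> (\<eta> has_field_derivative Y) (at 0) \<and>
    (\<forall>\<^sub>F t in nhds 0. nondeg_zero k (affine_line E A t) (\<xi> t) (\<eta> t)) \<and>
    (\<forall>r\<le>k. minor_at_dir k A E (fst (P m)) (snd (P m)) r + X * minor_at_dx k E (fst (P m)) (snd (P m)) r +
        Y * minor_at_dy k E (fst (P m)) (snd (P m)) r = 0)" for m \<xi> \<eta> X Y
  have "\<exists>\<xi> \<eta> X Y. curve m \<xi> \<eta> X Y" if "m < n" for m
  proof -
    have "nondeg_zero k E (fst (P m)) (snd (P m))" using g that by (simp add: nondeg_config_def n_def)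
    then show ?thesis
      by (rule nondeg_zero_persists[where A = A]) (unfold curve_def, blast)
  qed
  then obtain \<xi> \<eta> X Y where "\<And>m. m < n \<Longrightarrow> curve m (\<xi> m) (\<eta> m) (X m) (Y m)"
    by metis
  then have c: "\<And>m. m < n \<Longrightarrow> \<xi> m 0 = fst (P m)" "\<And>m. m < n \<Longrightarrow> \<eta> m 0 = snd (P m)"
    "\<And>m. m < n \<Longrightarrow> (\<xi> m has_field_derivative X m) (at 0)"
    "\<And>m. m < n \<Longrightarrow> (\<eta> m has_field_derivative Y m) (at 0)"
    "\<And>m. m < n \<Longrightarrow> \<forall>\<^sub>F t in nhds 0. nondeg_zero k (affine_line E A t) (\<xi> m t) (\<eta> m t)"
    "\<And>m r. m < n \<Longrightarrow> r \<le> k \<Longrightarrow> minor_at_dir k A E (fst (P m)) (snd (P m)) r +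
       X m * minor_at_dx k E (fst (P m)) (snd (P m)) r + Y m * minor_at_dy k E (fst (P m)) (snd (P m)) r = 0"
    unfolding curve_def by simp_all
  define \<Gamma> where "\<Gamma> m t = (\<xi> m t, \<eta> m t)" for m t
  have \<Gamma>0: "\<Gamma> m 0 = P m" if "m < n" for m using c(1,2)[OF that] by (simp add: \<Gamma>_def)
  have lim: "(\<Gamma> m \<longlongrightarrow> P m) (nhds 0)" if "m < n" for m
  proof -
    have "isCont (\<xi> m) 0" "isCont (\<eta> m) 0" using c(3,4)[OF that] by (simp_all add: DERIV_isCont)
    then have "(\<xi> m \<longlongrightarrow> \<xi> m 0) (nhds 0)" "(\<eta> m \<longlongrightarrow> \<eta> m 0) (nhds 0)"
      unfolding isCont_def tendsto_at_iff_tendsto_nhds by auto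
    then have "((\<lambda>t. (\<xi> m t, \<eta> m t)) \<longlongrightarrow> (\<xi> m 0, \<eta> m 0)) (nhds 0)" by (rule tendsto_Pair)
    then show ?thesis using c(1,2)[OF that] by (simp add: \<Gamma>_def[abs_def])
  qed
  have evV: "\<forall>\<^sub>F t in nhds 0. \<Gamma> m t \<in> V" if "m < n" for m
    using topological_tendstoD[OF lim[OF that] V] g that by (simp add: nondeg_config_def n_def)
  have evD: "\<forall>\<^sub>F t in nhds 0. \<Gamma> m t \<noteq> \<Gamma> l t" if ml: "m < n" "l < n" "m \<noteq> l" for m l
  proof -
    have "P m \<noteq> P l" using g ml by (auto simp: nondeg_config_def n_def dest: inj_onD)
    then obtain U W where UW: "open U" "open W" "P m \<in> U" "P l \<in> W" "U \<inter> W = {}"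
      using hausdorff by metis
    show ?thesis
      using topological_tendstoD[OF lim[OF ml(1)] UW(1,3)] topological_tendstoD[OF lim[OF ml(2)] UW(2,4)]
      by eventually_elim (use UW(5) in auto)
  qed
  have "\<forall>\<^sub>F t in nhds 0. \<forall>m\<in>{..<n}. \<Gamma> m t \<in> V \<and> nondeg_zero k (affine_line E A t) (\<xi> m t) (\<eta> m t) \<and>
      (\<forall>l\<in>{..<n} - {m}. \<Gamma> m t \<noteq> \<Gamma> l t)"
    by (intro eventually_ball_finite ballI eventually_conj evV c(5) evD) auto
  then have ev: "\<forall>\<^sub>F t in nhds 0. nondeg_config k V (affine_line E A t) (\<lambda>m. \<Gamma> m t)"
  proof eventually_elim
    case (elim t)
    then have "inj_on (\<lambda>m. \<Gamma> m t) {..<n}" by (auto simp: inj_on_def)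
    then show ?case using elim unfolding nondeg_config_def n_def[symmetric] by (auto simp: \<Gamma>_def)
  qed
  show thesis
    by (rule that[of \<Gamma> X Y, folded n_def])
      (use \<Gamma>0 c ev in \<open>auto simp: \<Gamma>_def n_def\<close>)
qed

section \<open>Symmetric test functions with prescribed gradients\<close>

definition has_gradient :: "complex poly poly \<Rightarrow> complex \<Rightarrow> complex \<Rightarrow> complex \<times> complex \<Rightarrow> bool" where
  "has_gradient f \<alpha> \<beta> p \<longleftrightarrow> (eval_xy f has_derivative (\<lambda>h. \<alpha> * fst h + \<beta> * snd h)) (at p)"

lemma has_gradient_exists: "\<exists>\<alpha> \<beta>. has_gradient f \<alpha> \<beta> p"
proof -
  obtain d where d: "tdeg_less d f" using tdeg_less_exists by blast
  let ?c = "\<lambda>j l. poly.coeff (poly.coeff f l) j"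
  define \<alpha> where "\<alpha> = (\<Sum>(j, l)\<in>tri_labels d. ?c j l * (of_nat j * fst p ^ (j - 1) * snd p ^ l))"
  define \<beta> where "\<beta> = (\<Sum>(j, l)\<in>tri_labels d. ?c j l * (fst p ^ j * (of_nat l * snd p ^ (l - 1))))"
  have "((\<lambda>p. \<Sum>(j, l)\<in>tri_labels d. ?c j l * (fst p ^ j * snd p ^ l)) has_derivative
     (\<lambda>h. \<Sum>(j, l)\<in>tri_labels d. ?c j l * (fst p ^ j * (of_nat l * snd h * snd p ^ (l - 1)) +
        (of_nat j * fst h * fst p ^ (j - 1)) * snd p ^ l))) (at p)"
    unfolding case_prod_unfold
    by (intro has_derivative_sum has_derivative_mult_right has_derivative_mult has_derivative_power
        has_derivative_fst has_derivative_snd has_derivative_ident)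
  also have "(\<lambda>h. \<Sum>(j, l)\<in>tri_labels d. ?c j l * (fst p ^ j * (of_nat l * snd h * snd p ^ (l - 1)) +
        (of_nat j * fst h * fst p ^ (j - 1)) * snd p ^ l)) = (\<lambda>h. \<alpha> * fst h + \<beta> * snd h)"
    unfolding \<alpha>_def \<beta>_def sum_distrib_right sum.distrib[symmetric] case_prod_unfold
    by (intro ext sum.cong refl) (simp add: algebra_simps)
  also have "(\<lambda>p. \<Sum>(j, l)\<in>tri_labels d. ?c j l * (fst p ^ j * snd p ^ l)) = eval_xy f"
    using eval_tdeg_less[OF d] by (intro ext) simp
  finally show ?thesis unfolding has_gradient_def by blast
qed

lemma continuous_on_eval_xy: "continuous_on S (eval_xy f)"
proof -
  have "isCont (eval_xy f) p" for p
    using has_gradient_exists[of f p] unfolding has_gradient_def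
    by (metis has_derivative_continuous)
  then show ?thesis by (simp add: continuous_at_imp_continuous_on)
qed

lemma has_gradient_curve:
  assumes g: "has_gradient f \<alpha> \<beta> (x t, y t)"
    and x: "(x has_field_derivative x') (at t)" and y: "(y has_field_derivative y') (at t)"
  shows "((\<lambda>t. eval_xy f (x t, y t)) has_field_derivative \<alpha> * x' + \<beta> * y') (at t)"
proof -
  have "((\<lambda>t. (x t, y t)) has_derivative (\<lambda>h. (x' * h, y' * h))) (at t)"
    using x y unfolding has_field_derivative_def by (rule has_derivative_Pair)
  from has_derivative_compose[OF this g[unfolded has_gradient_def]]
  have "((\<lambda>t. eval_xy f (x t, y t)) has_derivative (\<lambda>h. \<alpha> * (x' * h) + \<beta> * (y' * h))) (at t)" by simp
  then show ?thesis unfolding has_field_derivative_def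
    by (rule has_derivative_eq_rhs) (simp add: fun_eq_iff algebra_simps)
qed

text \<open>The polynomial is \<open>h * h * a\<close>, where \<open>h\<close> is 1 at
  \<open>P m\<close> and 0 at the other points, and \<open>a\<close> is affine with the desired
  gradient and zero at \<open>P m\<close>. The square removes the gradient at the other points; at
  \<open>P m\<close> the unknown gradient of \<open>h\<close> is multiplied by the value of
  \<open>a\<close>, which is zero.\<close>

lemma hermite_interpolation:
  assumes inj: "inj_on P {..<n::nat}" and m: "m < n"
  shows "\<exists>f. \<forall>l<n. has_gradient f (if l = m then \<alpha> else 0) (if l = m then \<beta> else 0) (P l)"
proof -
  have "P m \<notin> P ` ({..<n} - {m})" using inj m by (auto dest: inj_onD)
  from interpolation_poly[OF _ this] obtain h where
    h: "eval_xy h (P m) = 1" "\<forall>q\<in>P ` ({..<n} - {m}). eval_xy h q = 0" by auto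
  define a where "a = [:[:\<alpha>:]:] * (mono_xy 1 0 - [:[:fst (P m):]:]) + [:[:\<beta>:]:] * (mono_xy 0 1 - [:[:snd
      (P m):]:])"
  have a: "eval_xy a p = \<alpha> * (fst p - fst (P m)) + \<beta> * (snd p - snd (P m))" for p
    by (simp add: a_def del: mult_pCons_left)
  have da: "has_gradient a \<alpha> \<beta> p" for p
    unfolding has_gradient_def a[abs_def]
    by (rule has_derivative_eq_rhs, (rule derivative_intros | intro derivative_intros)+) (simp add:
        fun_eq_iff)
  show ?thesis
  proof (intro exI[of _ "h * h * a"] allI impI)
    fix l assume l: "l < n"
    obtain u v where "has_gradient h u v (P l)" using has_gradient_exists by blast
    then have dh: "(eval_xy h has_derivative (\<lambda>q. u * fst q + v * snd q)) (at (P l))"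
      by (simp add: has_gradient_def)
    have hl: "eval_xy h (P l) = (if l = m then 1 else 0)" using h l by auto
    have "((\<lambda>p. eval_xy h p * eval_xy h p * eval_xy a p) has_derivative
      (\<lambda>q. eval_xy h (P l) * eval_xy h (P l) * (\<alpha> * fst q + \<beta> * snd q) +
         (eval_xy h (P l) * (u * fst q + v * snd q) + (u * fst q + v * snd q) * eval_xy h (P l)) *
             eval_xy a (P l))) (at (P l))"
      by (intro has_derivative_mult dh da[unfolded has_gradient_def])
    moreover have "eval_xy a (P l) = 0" if "l = m" using that by (simp add: a)
    ultimately show "has_gradient (h * h * a) (if l = m then \<alpha> else 0) (if l = m then \<beta> else 0) (P l)"
      unfolding has_gradient_def eval_xy_mult[abs_def] by (cases "l = m") (simp_all add: hl h(1))
  qed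
qed

text \<open>Additive symmetric functions descend to the symmetric product, and at distinct points
  their differentials can be prescribed point by point.\<close>

definition point_sum :: "complex poly poly \<Rightarrow> (complex \<times> complex) multiset \<Rightarrow> complex" where
  "point_sum f M = sum_mset (image_mset (eval_xy f) M)"

lemma point_sum_mset: "point_sum f (mset (map P [0..<n])) = (\<Sum>i<n. eval_xy f (P i))"
  by (simp add: point_sum_def sum_unfold_sum_mset atLeast0LessThan image_mset.compositionality comp_def)

lemma point_sum_cycle: "point_sum f (cycle n z) = (\<Sum>i<n. eval_xy f (z (i, 0), z (i, 1)))"
  unfolding cycle_def by (rule point_sum_mset)

lemma point_sum_cycle_deriv:
  assumes g: "\<And>i. i < n \<Longrightarrow> has_gradient f (\<alpha> i) (\<beta> i) ((z(a := t)) (i, 0), (z(a := t)) (i, 1))"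
    and a: "a \<in> power_labels n"
  shows "((\<lambda>t. point_sum f (cycle n (z(a := t)))) has_field_derivative
    (if snd a = 0 then \<alpha> (fst a) else \<beta> (fst a))) (at t)"
proof -
  have c: "((\<lambda>t. (z(a := t)) b) has_field_derivative (if b = a then 1 else 0)) (at t)" for b
    by (cases "b = a") auto
  have "((\<lambda>t. \<Sum>i<n. eval_xy f ((z(a := t)) (i, 0), (z(a := t)) (i, 1))) has_field_derivative
     (\<Sum>i<n. \<alpha> i * (if (i, 0) = a then 1 else 0) + \<beta> i * (if (i, 1) = a then 1 else 0))) (at t)"
    by (intro DERIV_sum has_gradient_curve c) (use g in auto)
  also have "(\<Sum>i<n. \<alpha> i * (if (i, 0) = a then 1 else 0) + \<beta> i * (if (i, 1) = a then 1 else 0)) =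
     (\<Sum>i<n. if i = fst a then (if snd a = 0 then \<alpha> (fst a) else \<beta> (fst a)) else 0)"
    using a by (intro sum.cong refl) (auto simp: power_labels_def)
  also have "\<dots> = (if snd a = 0 then \<alpha> (fst a) else \<beta> (fst a))"
    using a by (auto simp: power_labels_def)
  finally show ?thesis by (simp only: point_sum_cycle)
qed

lemma holo_point_sum: "holo_on (power_labels n) U (point_sum f \<circ> cycle n)"
  unfolding holo_on_def
proof (intro conjI ballI)
  have pc: "continuous_on U (\<lambda>z :: pt. z b)" for b
    by (rule continuous_on_subset[of UNIV]) simp_all
  have "continuous_on U (\<lambda>z. \<Sum>i<n. eval_xy f (z (i, 0), z (i, 1)))"
    by (intro continuous_intros continuous_on_compose2[OF continuous_on_eval_xy[of UNIV f]]
        pc) auto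
  then show "continuous_on U (point_sum f \<circ> cycle n)"
    by (simp add: comp_def point_sum_cycle)
next
  fix z :: pt and a assume "a \<in> power_labels n"
  have "\<exists>D. ((\<lambda>t. point_sum f (cycle n (z(a := t)))) has_field_derivative D) (at t)" for t
  proof -
    have "\<forall>i. \<exists>\<alpha> \<beta>. has_gradient f \<alpha> \<beta> ((z(a := t)) (i, 0), (z(a := t)) (i, 1))"
      using has_gradient_exists by blast
    then obtain \<alpha> \<beta> where "\<And>i. has_gradient f (\<alpha> i) (\<beta> i) ((z(a := t)) (i, 0), (z(a := t)) (i, 1))"
      by metis
    from point_sum_cycle_deriv[OF this \<open>a \<in> power_labels n\<close>] show ?thesis by (rule exI)
  qed
  then show "(\<lambda>t. (point_sum f \<circ> cycle n) (z(a := t))) holomorphic_on {t. z(a := t) \<in> U}"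
    unfolding comp_def holomorphic_on_def field_differentiable_def
    by (meson has_field_derivative_at_within)
qed

definition unit_pt :: "label \<Rightarrow> pt" where
  "unit_pt b = (\<lambda>c. if c = b then 1 else 0)"

lemma affine_line_unit_pt: "E(b := t) = affine_line E (unit_pt b) (t - E b)"
  by (auto simp: affine_line_def unit_pt_def)

lemma minor_at_dir_unit:
  assumes "j \<le> k" "i < k"
  shows "minor_at_dir k (unit_pt (j, i)) E x y r = minor_cofactor k E x y r i j"
proof -
  have "(\<Sum>i'<k. unit_pt (j, i) (j', i') * minor_cofactor k E x y r i' j') = (if j' = j then
      minor_cofactor k E x y r i j else 0)" for j'
    using assms
    by (cases "j' = j") (simp_all add: unit_pt_def if_distrib[of "\<lambda>u. u * _"] cong: if_cong)
  then show ?thesis using assms by (simp add: minor_at_dir_def)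
qed

text \<open>Along a moving configuration the point sum changes only through \<open>P m\<close>, by
  minus the derivative of the minor in the direction of the velocity. The relation for moving zeros
  identifies this with the derivative of the minor with respect to the entry. So the cofactor matrix
  at a zero is the differential of a function pulled back from the symmetric product.\<close>

lemma point_sum_hilbert_chow_partial:
  assumes g: "nondeg_config k V E P" and V: "open V"
    and b: "b = (j, i)" "j \<le> k" "i < k" and m: "m < npts k" and r: "r \<le> k"
    and f: "\<And>l. l < npts k \<Longrightarrow> has_gradient f
       (if l = m then - minor_at_dx k E (fst (P m)) (snd (P m)) r else 0)
       (if l = m then - minor_at_dy k E (fst (P m)) (snd (P m)) r else 0) (P l)"
  shows "partial b (point_sum f \<circ> hilbert_chow k) E = minor_cofactor k E (fst (P m)) (snd (P m)) r i j"
proof -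
  obtain \<Gamma> X Y where \<Gamma>: "\<And>m. m < npts k \<Longrightarrow> \<Gamma> m 0 = P m"
    "\<And>m. m < npts k \<Longrightarrow> ((\<lambda>t. fst (\<Gamma> m t)) has_field_derivative X m) (at 0)"
    "\<And>m. m < npts k \<Longrightarrow> ((\<lambda>t. snd (\<Gamma> m t)) has_field_derivative Y m) (at 0)"
    "\<forall>\<^sub>F t in nhds 0. nondeg_config k V (affine_line E (unit_pt b) t) (\<lambda>m. \<Gamma> m t)"
    "\<And>m r. m < npts k \<Longrightarrow> r \<le> k \<Longrightarrow> minor_at_dir k (unit_pt b) E (fst (P m)) (snd (P m)) r +
       X m * minor_at_dx k E (fst (P m)) (snd (P m)) r + Y m * minor_at_dy k E (fst (P m)) (snd (P m)) r = 0"
    using nondeg_config_persists[OF g V, of "unit_pt b"] by blast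
  let ?D = "minor_cofactor k E (fst (P m)) (snd (P m)) r i j"
  define S where "S t = (\<Sum>l<npts k. eval_xy f (fst (\<Gamma> l t), snd (\<Gamma> l t)))" for t
  have "(S has_field_derivative
      (\<Sum>l<npts k. (if l = m then - minor_at_dx k E (fst (P m)) (snd (P m)) r else 0) * X l +
         (if l = m then - minor_at_dy k E (fst (P m)) (snd (P m)) r else 0) * Y l)) (at 0)"
    unfolding S_def by (intro DERIV_sum has_gradient_curve) (use \<Gamma>(1-3) f in auto)
  also have "(\<Sum>l<npts k. (if l = m then - minor_at_dx k E (fst (P m)) (snd (P m)) r else 0) * X l +
         (if l = m then - minor_at_dy k E (fst (P m)) (snd (P m)) r else 0) * Y l) =
      (\<Sum>l<npts k. if l = m then ?D else 0)"
  proof (intro sum.cong refl)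
    fix l
    have "?D + X m * minor_at_dx k E (fst (P m)) (snd (P m)) r + Y m * minor_at_dy k E (fst (P m)) (snd
        (P m)) r = 0"
      using \<Gamma>(5)[OF m r] minor_at_dir_unit[OF b(2,3)] b(1) by simp
    then have "?D = - (X m * minor_at_dx k E (fst (P m)) (snd (P m)) r) - Y m * minor_at_dy k E (fst (P
        m)) (snd (P m)) r"
      by (simp add: eq_neg_iff_add_eq_0 algebra_simps)
    then show "(if l = m then - minor_at_dx k E (fst (P m)) (snd (P m)) r else 0) * X l +
         (if l = m then - minor_at_dy k E (fst (P m)) (snd (P m)) r else 0) * Y l = (if l = m then ?D else 0)"
      by simp
  qed
  also have "\<dots> = ?D" using m by simp
  finally have dS: "(S has_field_derivative ?D) (at 0)" .
  have "((\<lambda>t. S (t - E b)) has_field_derivative ?D * 1) (at (E b))"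
    by (rule DERIV_chain'[where g = S]) (auto intro!: derivative_eq_intros dS)
  then have d: "deriv (\<lambda>t. S (t - E b)) (E b) = ?D" by (simp add: DERIV_imp_deriv)
  have "\<forall>\<^sub>F t in nhds (E b). point_sum f (hilbert_chow k (E(b := t))) = S (t - E b)"
  proof -
    have "((\<lambda>t. t - E b) \<longlongrightarrow> E b - E b) (nhds (E b))"
      by (intro tendsto_diff tendsto_const filterlim_ident)
    then have "\<forall>\<^sub>F t in nhds (E b). nondeg_config k V (affine_line E (unit_pt b) (t - E b)) (\<lambda>m. \<Gamma> m (t
        - E b))"
      by (intro eventually_compose_filterlim[OF \<Gamma>(4)]) simp
    then show ?thesis
    proof eventually_elim
      case (elim t)
      show ?case unfolding affine_line_unit_pt
        using distinct_zeros_hilbert_chow[OF nondeg_config_distinct_zeros[OF elim]]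
        by (simp add: point_sum_mset S_def del: mset_map)
    qed
  qed
  then have "deriv (\<lambda>t. point_sum f (hilbert_chow k (E(b := t)))) (E b) = deriv (\<lambda>t. S (t - E b)) (E b)"
    by (rule deriv_cong_ev) simp
  then show ?thesis unfolding partial_def comp_def d .
qed

lemma bracket_eq_matrix_bracket:
  assumes "\<And>j i. j \<le> k \<Longrightarrow> i < k \<Longrightarrow> partial (j, i) f E = Z i j"
    "\<And>j i. j \<le> k \<Longrightarrow> i < k \<Longrightarrow> partial (j, i) g E = Z' i j"
  shows "bracket (es_labels k) B f g E = matrix_bracket k B E Z Z'"
  unfolding bracket_def matrix_bracket_def es_labels_def sum.cartesian_product'
  by (intro sum.cong refl) (use assms in auto)

lemma product_bracket:
  assumes f: "\<And>a. a \<in> power_labels n \<Longrightarrow> partial a F z = (if snd a = 0 then \<alpha> (fst a) else \<beta> (fst a))"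
    and g: "\<And>a. a \<in> power_labels n \<Longrightarrow> partial a G z = (if snd a = 0 then \<alpha>' (fst a) else \<beta>' (fst a))"
  shows "bracket (power_labels n) (product_bivector h) F G z =
    (\<Sum>i<n. h (z (i, 0), z (i, 1)) * (\<alpha> i * \<beta>' i - \<beta> i * \<alpha>' i))"
proof -
  have "bracket (power_labels n) (product_bivector h) F G z =
    (\<Sum>a\<in>power_labels n. \<Sum>b\<in>power_labels n. product_bivector h z a b *
       (if snd a = 0 then \<alpha> (fst a) else \<beta> (fst a)) * (if snd b = 0 then \<alpha>' (fst b) else \<beta>' (fst b)))"
    unfolding bracket_def by (intro sum.cong refl) (simp add: f g)
  also have "\<dots> = (\<Sum>i<n. \<Sum>i'<n. if i' = i then h (z (i, 0), z (i, 1)) * (\<alpha> i * \<beta>' i - \<beta> i * \<alpha>' i) else 0)"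
    unfolding power_labels_def sum.cartesian_product'
  proof (rule sum.cong[OF refl])
    fix i
    show "(\<Sum>e\<in>{0, 1}. \<Sum>i'<n. \<Sum>e'\<in>{0, 1}. product_bivector h z (i, e) (i', e') *
       (if snd (i, e) = 0 then \<alpha> (fst (i, e)) else \<beta> (fst (i, e))) *
       (if snd (i', e') = 0 then \<alpha>' (fst (i', e')) else \<beta>' (fst (i', e')))) =
      (\<Sum>i'<n. if i' = i then h (z (i, 0), z (i, 1)) * (\<alpha> i * \<beta>' i - \<beta> i * \<alpha>' i) else 0)"
      by (subst sum.swap, intro sum.cong refl) (auto simp: product_bivector_def algebra_simps)
  qed
  also have "\<dots> = (\<Sum>i<n. h (z (i, 0), z (i, 1)) * (\<alpha> i * \<beta>' i - \<beta> i * \<alpha>' i))"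
    by (intro sum.cong refl) simp
  finally show ?thesis .
qed

text \<open>Both test functions have their gradient concentrated at one point, so the product
  bracket is nonzero only if the points coincide. The minus signs of the two gradients cancel in the
  Jacobian.\<close>

lemma lifted_matrix_bracket:
  assumes lift: "lifted_poisson k V h B" and V: "open V" and g: "nondeg_config k V E P"
    and E: "E \<in> es_labels k \<rightarrow>\<^sub>E UNIV"
    and ml: "m < npts k" "l < npts k" and rs: "r \<le> k" "s \<le> k"
  shows "matrix_bracket k B E (minor_cofactor k E (fst (P m)) (snd (P m)) r) (minor_cofactor k E (fst (P
      l)) (snd (P l)) s) =
    (if m = l then h (P m) * minor_jacobian k E (fst (P m)) (snd (P m)) r s else 0)"
proof -
  define n where "n = npts k"
  have inj: "inj_on P {..<n}" using g by (simp add: nondeg_config_def n_def)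
  let ?\<alpha> = "\<lambda>m r. - minor_at_dx k E (fst (P m)) (snd (P m)) r"
  let ?\<beta> = "\<lambda>m r. - minor_at_dy k E (fst (P m)) (snd (P m)) r"
  obtain f where f: "\<And>i. i < n \<Longrightarrow> has_gradient f (if i = m then ?\<alpha> m r else 0) (if i = m then ?\<beta> m r else
      0) (P i)"
    using hermite_interpolation[OF inj, of m "?\<alpha> m r" "?\<beta> m r"] ml by (auto simp: n_def)
  obtain f' where f': "\<And>i. i < n \<Longrightarrow> has_gradient f' (if i = l then ?\<alpha> l s else 0) (if i = l then ?\<beta> l s
      else 0) (P i)"
    using hermite_interpolation[OF inj, of l "?\<alpha> l s" "?\<beta> l s"] ml by (auto simp: n_def)
  \<comment> \<open>The zeros in the order given by \<open>P\<close>, as a point of the product; the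
    value \<open>undefined\<close> off the labels makes it extensional, as \<open>power_set\<close>
    demands.\<close>
  define z :: pt where "z = (\<lambda>a. if a \<in> power_labels n then (if snd a = 0 then fst (P (fst a)) else snd
      (P (fst a))) else undefined)"
  have zP: "(z (i, 0), z (i, 1)) = P i" if "i < n" for i
    using that by (simp add: z_def power_labels_def)
  have zV: "z \<in> power_set n V"
    using g zP unfolding power_set_def nondeg_config_def n_def[symmetric] by (auto simp: z_def)
  have E': "E \<in> triangular_chart k V"
    by (rule distinct_zeros_chart[OF nondeg_config_distinct_zeros[OF g] _ E]) (use g in \<open>simp add:
        nondeg_config_def\<close>)
  have cyc: "cycle n z = hilbert_chow k E"
    unfolding distinct_zeros_hilbert_chow[OF nondeg_config_distinct_zeros[OF g]] cycle_def n_def[symmetric]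
    using zP by (intro arg_cong[where f = mset] map_cong) auto
  have "bracket (es_labels k) B (point_sum f \<circ> hilbert_chow k) (point_sum f' \<circ> hilbert_chow k) E =
     bracket (power_labels n) (product_bivector h) (point_sum f \<circ> cycle n) (point_sum f' \<circ> cycle n) z"
    using lift E' zV cyc unfolding lifted_poisson_def Let_def n_def
    using holo_point_sum by blast
  moreover have "bracket (es_labels k) B (point_sum f \<circ> hilbert_chow k) (point_sum f' \<circ> hilbert_chow k) E =
     matrix_bracket k B E (minor_cofactor k E (fst (P m)) (snd (P m)) r) (minor_cofactor k E (fst (P l))
         (snd (P l)) s)"
    by (rule bracket_eq_matrix_bracket; rule point_sum_hilbert_chow_partial[OF g V])
      (use ml rs f f' in \<open>auto simp: n_def\<close>)
  moreover have pd: "partial a (point_sum F \<circ> cycle n) z = (if snd a = 0 then \<alpha> (fst a) else \<beta> (fst a))"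
    if a: "a \<in> power_labels n" and F: "\<And>i. i < n \<Longrightarrow> has_gradient F (\<alpha> i) (\<beta> i) (P i)" for a F \<alpha> \<beta>
  proof -
    have "((\<lambda>t. point_sum F (cycle n (z(a := t)))) has_field_derivative
      (if snd a = 0 then \<alpha> (fst a) else \<beta> (fst a))) (at (z a))"
      by (rule point_sum_cycle_deriv[OF _ a]) (use F zP in simp)
    then show ?thesis unfolding partial_def comp_def by (rule DERIV_imp_deriv)
  qed
  have "bracket (power_labels n) (product_bivector h) (point_sum f \<circ> cycle n) (point_sum f' \<circ> cycle n) z =
     (\<Sum>i<n. h (z (i, 0), z (i, 1)) * ((if i = m then ?\<alpha> m r else 0) * (if i = l then ?\<beta> l s else 0) -
        (if i = m then ?\<beta> m r else 0) * (if i = l then ?\<alpha> l s else 0)))"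
    by (rule product_bracket[where \<alpha> = "\<lambda>i. if i = m then ?\<alpha> m r else 0" and \<beta> = "\<lambda>i. if i = m then ?\<beta> m
        r else 0"
          and \<alpha>' = "\<lambda>i. if i = l then ?\<alpha> l s else 0" and \<beta>' = "\<lambda>i. if i = l then ?\<beta> l s else 0"])
      (rule pd, assumption, erule f, rule pd, assumption, erule f')
  moreover have "\<dots> = (\<Sum>i<n. if i = m then (if m = l then h (P m) * minor_jacobian k E (fst (P m)) (snd
      (P m)) r s else 0) else 0)"
    using zP by (intro sum.cong refl) (auto simp: minor_jacobian_def)
  moreover have "\<dots> = (if m = l then h (P m) * minor_jacobian k E (fst (P m)) (snd (P m)) r s else 0)"
    using ml by (simp add: n_def)
  ultimately show ?thesis by simp
qed

section \<open>Uniqueness of the lift\<close>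

text \<open>Appending a second copy of column \<open>i\<close> gives a square matrix with two equal
  columns. Expanding its zero determinant along the new column is the Hilbert-Burch
  relation.\<close>

lemma det_rows_syzygy:
  fixes f :: "nat \<Rightarrow> nat \<Rightarrow> 'a::comm_ring_1"
  assumes i: "i < k"
  shows "(\<Sum>r\<le>k. (-1) ^ r * f r i * det_rows k (\<lambda>a. f (skip r a))) = 0"
proof -
  define M where "M = Matrix.mat (Suc k) (Suc k) (\<lambda>(a, c). if c < k then f a c else f a i)"
  have M: "M \<in> carrier_mat (Suc k) (Suc k)" by (simp add: M_def)
  have "Determinant.det M = 0"
    by (rule det_identical_columns[OF M, of i k]) (use i in \<open>auto simp: M_def\<close>)
  moreover have "Determinant.det M = (\<Sum>a<Suc k. M $$ (a, k) * cofactor M a k)"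
    by (rule laplace_expansion_column[OF M]) simp
  moreover have "\<dots> = (\<Sum>r\<le>k. (-1) ^ k * ((-1) ^ r * f r i * det_rows k (\<lambda>a. f (skip r a))))"
    unfolding lessThan_Suc_atMost
  proof (intro sum.cong refl)
    fix r assume r: "r \<in> {..k}"
    have "mat_delete M r k = Matrix.mat k k (\<lambda>(a, c). f (skip r a) c)"
      by (rule eq_matI) (use r in \<open>auto simp: mat_delete_def M_def skip_def\<close>)
    then show "M $$ (r, k) * cofactor M r k = (-1) ^ k * ((-1) ^ r * f r i * det_rows k (\<lambda>a. f (skip r a)))"
      using r by (simp add: cofactor_def det_rows_def M_def power_add algebra_simps)
  qed
  moreover have "\<dots> = (-1) ^ k * (\<Sum>r\<le>k. (-1) ^ r * f r i * det_rows k (\<lambda>a. f (skip r a)))"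
    by (rule sum_distrib_left[symmetric])
  ultimately have "(-1) ^ k * ((-1) ^ k * (\<Sum>r\<le>k. (-1) ^ r * f r i * det_rows k (\<lambda>a. f (skip r a)))) = 0"
    by simp
  then show ?thesis by (simp only: mult.assoc[symmetric] power_mult_distrib[symmetric]) simp
qed

text \<open>The derivative of the Hilbert-Burch relation along \<open>A\<close>. Where the minors do
  not vary along \<open>A\<close>, it becomes a linear relation between the minors with the entries
  of \<open>A\<close>, up to sign, as coefficients.\<close>

lemma syzygy_direction:
  assumes i: "i < k"
  shows "(\<Sum>r\<le>k. (-1) ^ r * (A (r, i) * minor_at k E x y r + S_at E x y r i * minor_at_dir k A E x y r)) = 0"
proof -
  have dS: "((\<lambda>t. S_at (affine_line E A t) x y r i) has_derivative (\<lambda>h. A (r, i) * h)) (at 0)" for r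
    unfolding S_at_def affine_line_def
    by (rule has_derivative_eq_rhs, (rule derivative_intros | intro derivative_intros)+) (simp add:
        fun_eq_iff mult.commute)
  have dM: "((\<lambda>t. minor_at k (affine_line E A t) x y r) has_derivative (\<lambda>h. h * minor_at_dir k A E x y
      r)) (at 0)" if "r \<le> k" for r
    using minor_at_along_has_derivative[OF that, of "\<lambda>t. t" "\<lambda>h. h" 0 "\<lambda>_. x" "\<lambda>_. 0" "\<lambda>_. y" "\<lambda>_. 0" E
        A] by simp
  have "((\<lambda>t. \<Sum>r\<le>k. (-1) ^ r * (S_at (affine_line E A t) x y r i * minor_at k (affine_line E A t) x y
      r)) has_derivative
     (\<lambda>h. \<Sum>r\<le>k. (-1) ^ r * (S_at (affine_line E A 0) x y r i * (h * minor_at_dir k A E x y r) +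
        A (r, i) * h * minor_at k (affine_line E A 0) x y r))) (at 0)"
    by (intro has_derivative_sum has_derivative_mult_right has_derivative_mult dS dM) auto
  moreover have "(\<lambda>t. \<Sum>r\<le>k. (-1) ^ r * (S_at (affine_line E A t) x y r i * minor_at k (affine_line E A
      t) x y r)) = (\<lambda>t. 0)"
    using det_rows_syzygy[OF i, of "S_at (affine_line E A _) x y"] by (simp add: minor_at_def mult.assoc)
  ultimately have "((\<lambda>t::complex. 0::complex) has_derivative
     (\<lambda>h. \<Sum>r\<le>k. (-1) ^ r * (S_at (affine_line E A 0) x y r i * (h * minor_at_dir k A E x y r) +
        A (r, i) * h * minor_at k (affine_line E A 0) x y r))) (at 0)" by simp
  from has_derivative_unique[OF this has_derivative_const]
  have "(\<Sum>r\<le>k. (-1) ^ r * (S_at E x y r i * (1 * minor_at_dir k A E x y r) + A (r, i) * 1 * minor_at k E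
      x y r)) = 0"
    by (simp only: affine_line_0 fun_eq_iff)
  then show ?thesis by (simp add: add.commute)
qed

lemma eval_xy_all_0:
  assumes "\<And>p. eval_xy f p = 0"
  shows "f = 0"
proof (rule ccontr)
  assume "f \<noteq> 0"
  then have "finite {q. poly f q = 0}" by (rule poly_roots_finite)
  moreover have "range (\<lambda>y. [:y:]) \<subseteq> {q. poly f q = 0}"
  proof clarify
    fix y :: complex
    have "poly (poly f [:y:]) x = 0" for x using assms[of "(x, y)"] by (simp add: eval_xy_def)
    then show "poly f [:y:] = 0" by (simp add: poly_all_0_iff_0[symmetric])
  qed
  ultimately have "finite (range (\<lambda>y::complex. [:y:]))" by (rule rev_finite_subset)
  moreover have "inj (\<lambda>y::complex. [:y:])" by (auto simp: inj_def)
  ultimately show False using finite_imageD infinite_UNIV_char_0 by blast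
qed

text \<open>The monomial \<open>x ^ r * y ^ (k - r)\<close> occurs in minor \<open>r\<close> only,
  so its coefficient isolates \<open>c r\<close>.\<close>

lemma maximal_minors_independent:
  assumes z: "\<And>x y. (\<Sum>r\<le>k. c r * minor_at k E x y r) = 0" and r: "r \<le> k"
  shows "c r = 0"
proof -
  have "eval_xy (\<Sum>r\<le>k. Polynomial.smult [:c r:] (maximal_minor k E r)) p = 0" for p
    using z[of "fst p" "snd p"] by (simp add: eval_maximal_minor[of k E _ "fst p" "snd p", simplified])
  then have z0: "(\<Sum>r\<le>k. Polynomial.smult [:c r:] (maximal_minor k E r)) = 0"
    by (rule eval_xy_all_0)
  have "poly.coeff (poly.coeff (maximal_minor k E s) (k - r)) r = (if s = r then (-1) ^ r else 0)" if "s
      \<le> k" for s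
  proof -
    let ?l = "maximal_minor k E s - Polynomial.smult [:(-1) ^ s:] (mono_xy s (k - s))"
    have "poly.coeff (poly.coeff ?l (k - r)) r = 0"
      using maximal_minor_leading[OF that, of E] r unfolding tdeg_less_def by fastforce
    then show ?thesis using that r by (auto simp: coeff_mono_xy split: if_splits)
  qed
  then have "poly.coeff (poly.coeff (\<Sum>s\<le>k. Polynomial.smult [:c s:] (maximal_minor k E s)) (k - r)) r =
     (\<Sum>s\<le>k. if s = r then c r * (-1) ^ r else 0)"
    unfolding coeff_sum by (intro sum.cong refl) auto
  then show ?thesis using z0 r by simp
qed

lemma immersion:
  assumes P: "distinct_zeros k E P"
    and z: "\<And>m r. m < npts k \<Longrightarrow> r \<le> k \<Longrightarrow> minor_at_dir k A E (fst (P m)) (snd (P m)) r = 0"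
    and ji: "j \<le> k" "i < k"
  shows "A (j, i) = 0"
proof -
  have "minor_at_dir k A E x y r = 0" if r: "r \<le> k" for x y r
  proof -
    have "minor_dir k A E r = 0"
    proof (rule distinct_zeros_unisolvent[OF P tdeg_less_minor_dir])
      fix m assume "m < npts k"
      then show "eval_xy (minor_dir k A E r) (P m) = 0"
        using z[OF _ r] eval_minor_dir[OF r, of A E "fst (P m)" "snd (P m)"] by simp
    qed
    then show ?thesis using eval_minor_dir[OF r, of A E x y] by simp
  qed
  then have "(\<Sum>r\<le>k. ((-1) ^ r * A (r, i)) * minor_at k E x y r) = 0" for x y
    using syzygy_direction[OF ji(2), of A E x y] by (simp add: mult.assoc)
  from maximal_minors_independent[where c = "\<lambda>r. (-1) ^ r * A (r, i)", OF this ji(1)]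
  show ?thesis by simp
qed

lemma hilb_bracket_nondeg_config:
  assumes g: "nondeg_config k V E P" and ml: "m < npts k" "l < npts k" and rs: "r \<le> k" "s \<le> k"
  shows "matrix_bracket k (hilb_bracket k) E (minor_cofactor k E (fst (P m)) (snd (P m)) r)
      (minor_cofactor k E (fst (P l)) (snd (P l)) s) =
    (if m = l then fst (P m) * snd (P m) * minor_jacobian k E (fst (P m)) (snd (P m)) r s else 0)"
proof -
  have nd: "nondeg_zero k E (fst (P q)) (snd (P q))" if "q < npts k" for q using g that by (simp add:
      nondeg_config_def)
  then have sg: "rank_drops k E (fst (P q)) (snd (P q))" if "q < npts k" for q using that by (simp add:
      nondeg_zero_def)
  show ?thesis
  proof (cases "m = l")
    case False
    then have "P m \<noteq> P l" using g ml by (auto simp: nondeg_config_def dest: inj_onD)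
    then show ?thesis
      using False hilb_matrix_bracket_distinct[OF minor_cofactor_annihilates[OF sg rs(1)]
          minor_cofactor_annihilates[OF sg rs(2)]] ml
      by (simp add: prod_eq_iff)
  next
    case True
    let ?x = "fst (P m)" and ?y = "snd (P m)"
    obtain r' s' c where nz: "r' \<le> k" "s' \<le> k" "c < k" "minor_cofactor k E ?x ?y r' c s' \<noteq> 0"
      using nd[OF ml(1)] unfolding nondeg_zero_def by blast
    have "matrix_bracket k (hilb_bracket k) E (minor_cofactor k E ?x ?y r) (minor_cofactor k E ?x ?y s) =
       ?x * ?y * ((\<Sum>j<k. minor_cofactor k E ?x ?y r j (Suc j)) * (\<Sum>i<k. minor_cofactor k E ?x ?y s i i) -
         (\<Sum>j<k. minor_cofactor k E ?x ?y r j j) * (\<Sum>i<k. minor_cofactor k E ?x ?y s i (Suc i)))"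
    proof (rule hilb_matrix_bracket_same[OF minor_cofactor_annihilates[OF sg[OF ml(1)] rs(2)]])
      fix i i' j j' assume "i < k" "i' < k" "j \<le> k" "j' \<le> k"
      then show "minor_cofactor k E ?x ?y r i j * minor_cofactor k E ?x ?y s i' j' = minor_cofactor k E
          ?x ?y r i' j * minor_cofactor k E ?x ?y s i j'"
        using rank_drops_kernel_proportional[OF nz(4,1,2,3) rank_drops_minor_cofactor_kernel[OF sg[OF
            ml(1)] rs(1)] rank_drops_minor_cofactor_kernel[OF sg[OF ml(1)] rs(2)]]
        by blast
    qed
    then show ?thesis using True by (simp add: minor_jacobian_def minor_at_dx_def minor_at_dy_def)
  qed
qed

text \<open>Contracting the bivector with the first covector leaves a tangent vector, along which
  the minor is differentiated; in this form \<open>immersion\<close> applies.\<close>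

lemma matrix_bracket_minor_at_dir:
  "matrix_bracket k B E Z (minor_cofactor k E x y s) =
     minor_at_dir k (\<lambda>b. \<Sum>j\<le>k. \<Sum>i<k. B E (j, i) b * Z i j) E x y s"
proof -
  have "matrix_bracket k B E Z (minor_cofactor k E x y s) =
     (\<Sum>j\<le>k. \<Sum>b\<le>k. \<Sum>i<k. \<Sum>a<k. B E (j, i) (b, a) * Z i j * minor_cofactor k E x y s a b)"
    unfolding matrix_bracket_def by (intro sum.cong refl sum.swap)
  also have "\<dots> = (\<Sum>b\<le>k. \<Sum>j\<le>k. \<Sum>a<k. \<Sum>i<k. B E (j, i) (b, a) * Z i j * minor_cofactor k E x y s a b)"
    by (subst sum.swap) (intro sum.cong refl sum.swap)
  also have "\<dots> = (\<Sum>b\<le>k. \<Sum>a<k. \<Sum>j\<le>k. \<Sum>i<k. B E (j, i) (b, a) * Z i j * minor_cofactor k E x y s a b)"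
    by (intro sum.cong refl sum.swap)
  finally show ?thesis by (simp add: minor_at_dir_def sum_distrib_right)
qed

text \<open>The injectivity in \<open>immersion\<close> is used once per argument: with the first
  covector fixed, and then with the second label fixed.\<close>

lemma bracket_determined_at_nondeg_config:
  assumes g: "nondeg_config k V E P"
    and B: "\<And>m l r s. m < npts k \<Longrightarrow> l < npts k \<Longrightarrow> r \<le> k \<Longrightarrow> s \<le> k \<Longrightarrow>
      matrix_bracket k B E (minor_cofactor k E (fst (P m)) (snd (P m)) r) (minor_cofactor k E (fst (P
          l)) (snd (P l)) s) =
      matrix_bracket k B' E (minor_cofactor k E (fst (P m)) (snd (P m)) r) (minor_cofactor k E (fst (P
          l)) (snd (P l)) s)"
    and ji: "j \<le> k" "i < k" and ba: "b \<le> k" "a < k"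
  shows "B E (j, i) (b, a) = B' E (j, i) (b, a)"
proof -
  note P = nondeg_config_distinct_zeros[OF g]
  define T :: bivector where "T = (\<lambda>E u v. B E u v - B' E u v)"
  have T: "matrix_bracket k T E (minor_cofactor k E (fst (P m)) (snd (P m)) r) (minor_cofactor k E (fst
      (P l)) (snd (P l)) s) = 0"
    if "m < npts k" "l < npts k" "r \<le> k" "s \<le> k" for m l r s
    using B[OF that] unfolding matrix_bracket_def T_def by (simp add: left_diff_distrib sum_subtractf)
  have 1: "(\<Sum>j\<le>k. \<Sum>i<k. T E (j, i) (b, a) * minor_cofactor k E (fst (P m)) (snd (P m)) r i j) = 0"
    if "m < npts k" "r \<le> k" for m r
    by (rule immersion[OF P, where A = "\<lambda>u. \<Sum>j\<le>k. \<Sum>i<k. T E (j, i) u * minor_cofactor k E (fst (P m))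
        (snd (P m)) r i j"])
      (use T[OF that(1) _ that(2)] ba in \<open>simp_all add: matrix_bracket_minor_at_dir\<close>)
  have "T E (j, i) (b, a) = 0"
    by (rule immersion[OF P, where A = "\<lambda>u. T E u (b, a)"]) (use 1 ji in \<open>simp_all add: minor_at_dir_def\<close>)
  then show ?thesis by (simp add: T_def)
qed

section \<open>An explicit nondegenerate configuration\<close>

lemma minor_at_partial_x: "r \<le> k \<Longrightarrow> ((\<lambda>x. minor_at k E x y r) has_field_derivative minor_at_dx k E x y r)
    (at x)"
  unfolding has_field_derivative_def
  using minor_at_along_has_derivative[of r k "\<lambda>_. 0" "\<lambda>_. 0" x "\<lambda>x. x" "\<lambda>h. h" "\<lambda>_. y" "\<lambda>_. 0" E "\<lambda>_. 0"]
  by (simp add: mult_commute_abs)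

lemma minor_at_partial_y: "r \<le> k \<Longrightarrow> ((\<lambda>y. minor_at k E x y r) has_field_derivative minor_at_dy k E x y r)
    (at y)"
  unfolding has_field_derivative_def
  using minor_at_along_has_derivative[of r k "\<lambda>_. 0" "\<lambda>_. 0" y "\<lambda>_. x" "\<lambda>_. 0" "\<lambda>y. y" "\<lambda>h. h" E "\<lambda>_. 0"]
  by (simp add: mult_commute_abs)

text \<open>The scheme of this point consists of the points \<open>(\<epsilon> i, \<epsilon> j)\<close> with \<open>i \<le> j < k\<close>.\<close>

definition grid_pt :: "nat \<Rightarrow> complex \<Rightarrow> pt" where
  "grid_pt k \<epsilon> = (\<lambda>(j, i). if (j, i) \<in> es_labels k
     then (if j = i then \<epsilon> * of_nat i else if j = Suc i then - (\<epsilon> * of_nat i) else 0) else undefined)"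

lemma S_at_grid_pt:
  assumes "j \<le> k" "i < k"
  shows "S_at (grid_pt k \<epsilon>) x y j i =
    (if j = i then \<epsilon> * of_nat i - x else if j = Suc i then y - \<epsilon> * of_nat i else 0)"
  using assms by (auto simp: S_at_def grid_pt_def es_labels_def)

lemma prod_split_at: "r \<le> k \<Longrightarrow> (\<Prod>a<k. if a < r then f a else g a) = (\<Prod>a<r. f a) * (\<Prod>a\<in>{r..<k}. g a)"
  for f g :: "nat \<Rightarrow> complex"
proof -
  assume r: "r \<le> k"
  then have e: "{..<k} = {..<r} \<union> {r..<k}" by auto
  have "(\<Prod>a<r. if a < r then f a else g a) = (\<Prod>a<r. f a)"
    "(\<Prod>a\<in>{r..<k}. if a < r then f a else g a) = (\<Prod>a\<in>{r..<k}. g a)"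
    by (auto intro!: prod.cong)
  then show ?thesis unfolding e by (subst prod.union_disjoint) auto
qed

lemma minor_at_grid_pt:
  assumes r: "r \<le> k"
  shows "minor_at k (grid_pt k \<epsilon>) x y r = (\<Prod>a<r. \<epsilon> * of_nat a - x) * (\<Prod>a\<in>{r..<k}. y - \<epsilon> * of_nat a)"
proof -
  have "minor_at k (grid_pt k \<epsilon>) x y r = (\<Prod>a<k. S_at (grid_pt k \<epsilon>) x y (skip r a) a)"
    unfolding minor_at_def
    by (rule det_rows_bidiagonal[of r]) (use r in \<open>auto simp: S_at_grid_pt skip_le, auto simp: skip_def\<close>)
  also have "\<dots> = (\<Prod>a<k. if a < r then \<epsilon> * of_nat a - x else y - \<epsilon> * of_nat a)"
    by (intro prod.cong refl) (auto simp: S_at_grid_pt skip_le, auto simp: skip_def)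
  finally show ?thesis unfolding prod_split_at[OF r] .
qed

text \<open>The unit row keeps the bidiagonal shape and replaces by 1 exactly the factor
  \<open>y - \<epsilon> j\<close> that vanishes at the point.\<close>

lemma minor_cofactor_grid_pt:
  assumes ij: "i \<le> j" "j < k"
  shows "minor_cofactor k (grid_pt k \<epsilon>) x y i j (Suc j) =
    (\<Prod>a<i. \<epsilon> * of_nat a - x) * (\<Prod>a\<in>{i..<k}. if a = j then 1 else y - \<epsilon> * of_nat a)"
proof -
  let ?S = "S_at (grid_pt k \<epsilon>) x y"
  have u: "unskip i (Suc j) = j" using ij by (simp add: unskip_def)
  have "minor_cofactor k (grid_pt k \<epsilon>) x y i j (Suc j) = det_rows k ((\<lambda>a. ?S (skip i a))(j := unit_row j))"
    using ij by (simp add: minor_cofactor_def u)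
  also have "\<dots> = (\<Prod>a<k. ((\<lambda>a. ?S (skip i a))(j := unit_row j)) a a)"
    by (rule det_rows_bidiagonal[of i]) (use ij in \<open>auto simp: S_at_grid_pt skip_le unit_row_def, auto
        simp: skip_def\<close>)
  also have "\<dots> = (\<Prod>a<k. if a < i then \<epsilon> * of_nat a - x else if a = j then 1 else y - \<epsilon> * of_nat a)"
    using ij by (intro prod.cong refl) (auto simp: S_at_grid_pt skip_le unit_row_def, auto simp: skip_def)
  also have "\<dots> = (\<Prod>a<i. \<epsilon> * of_nat a - x) * (\<Prod>a\<in>{i..<k}. if a = j then 1 else y - \<epsilon> * of_nat a)"
    by (rule prod_split_at) (use ij in auto)
  finally show ?thesis .
qed

text \<open>Minor \<open>i\<close> contains the factor \<open>y - \<epsilon> j\<close> and minor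
  \<open>j + 1\<close> the factor \<open>\<epsilon> i - x\<close>. So the
  \<open>x\<close>-derivative of the former vanishes at the point, and the Jacobian is minus the
  product of its \<open>y\<close>-derivative with the \<open>x\<close>-derivative of the
  latter.\<close>

lemma nondeg_zero_grid_pt:
  assumes ij: "i \<le> j" "j < k" and e: "\<epsilon> \<noteq> 0"
  shows "nondeg_zero k (grid_pt k \<epsilon>) (\<epsilon> * of_nat i) (\<epsilon> * of_nat j)"
proof -
  let ?E = "grid_pt k \<epsilon>" and ?x = "\<epsilon> * of_nat i" and ?y = "\<epsilon> * of_nat j"
  have le: "i \<le> k" "Suc j \<le> k" using ij by auto
  have nz: "minor_cofactor k ?E ?x ?y i j (Suc j) \<noteq> 0"
    unfolding minor_cofactor_grid_pt[OF ij] using e by auto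
  have z1: "minor_at k ?E x ?y i = 0" for x
    unfolding minor_at_grid_pt[OF le(1)] using ij by force
  have z2: "minor_at k ?E ?x y (Suc j) = 0" for y
    unfolding minor_at_grid_pt[OF le(2)] using ij by force
  have sg: "rank_drops k ?E ?x ?y"
    by (rule two_minors_rank_drops[OF nz le ij(2) z1 z2])
  have dx: "minor_at_dx k ?E ?x ?y i = 0"
    using DERIV_unique[OF minor_at_partial_x[OF le(1), of ?E ?y ?x]] unfolding z1 by simp
  have dy: "minor_at_dy k ?E ?x ?y i \<noteq> 0"
  proof -
    \<comment> \<open>The factors other than \<open>y - \<epsilon> j\<close>; at the point, their
      product is the derivative of the minor.\<close>
    define C where "C y = (\<Prod>a<i. \<epsilon> * of_nat a - ?x) * (\<Prod>a\<in>{i..<k} - {j}. y - \<epsilon> * of_nat a)" for y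
    have C0: "C ?y \<noteq> 0" unfolding C_def using e by auto
    have "minor_at k ?E ?x y i = (y - ?y) * C y" for y
      unfolding minor_at_grid_pt[OF le(1)] C_def using ij by (simp add: prod.remove[of _ j])
    moreover have "((\<lambda>y. (y - ?y) * C y) has_field_derivative 1 * C ?y + deriv C ?y * (?y - ?y)) (at ?y)"
    proof (rule DERIV_mult)
      have "C holomorphic_on UNIV" unfolding C_def by (intro holomorphic_intros)
      then show "(C has_field_derivative deriv C ?y) (at ?y)" by (rule holomorphic_derivI) auto
    qed (auto intro!: derivative_eq_intros)
    ultimately have "((\<lambda>y. minor_at k ?E ?x y i) has_field_derivative C ?y) (at ?y)" by simp
    then show ?thesis using DERIV_unique[OF minor_at_partial_y[OF le(1)]] C0 by metis
  qed
  have dx': "minor_at_dx k ?E ?x ?y (Suc j) \<noteq> 0"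
  proof -
    define C where "C x = (\<Prod>a\<in>{..<Suc j} - {i}. \<epsilon> * of_nat a - x) * (\<Prod>a\<in>{Suc j..<k}. ?y - \<epsilon> * of_nat a)" for x
    have C0: "C ?x \<noteq> 0" unfolding C_def using e by auto
    have "minor_at k ?E x ?y (Suc j) = (?x - x) * C x" for x
    proof -
      have "(\<Prod>a<Suc j. \<epsilon> * of_nat a - x) = (?x - x) * (\<Prod>a\<in>{..<Suc j} - {i}. \<epsilon> * of_nat a - x)"
        by (rule prod.remove) (use ij in auto)
      then show ?thesis unfolding minor_at_grid_pt[OF le(2)] C_def by (simp only: mult.assoc)
    qed
    moreover have "((\<lambda>x. (?x - x) * C x) has_field_derivative (-1) * C ?x + deriv C ?x * (?x - ?x)) (at ?x)"
    proof (rule DERIV_mult)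
      have "C holomorphic_on UNIV" unfolding C_def by (intro holomorphic_intros)
      then show "(C has_field_derivative deriv C ?x) (at ?x)" by (rule holomorphic_derivI) auto
    qed (auto intro!: derivative_eq_intros)
    ultimately have "((\<lambda>x. minor_at k ?E x ?y (Suc j)) has_field_derivative - C ?x) (at ?x)" by simp
    then show ?thesis using DERIV_unique[OF minor_at_partial_x[OF le(2)]] C0 by (metis neg_equal_0_iff_equal)
  qed
  have "minor_jacobian k ?E ?x ?y i (Suc j) \<noteq> 0" using dx dy dx' by (simp add: minor_jacobian_def)
  then show ?thesis unfolding nondeg_zero_def using sg nz le ij(2) by blast
qed

lemma nondeg_config_grid_pt:
  assumes V: "open V" "(0, 0) \<in> V"
  shows "\<exists>\<epsilon> P. nondeg_config k V (grid_pt k \<epsilon>) P"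
proof -
  obtain \<delta> where \<delta>: "\<delta> > 0" "\<And>p. dist p (0, 0) < \<delta> \<Longrightarrow> p \<in> V"
    using V unfolding open_dist by blast
  \<comment> \<open>The denominator exceeds \<open>i + j\<close> for all \<open>i, j < k\<close>, so
    the grid stays within distance \<open>\<delta>\<close> of the origin.\<close>
  define \<epsilon> :: complex where "\<epsilon> = of_real (\<delta> / (2 * real k + 2))"
  have e: "\<epsilon> \<noteq> 0" using \<delta>(1) by (simp add: \<epsilon>_def of_real_eq_0_iff del: of_real_divide)
  have inV: "(\<epsilon> * of_nat i, \<epsilon> * of_nat j) \<in> V" if "i < k" "j < k" for i j
  proof (rule \<delta>(2))
    have ne: "norm \<epsilon> = \<delta> / (2 * real k + 2)" using \<delta>(1) by (simp add: \<epsilon>_def del: of_real_divide)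
    have "dist (\<epsilon> * of_nat i, \<epsilon> * of_nat j) (0, 0) \<le> norm (\<epsilon> * of_nat i) + norm (\<epsilon> * of_nat j)"
      using norm_Pair_le[of "\<epsilon> * of_nat i" "\<epsilon> * of_nat j"] by (simp add: dist_norm)
    also have "\<dots> = norm \<epsilon> * (real i + real j)" by (simp add: norm_mult algebra_simps)
    also have "\<dots> < norm \<epsilon> * (2 * real k + 2)" using that e by (intro mult_strict_left_mono) auto
    also have "\<dots> = \<delta>" by (simp add: ne)
    finally show "dist (\<epsilon> * of_nat i, \<epsilon> * of_nat j) (0, 0) < \<delta>" .
  qed
  obtain f where f: "bij_betw f {0..<npts k} (tri_labels k)"
    using ex_bij_betw_nat_finite[OF finite_tri_labels] unfolding card_tri_labels by metis
  \<comment> \<open>A label \<open>(i, l)\<close> of the triangle gives the grid point with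
    \<open>j = i + l\<close>, so the labels enumerate the pairs with
    \<open>i \<le> j < k\<close>.\<close>
  define P where "P m = (\<epsilon> * of_nat (fst (f m)), \<epsilon> * of_nat (fst (f m) + snd (f m)))" for m
  have fm: "fst (f m) + snd (f m) < k" if "m < npts k" for m
  proof -
    have "f m \<in> tri_labels k" using bij_betwE[OF f] that by simp
    then show ?thesis by (auto simp: tri_labels_def)
  qed
  have "nondeg_config k V (grid_pt k \<epsilon>) P"
    unfolding nondeg_config_def
  proof (intro conjI allI impI)
    show "inj_on P {..<npts k}"
    proof (rule inj_onI)
      fix m l assume ml: "m \<in> {..<npts k}" "l \<in> {..<npts k}" "P m = P l"
      then have "of_nat (fst (f m)) = (of_nat (fst (f l)) :: complex)"
        "of_nat (fst (f m) + snd (f m)) = (of_nat (fst (f l) + snd (f l)) :: complex)"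
        using e by (auto simp: P_def simp del: of_nat_add)
      then have "f m = f l" unfolding of_nat_eq_iff by (simp add: prod_eq_iff)
      then show "m = l" using f ml by (auto simp: bij_betw_def inj_on_def)
    qed
  next
    fix m assume "m < npts k"
    from fm[OF this] show "P m \<in> V" "nondeg_zero k (grid_pt k \<epsilon>) (fst (P m)) (snd (P m))"
      using inV[of "fst (f m)" "fst (f m) + snd (f m)"] nondeg_zero_grid_pt[OF _ _ e, of "fst (f m)"
          "fst (f m) + snd (f m)" k]
      by (simp_all add: P_def)
  qed
  then show ?thesis by blast
qed

section \<open>Contracting weights\<close>

definition weight_major :: "nat \<Rightarrow> int \<Rightarrow> int \<Rightarrow> int" where
  "weight_major k j i = (2 * i - int k + 1)\<^sup>2 - (2 * j - int k)\<^sup>2"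

definition weight_minor :: "nat \<Rightarrow> int \<Rightarrow> int \<Rightarrow> int" where
  "weight_minor k j i = (2 * j - int k) * (2 * i - int k + 1)"

text \<open>A comparison involves four values of \<open>weight_minor\<close>, each at most
  \<open>k ^ 2\<close> in absolute value, while \<open>weight_major\<close> changes by an integer.
  The factor \<open>4 * k ^ 2 + 1\<close> therefore makes the comparison lexicographic.\<close>

definition torus_weight :: "nat \<Rightarrow> label \<Rightarrow> int" where
  "torus_weight k = (\<lambda>(j, i). (4 * int k ^ 2 + 1) * weight_major k (int j) (int i) - weight_minor k (int
      j) (int i))"

text \<open>The drop in weight is the exponent of \<open>t\<close> acquired by the coefficient under
  the one-parameter subgroup, so a coefficient of the second kind tends to zero.\<close>

definition admissible_monomial :: "nat \<Rightarrow> label \<Rightarrow> label \<Rightarrow> label \<Rightarrow> label \<Rightarrow> bool" where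
  "admissible_monomial k a b c d \<longleftrightarrow> weight a b c d = (\<lambda>_. 0) \<or> torus_weight k c + torus_weight k d <
      torus_weight k a + torus_weight k b"

lemma admissible_monomial_same: "admissible_monomial k a b a b" "admissible_monomial k a b b a"
  by (auto simp: admissible_monomial_def weight_def)

lemma admissible_monomial_commute: "admissible_monomial k a b c d \<Longrightarrow> admissible_monomial k a b d c"
  by (auto simp: admissible_monomial_def weight_def fun_eq_iff algebra_simps)

lemma abs_weight_minor_le:
  assumes "j \<le> k" "i < k"
  shows "\<bar>weight_minor k (int j) (int i)\<bar> \<le> int k ^ 2"
proof -
  have "\<bar>2 * int j - int k\<bar> * \<bar>2 * int i - int k + 1\<bar> \<le> int k * int k"
    by (rule mult_mono) (use assms in auto)
  then show ?thesis by (simp add: weight_minor_def abs_mult power2_eq_square)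
qed

lemma admissible_monomial_primary:
  assumes "j \<le> k" "i < k" "b \<le> k" "a < k" "j' \<le> k" "i' < k" "b' \<le> k" "a' < k"
    and lt: "weight_major k (int j') (int i') + weight_major k (int b') (int a') < weight_major k (int
        j) (int i) + weight_major k (int b) (int a)"
  shows "admissible_monomial k (j, i) (b, a) (j', i') (b', a')"
proof -
  define N where "N = int k ^ 2"
  define D where "D = weight_major k (int j) (int i) + weight_major k (int b) (int a) - (weight_major k
      (int j') (int i') + weight_major k (int b') (int a'))"
  have N: "0 \<le> N" by (simp add: N_def)
  have "(4 * N + 1) * 1 \<le> (4 * N + 1) * D"
    by (rule mult_left_mono) (use lt N in \<open>auto simp: D_def\<close>)
  then have "4 * N + 1 \<le> (4 * N + 1) * weight_major k (int j) (int i) + (4 * N + 1) * weight_major k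
      (int b) (int a) -
      ((4 * N + 1) * weight_major k (int j') (int i') + (4 * N + 1) * weight_major k (int b') (int a'))"
    unfolding D_def by (simp add: right_diff_distrib distrib_left)
  moreover have "\<bar>weight_minor k (int j) (int i)\<bar> \<le> N" "\<bar>weight_minor k (int b) (int a)\<bar> \<le> N"
    "\<bar>weight_minor k (int j') (int i')\<bar> \<le> N" "\<bar>weight_minor k (int b') (int a')\<bar> \<le> N"
    unfolding N_def using assms by (simp_all add: abs_weight_minor_le)
  ultimately have "torus_weight k (j', i') + torus_weight k (b', a') < torus_weight k (j, i) +
      torus_weight k (b, a)"
    unfolding torus_weight_def N_def[symmetric] by simp
  then show ?thesis by (simp add: admissible_monomial_def)
qed

text \<open>Two rows move apart with fixed sum: \<open>p\<close> lies outside the interval between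
  \<open>j\<close> and \<open>b\<close>, so the sum of the squares of \<open>u\<close>
  grows.\<close>

lemma admissible_monomial_rows:
  assumes "j \<le> k" "i < k" "b \<le> k" "a < k" "p \<le> k" "p \<le> j + b" "j + b - p \<le> k"
    and "j = p \<or> 0 < (int p - int j) * (int p - int b)"
  shows "admissible_monomial k (j, i) (b, a) (p, i) (j + b - p, a)"
proof (cases "j = p")
  case True
  then show ?thesis by (simp add: admissible_monomial_same)
next
  case False
  then have pos: "0 < (int p - int j) * (int p - int b)" using assms by auto
  have "weight_major k (int j) (int i) + weight_major k (int b) (int a) - (weight_major k (int p) (int
      i) + weight_major k (int j + int b - int p) (int a)) =
      8 * ((int p - int j) * (int p - int b))"
    by (simp add: weight_major_def power2_eq_square algebra_simps)
  then show ?thesis using pos assms by (intro admissible_monomial_primary) (auto simp: of_nat_diff)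
qed

text \<open>Two columns move together with fixed sum: \<open>q\<close> lies strictly between
  \<open>i\<close> and \<open>a\<close>, so the sum of the squares of \<open>v\<close>
  falls.\<close>

lemma admissible_monomial_cols:
  assumes "j \<le> k" "i < k" "b \<le> k" "a < k" "q < k" "q \<le> i + a" "i + a - q < k"
    and "i = q \<or> (int q - int i) * (int q - int a) < 0"
  shows "admissible_monomial k (j, i) (b, a) (j, q) (b, i + a - q)"
proof (cases "i = q")
  case True
  then show ?thesis by (simp add: admissible_monomial_same)
next
  case False
  then have neg: "(int q - int i) * (int q - int a) < 0" using assms by auto
  have "weight_major k (int j) (int i) + weight_major k (int b) (int a) - (weight_major k (int j) (int
      q) + weight_major k (int b) (int i + int a - int q)) =
      - 8 * ((int q - int i) * (int q - int a))"
    by (simp add: weight_major_def power2_eq_square algebra_simps)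
  then show ?thesis using neg assms by (intro admissible_monomial_primary) (auto simp: of_nat_diff)
qed

text \<open>Row \<open>j\<close> and column \<open>a\<close> shift by the same amount
  \<open>s = p - j\<close>. The terms quadratic in \<open>s\<close> cancel in
  \<open>v\<^sup>2 - u\<^sup>2\<close>, and the change is \<open>4 s (v - u)\<close> with the odd
  number \<open>v - u = 2 a + 1 - 2 j\<close>.\<close>

lemma admissible_monomial_mixed1:
  assumes "j \<le> k" "i < k" "b \<le> k" "a < k" "p \<le> k" "j \<le> p + a" "p + a - j < k"
    and "j = p \<or> (int p - int j) * (2 * int a + 1 - 2 * int j) < 0"
  shows "admissible_monomial k (j, i) (b, a) (p, i) (b, p + a - j)"
proof (cases "j = p")
  case True
  then show ?thesis by (simp add: admissible_monomial_same)
next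
  case False
  then have neg: "(int p - int j) * (2 * int a + 1 - 2 * int j) < 0" using assms by auto
  have "weight_major k (int j) (int i) + weight_major k (int b) (int a) - (weight_major k (int p) (int
      i) + weight_major k (int b) (int p + int a - int j)) =
      - 4 * ((int p - int j) * (2 * int a + 1 - 2 * int j))"
    by (simp add: weight_major_def power2_eq_square algebra_simps)
  then show ?thesis using neg assms by (intro admissible_monomial_primary) (auto simp: of_nat_diff)
qed

lemma admissible_monomial_mixed2:
  assumes "j \<le> k" "i < k" "b \<le> k" "a < k" "q < k" "i \<le> b + q" "b + q - i \<le> k"
    and "i = q \<or> (int q - int i) * (2 * int i + 1 - 2 * int b) < 0"
  shows "admissible_monomial k (j, i) (b, a) (j, q) (b + q - i, a)"
proof (cases "i = q")
  case True
  then show ?thesis by (simp add: admissible_monomial_same)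
next
  case False
  then have neg: "(int q - int i) * (2 * int i + 1 - 2 * int b) < 0" using assms by auto
  have "weight_major k (int j) (int i) + weight_major k (int b) (int a) - (weight_major k (int j) (int
      q) + weight_major k (int b + int q - int i) (int a)) =
      - 4 * ((int q - int i) * (2 * int i + 1 - 2 * int b))"
    by (simp add: weight_major_def power2_eq_square algebra_simps)
  then show ?thesis using neg assms by (intro admissible_monomial_primary) (auto simp: of_nat_diff)
qed

text \<open>Rows and columns are unchanged as multisets, so the sums of \<open>weight_major\<close>
  agree; only \<open>weight_minor\<close> registers which row is paired with which column.\<close>

lemma admissible_monomial_swap:
  assumes "(int j - int b) * (int i - int a) \<le> 0"
  shows "admissible_monomial k (j, i) (b, a) (j, a) (b, i)"
proof (cases "j = b \<or> i = a")
  case True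
  then show ?thesis by (auto simp: admissible_monomial_same)
next
  case False
  then have neg: "(int j - int b) * (int i - int a) < 0" using assms by (simp add: order_less_le)
  have "torus_weight k (j, i) + torus_weight k (b, a) - (torus_weight k (j, a) + torus_weight k (b, i))
      = - 4 * ((int j - int b) * (int i - int a))"
    by (simp add: torus_weight_def weight_major_def weight_minor_def power2_eq_square algebra_simps)
  then show ?thesis using neg by (simp add: admissible_monomial_def)
qed

section \<open>The monomials of the explicit bracket\<close>

definition quadratic_form :: "nat \<Rightarrow> (label \<Rightarrow> label \<Rightarrow> complex) \<Rightarrow> pt \<Rightarrow> pt \<Rightarrow> complex" where
  "quadratic_form k K E F = (\<Sum>c\<in>es_labels k. \<Sum>d\<in>es_labels k. K c d * E c * F d)"

text \<open>The coefficients sit behind an existential quantifier and may be asymmetric in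
  \<open>c\<close> and \<open>d\<close>, so that an explicit formula can be treated summand by
  summand.\<close>

definition admissible_form :: "nat \<Rightarrow> label \<Rightarrow> label \<Rightarrow> (pt \<Rightarrow> complex) \<Rightarrow> bool" where
  "admissible_form k a b f \<longleftrightarrow>
     (\<exists>K. (\<forall>E. f E = quadratic_form k K E E) \<and> (\<forall>c d. K c d \<noteq> 0 \<longrightarrow> admissible_monomial k a b c d))"

lemma finite_es_labels [simp]: "finite (es_labels k)"
  by (simp add: es_labels_def)

lemma es_labels_iff [simp]: "(j, i) \<in> es_labels k \<longleftrightarrow> j \<le> k \<and> i < k"
  by (simp add: es_labels_def)

lemma admissible_form_0: "admissible_form k a b (\<lambda>E. 0)"
  unfolding admissible_form_def quadratic_form_def by (rule exI[of _ "\<lambda>_ _. 0"]) simp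

lemma admissible_form_add: "admissible_form k a b f \<Longrightarrow> admissible_form k a b g \<Longrightarrow> admissible_form k a b
    (\<lambda>E. f E + g E)"
proof -
  assume "admissible_form k a b f" "admissible_form k a b g"
  then obtain K K' where K: "\<And>E. f E = quadratic_form k K E E" "\<And>c d. K c d \<noteq> 0 \<Longrightarrow> admissible_monomial k
      a b c d"
    "\<And>E. g E = quadratic_form k K' E E" "\<And>c d. K' c d \<noteq> 0 \<Longrightarrow> admissible_monomial k a b c d"
    unfolding admissible_form_def by blast
  show ?thesis unfolding admissible_form_def
  proof (intro exI[of _ "\<lambda>c d. K c d + K' c d"] conjI allI impI)
    show "f E + g E = quadratic_form k (\<lambda>c d. K c d + K' c d) E E" for E
      by (simp add: K(1,3) quadratic_form_def distrib_right sum.distrib)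
    show "admissible_monomial k a b c d" if "K c d + K' c d \<noteq> 0" for c d
      using that K(2,4)[of c d] by (cases "K c d = 0") simp_all
  qed
qed

lemma admissible_form_uminus: "admissible_form k a b f \<Longrightarrow> admissible_form k a b (\<lambda>E. - f E)"
proof -
  assume "admissible_form k a b f"
  then obtain K where K: "\<And>E. f E = quadratic_form k K E E" "\<And>c d. K c d \<noteq> 0 \<Longrightarrow> admissible_monomial k a b c d"
    unfolding admissible_form_def by blast
  show ?thesis unfolding admissible_form_def
    by (intro exI[of _ "\<lambda>c d. - K c d"]) (auto simp: K quadratic_form_def sum_negf)
qed

lemma admissible_form_sum: "finite A \<Longrightarrow> (\<And>x. x \<in> A \<Longrightarrow> admissible_form k a b (f x)) \<Longrightarrow> admissible_form k a b
    (\<lambda>E. \<Sum>x\<in>A. f x E)"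
  by (induction A rule: finite_induct) (auto intro: admissible_form_0 admissible_form_add)

lemma admissible_form_if: "(P \<Longrightarrow> admissible_form k a b f) \<Longrightarrow> (\<not> P \<Longrightarrow> admissible_form k a b g) \<Longrightarrow>
    admissible_form k a b (\<lambda>E. if P then f E else g E)"
  by (cases P) auto

lemma admissible_form_monomial:
  assumes c: "c \<in> es_labels k" "d \<in> es_labels k" and admissible: "admissible_monomial k a b c d"
  shows "admissible_form k a b (\<lambda>E. E c * E d)"
proof -
  define K where "K u v = (if u = c then (if v = d then 1 else 0) else (0::complex))" for u v
  have "quadratic_form k K E E = E c * E d" for E
  proof -
    have "(\<Sum>v\<in>es_labels k. K u v * E u * E v) = (if u = c then E c * E d else 0)" for u
      using c(2) by (cases "u = c") (simp_all add: K_def if_distrib[of "\<lambda>x. x * _"] cong: if_cong)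
    then show ?thesis using c(1) by (simp add: quadratic_form_def)
  qed
  then show ?thesis unfolding admissible_form_def
    by (intro exI[of _ K]) (use admissible in \<open>auto simp: K_def split: if_splits\<close>)
qed

text \<open>Either half of the bracket splits into moves of two rows, or of two columns, and moves
  coupling a row with a column. Besides these, the term \<open>p = b\<close> of the first sum and
  the term \<open>q = a\<close> of the second produce the same exchange monomial \<open>sw\<close>,
  with coefficient -1 if \<open>b < j\<close> and +1 if \<open>a \<le> i\<close>. They cancel unless
  exactly one condition holds, and then \<open>(j - b) * (i - a) \<le> 0\<close>, which makes the
  exchange admissible.\<close>

lemma hilb_bracket_admissible_form:
  assumes ji: "j \<le> k" "i < k" and ba: "b \<le> k" "a < k"
  shows "admissible_form k (j, i) (b, a) (\<lambda>E. hilb_bracket k E (j, i) (b, a))"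
proof -
  define row where "row p E = (if j \<le> p then (if b < p \<and> p \<le> b + j then E (p, i) * E (j + b - p, a) else 0)
     else - (if p < b \<and> b + j < k + p + 1 then E (p, i) * E (j + b - p, a) else 0))" for p and E :: pt
  define mix where "mix p E = (if j \<le> p then - (if a < j then E (p, i) * E (b, p + a - j) else 0)
     else (if j \<le> a then E (p, i) * E (b, p + a - j) else 0))" for p and E :: pt
  define col where "col q E = (if q \<le> i then (if a < q then E (j, q) * E (b, i + a - q) else 0)
     else - (if q < a then E (j, q) * E (b, i + a - q) else 0))" for q and E :: pt
  define mix' where "mix' q E = (if q \<le> i then - (if b \<le> i \<and> i \<le> b + q then E (j, q) * E (b + q - i, a)
      else 0)
     else (if i < b \<and> b + q < k + i + 1 then E (j, q) * E (b + q - i, a) else 0))" for q and E :: pt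
  define sw where "sw E = E (j, a) * E (b, i)" for E :: pt
  have 1: "E (p, i) * y_reduction k E p (j - 1) (b, a) = row p E + mix p E - (if p = b then (if b < j
      then sw E else 0) else 0)"
    if "1 \<le> j" for E p
  proof -
    have e: "(j - 1 < p) = (j \<le> p)" "j - 1 + 1 = j" "p \<le> b + (j - 1) + 1 \<longleftrightarrow> p \<le> b + j" "a \<le> j - 1 \<longleftrightarrow> a < j"
      "j - 1 < a \<longleftrightarrow> j \<le> a" "b + (j - 1) < k + p \<longleftrightarrow> b + j < k + p + 1"
      using that by auto
    show ?thesis unfolding y_reduction_def row_def mix_def sw_def e prod.case
      using ji by (cases "j \<le> p"; cases "p = b") (auto simp: algebra_simps)
  qed
  have 2: "- (E (j, q) * y_reduction k E (i + 1) q (b, a)) = col q E + mix' q E + (if q = a then (if a \<le>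
      i then sw E else 0) else 0)"
    for E q
  proof -
    have e: "(q < i + 1) = (q \<le> i)" "b < i + 1 \<longleftrightarrow> b \<le> i" "i + 1 \<le> b + q + 1 \<longleftrightarrow> i \<le> b + q"
      "q + 1 + b - (i + 1) = b + q - i" "i + 1 + a - (q + 1) = i + a - q" "i + 1 \<le> b \<longleftrightarrow> i < b"
      "b + q < k + (i + 1) \<longleftrightarrow> b + q < k + i + 1"
      by auto
    show ?thesis unfolding y_reduction_def col_def mix'_def sw_def e prod.case
      by (cases "q \<le> i"; cases "q = a") (auto simp: algebra_simps)
  qed
  have eq: "hilb_bracket k E (j, i) (b, a) =
     (if 1 \<le> j then (\<Sum>p\<le>k. row p E + mix p E) else 0) + (\<Sum>q<k. col q E + mix' q E) +
     ((if a \<le> i then sw E else 0) + - (if b < j then sw E else 0))" for E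
  proof -
    have "(if 1 \<le> j then \<Sum>p\<le>k. E (p, i) * y_reduction k E p (j - 1) (b, a) else 0) =
       (if 1 \<le> j then (\<Sum>p\<le>k. row p E + mix p E) else 0) - (if b < j then sw E else 0)"
    proof (cases "1 \<le> j")
      case True
      have "(\<Sum>p\<le>k. E (p, i) * y_reduction k E p (j - 1) (b, a)) =
          (\<Sum>p\<le>k. row p E + mix p E - (if p = b then (if b < j then sw E else 0) else 0))"
        by (rule sum.cong[OF refl]) (rule 1[OF True])
      then show ?thesis using True ba by (simp add: sum_subtractf)
    qed simp
    moreover have "- (\<Sum>q<k. E (j, q) * y_reduction k E (i + 1) q (b, a)) =
       (\<Sum>q<k. col q E + mix' q E) + (if a \<le> i then sw E else 0)"
      unfolding sum_negf[symmetric] 2 using ba by (simp add: sum.distrib)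
    ultimately show ?thesis unfolding hilb_bracket_def by simp
  qed
  have row: "admissible_form k (j, i) (b, a) (row p)" if "p \<le> k" for p
    unfolding row_def
  proof (intro admissible_form_if admissible_form_0 admissible_form_uminus admissible_form_monomial;
      (elim conjE)?)
    assume p: "j \<le> p" "b < p" "p \<le> b + j"
    show "admissible_monomial k (j, i) (b, a) (p, i) (j + b - p, a)"
    proof (rule admissible_monomial_rows[OF ji ba that])
      show "j = p \<or> 0 < (int p - int j) * (int p - int b)"
        using p by (cases "j = p") (simp_all add: mult_pos_pos)
    qed (use p ji ba that in linarith)+
  next
    assume p: "\<not> j \<le> p" "p < b" "b + j < k + p + 1"
    show "admissible_monomial k (j, i) (b, a) (p, i) (j + b - p, a)"
    proof (rule admissible_monomial_rows[OF ji ba that])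
      show "j = p \<or> 0 < (int p - int j) * (int p - int b)"
        using p by (intro disjI2 mult_neg_neg) simp_all
    qed (use p ji ba that in linarith)+
  qed (use that ji ba in auto)
  have mix: "admissible_form k (j, i) (b, a) (mix p)" if "p \<le> k" for p
    unfolding mix_def
  proof (intro admissible_form_if admissible_form_0 admissible_form_uminus admissible_form_monomial)
    assume p: "j \<le> p" "a < j"
    show "admissible_monomial k (j, i) (b, a) (p, i) (b, p + a - j)"
    proof (rule admissible_monomial_mixed1[OF ji ba that])
      show "j = p \<or> (int p - int j) * (2 * int a + 1 - 2 * int j) < 0"
        using p by (cases "j = p") (simp_all add: mult_pos_neg)
    qed (use p ji ba that in linarith)+
  next
    assume p: "\<not> j \<le> p" "j \<le> a"
    show "admissible_monomial k (j, i) (b, a) (p, i) (b, p + a - j)"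
    proof (rule admissible_monomial_mixed1[OF ji ba that])
      show "j = p \<or> (int p - int j) * (2 * int a + 1 - 2 * int j) < 0"
        using p by (intro disjI2 mult_neg_pos) simp_all
    qed (use p ji ba that in linarith)+
  qed (use that ji ba in auto)
  have col: "admissible_form k (j, i) (b, a) (col q)" if "q < k" for q
    unfolding col_def
  proof (intro admissible_form_if admissible_form_0 admissible_form_uminus admissible_form_monomial)
    assume q: "q \<le> i" "a < q"
    show "admissible_monomial k (j, i) (b, a) (j, q) (b, i + a - q)"
    proof (rule admissible_monomial_cols[OF ji ba that])
      show "i = q \<or> (int q - int i) * (int q - int a) < 0"
        using q by (cases "i = q") (simp_all add: mult_neg_pos)
    qed (use q ji ba that in linarith)+
  next
    assume q: "\<not> q \<le> i" "q < a"
    show "admissible_monomial k (j, i) (b, a) (j, q) (b, i + a - q)"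
    proof (rule admissible_monomial_cols[OF ji ba that])
      show "i = q \<or> (int q - int i) * (int q - int a) < 0"
        using q by (intro disjI2 mult_pos_neg) simp_all
    qed (use q ji ba that in linarith)+
  qed (use that ji ba in auto)
  have mix': "admissible_form k (j, i) (b, a) (mix' q)" if "q < k" for q
    unfolding mix'_def
  proof (intro admissible_form_if admissible_form_0 admissible_form_uminus admissible_form_monomial;
      (elim conjE)?)
    assume q: "q \<le> i" "b \<le> i" "i \<le> b + q"
    show "admissible_monomial k (j, i) (b, a) (j, q) (b + q - i, a)"
    proof (rule admissible_monomial_mixed2[OF ji ba that])
      show "i = q \<or> (int q - int i) * (2 * int i + 1 - 2 * int b) < 0"
        using q by (cases "i = q") (simp_all add: mult_neg_pos)
    qed (use q ji ba that in linarith)+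
  next
    assume q: "\<not> q \<le> i" "i < b" "b + q < k + i + 1"
    show "admissible_monomial k (j, i) (b, a) (j, q) (b + q - i, a)"
    proof (rule admissible_monomial_mixed2[OF ji ba that])
      show "i = q \<or> (int q - int i) * (2 * int i + 1 - 2 * int b) < 0"
        using q by (intro disjI2 mult_pos_neg) simp_all
    qed (use q ji ba that in linarith)+
  qed (use that ji ba in auto)
  have swap: "admissible_form k (j, i) (b, a) (\<lambda>E. (if a \<le> i then sw E else 0) + - (if b < j then sw E
      else 0))"
  proof -
    have sw: "admissible_form k (j, i) (b, a) sw" if "(int j - int b) * (int i - int a) \<le> 0"
      unfolding sw_def by (rule admissible_form_monomial) (use that ji ba in \<open>auto intro:
          admissible_monomial_swap\<close>)
    consider "a \<le> i" "b < j" | "\<not> a \<le> i" "\<not> b < j" | "a \<le> i" "\<not> b < j" | "\<not> a \<le> i" "b < j" by blast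
    then show ?thesis
    proof cases
      case 3
      then show ?thesis using sw by (simp add: mult_le_0_iff)
    next
      case 4
      then show ?thesis using admissible_form_uminus[OF sw] by (simp add: mult_le_0_iff)
    qed (simp_all add: admissible_form_0)
  qed
  show ?thesis unfolding eq
    by (intro admissible_form_add admissible_form_if admissible_form_sum admissible_form_0 swap)
      (simp_all add: row mix col mix' admissible_form_add)
qed

section \<open>Comparison of coefficients and passage to the limit\<close>

lemma quadratic_form_unit:
  assumes "c \<in> es_labels k" "d \<in> es_labels k"
  shows "quadratic_form k D (unit_pt c) (unit_pt d) = D c d"
proof -
  have "(\<Sum>v\<in>es_labels k. D u v * unit_pt c u * unit_pt d v) = (if u = c then D c d else 0)" for u
    using assms(2) by (cases "u = c") (simp_all add: unit_pt_def if_distrib[of "\<lambda>x. _ * x"] cong: if_cong)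
  then show ?thesis using assms(1) by (simp add: quadratic_form_def)
qed

lemma quadratic_form_affine_line:
  "quadratic_form k D (affine_line E A t) (affine_line E A t) =
    quadratic_form k D E E + t * (quadratic_form k D E A + quadratic_form k D A E) + t\<^sup>2 *
        quadratic_form k D A A"
  unfolding quadratic_form_def affine_line_def
  by (simp add: sum_distrib_left sum.distrib[symmetric] algebra_simps power2_eq_square)

text \<open>Along the line the form is a polynomial of degree at most two in \<open>t\<close>.
  Adding its values at \<open>s\<close> and \<open>- s\<close> isolates the leading coefficient,
  which depends on the direction \<open>A\<close> alone and no longer on the base point.\<close>

lemma quadratic_form_vanishes:
  assumes ev: "\<forall>\<^sub>F t in nhds 0. quadratic_form k D (affine_line E A t) (affine_line E A t) = 0"
  shows "quadratic_form k D A A = 0"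
proof -
  obtain e where e: "e > 0" "\<And>t. dist t 0 < e \<Longrightarrow> quadratic_form k D (affine_line E A t) (affine_line E A
      t) = 0"
    using ev unfolding eventually_nhds_metric by blast
  define s where "s = complex_of_real (e / 2)"
  have s: "s \<noteq> 0" "dist s 0 < e" "dist (- s) 0 < e" using e(1) by (simp_all add: s_def)
  let ?p = "quadratic_form k D E A + quadratic_form k D A E" and ?q = "quadratic_form k D A A"
  have "quadratic_form k D E E = 0" using e(2)[of 0] e(1) by simp
  then have "s * ?p + s\<^sup>2 * ?q = 0" "- s * ?p + s\<^sup>2 * ?q = 0"
    using e(2)[OF s(2)] e(2)[OF s(3)] unfolding quadratic_form_affine_line by simp_all
  then have "2 * (s\<^sup>2 * ?q) = 0" by (simp add: algebra_simps)
  then show ?thesis using s(1) by simp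
qed

text \<open>The given and the explicit bracket agree near the grid point on every line in the
  coordinate space, so their difference vanishes as a quadratic form. This fixes coefficients only
  up to symmetrisation, which is harmless because admissibility is symmetric in \<open>c\<close> and
  \<open>d\<close>.\<close>

lemma lifted_coefficients_admissible:
  assumes V: "open V" "(0, 0) \<in> V" and Q: "quadratic_bivector k Q"
    and lift: "lifted_poisson k V (\<lambda>(x, y). x * y) (bivector_field k Q)"
    and nz: "Q u v c d \<noteq> 0"
  shows "admissible_monomial k u v c d"
proof -
  have lab: "u \<in> es_labels k" "v \<in> es_labels k" "c \<in> es_labels k" "d \<in> es_labels k"
    using Q nz unfolding quadratic_bivector_def by blast+
  obtain j i b a where uv: "u = (j, i)" "v = (b, a)" by (metis surj_pair)
  have ji: "j \<le> k" "i < k" "b \<le> k" "a < k" using lab uv by auto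
  obtain K where K: "\<And>E. hilb_bracket k E u v = quadratic_form k K E E"
    "\<And>c d. K c d \<noteq> 0 \<Longrightarrow> admissible_monomial k u v c d"
    using hilb_bracket_admissible_form[OF ji] unfolding admissible_form_def uv by blast
  define D where "D c d = Q u v c d - K c d" for c d
  have D: "quadratic_form k D E E = bivector_field k Q E u v - hilb_bracket k E u v" for E
    unfolding K quadratic_form_def D_def bivector_field_def
    by (simp add: left_diff_distrib sum_subtractf)
  obtain \<epsilon> P where g0: "nondeg_config k V (grid_pt k \<epsilon>) P" using nondeg_config_grid_pt[OF V] by blast
  \<comment> \<open>Directions have to vanish off the labels for the line to stay among the
    extensional functions.\<close>
  have van: "quadratic_form k D A A = 0" if A: "\<And>l. l \<notin> es_labels k \<Longrightarrow> A l = 0" for A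
  proof (rule quadratic_form_vanishes)
    obtain \<Gamma> where "\<forall>\<^sub>F t in nhds 0. nondeg_config k V (affine_line (grid_pt k \<epsilon>) A t) (\<lambda>m. \<Gamma> m t)"
      by (rule nondeg_config_persists[OF g0 V(1), where A = A], rule that)
    then show "\<forall>\<^sub>F t in nhds 0. quadratic_form k D (affine_line (grid_pt k \<epsilon>) A t) (affine_line (grid_pt
        k \<epsilon>) A t) = 0"
    proof eventually_elim
      case (elim t)
      let ?E = "affine_line (grid_pt k \<epsilon>) A t"
      have E: "?E \<in> es_labels k \<rightarrow>\<^sub>E UNIV"
        using A by (auto simp: affine_line_def grid_pt_def extensional_def PiE_def split: prod.splits)
      have "bivector_field k Q ?E (j, i) (b, a) = hilb_bracket k ?E (j, i) (b, a)"
        by (rule bracket_determined_at_nondeg_config[OF elim _ ji])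
          (simp add: lifted_matrix_bracket[OF lift V(1) elim E] hilb_bracket_nondeg_config[OF elim]
              case_prod_unfold)
      then show ?case unfolding D uv by simp
    qed
  qed
  \<comment> \<open>Polarisation: the values at two basis vectors and at their sum give the
    symmetrised coefficient.\<close>
  have "quadratic_form k D (affine_line (unit_pt c) (unit_pt d) 1) (affine_line (unit_pt c) (unit_pt d)
      1) = 0"
    "quadratic_form k D (unit_pt c) (unit_pt c) = 0" "quadratic_form k D (unit_pt d) (unit_pt d) = 0"
    by (rule van; use lab in \<open>auto simp: affine_line_def unit_pt_def\<close>)+
  then have "quadratic_form k D (unit_pt c) (unit_pt d) + quadratic_form k D (unit_pt d) (unit_pt c) = 0"
    unfolding quadratic_form_affine_line by simp
  then have "D c d + D d c = 0" using lab by (simp add: quadratic_form_unit)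
  moreover have "Q u v d c = Q u v c d" using Q unfolding quadratic_bivector_def by blast
  ultimately have "2 * Q u v c d = K c d + K d c" by (simp add: D_def algebra_simps)
  then have "K c d \<noteq> 0 \<or> K d c \<noteq> 0" using nz by auto
  then show ?thesis using K(2) admissible_monomial_commute by blast
qed

text \<open>Function types carry the product topology; repeated use reduces the limit of a
  coefficient family to its single entries.\<close>

lemma tendsto_coordinatewise:
  fixes f :: "'x \<Rightarrow> 'i \<Rightarrow> 'a::topological_space"
  assumes "\<And>i. ((\<lambda>x. f x i) \<longlongrightarrow> l i) F"
  shows "(f \<longlongrightarrow> l) F"
proof -
  have "limitin (product_topology (\<lambda>i. euclidean) UNIV) f l F"
    unfolding limitin_componentwise using assms by simp
  then show ?thesis by (simp add: euclidean_product_topology)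
qed

theorem theorem4p13:
  fixes k :: nat and V :: "(complex \<times> complex) set" and \<sigma>n :: quad
  assumes "k \<ge> 1"
    and "open V" and "(0, 0) \<in> V"
    and "quadratic_bivector k \<sigma>n"
    and "lifted_poisson k V (\<lambda>(x, y). x * y) (bivector_field k \<sigma>n)"
  shows "\<exists>\<phi>. rank_one_subtorus k \<phi> \<and>
           ((\<lambda>t. torus_act (\<phi> t) \<sigma>n) \<longlongrightarrow> torus_invariant_part \<sigma>n) (at 0)"
proof -
  define m where "m a = torus_weight k a - torus_weight k (0, 0) + 1" for a
  define \<phi> :: "complex \<Rightarrow> label \<Rightarrow> complex"
    where "\<phi> t = (\<lambda>a. if a \<in> es_labels k then t powi m a else 1)" for t
  have "inj_on \<phi> (- {0})"
  proof (rule inj_onI)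
    fix s t assume "\<phi> s = \<phi> t"
    then have "\<phi> s (0, 0) = \<phi> t (0, 0)" by simp
    then show "s = t" using assms(1) by (simp add: \<phi>_def m_def)
  qed
  then have "rank_one_subtorus k \<phi>"
    unfolding rank_one_subtorus_def by (intro conjI exI[of _ m]) (auto simp: \<phi>_def)
  moreover have "((\<lambda>t. torus_act (\<phi> t) \<sigma>n a b c d) \<longlongrightarrow> torus_invariant_part \<sigma>n a b c d) (at 0)" for a b c d
  proof (cases "\<sigma>n a b c d = 0")
    case True
    then show ?thesis by (simp add: torus_act_def torus_invariant_part_def)
  next
    case False
    then have lab: "a \<in> es_labels k" "b \<in> es_labels k" "c \<in> es_labels k" "d \<in> es_labels k"
      using assms(4) unfolding quadratic_bivector_def by blast+
    let ?e = "m a + m b - m c - m d"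
    have act: "torus_act (\<phi> t) \<sigma>n a b c d = t powi ?e * \<sigma>n a b c d" if "t \<noteq> 0" for t
      using lab that by (simp add: torus_act_def \<phi>_def power_int_add power_int_diff)
    show ?thesis
    proof (cases "weight a b c d = (\<lambda>_. 0)")
      case True
      have "torus_act (\<phi> t) \<sigma>n a b c d = \<sigma>n a b c d" if "t \<noteq> 0" for t
        using torus_act_weight[OF assms(4), of "\<phi> t" a b c d] that True by (simp add: \<phi>_def)
      then have "\<forall>\<^sub>F t in at 0. torus_act (\<phi> t) \<sigma>n a b c d = \<sigma>n a b c d"
        by (simp add: eventually_at_filter)
      then show ?thesis using True by (simp add: torus_invariant_part_def tendsto_eventually)
    next
      case False
      then have pos: "?e > 0"
        using lifted_coefficients_admissible[OF assms(2-5) \<open>\<sigma>n a b c d \<noteq> 0\<close>] by (simp add: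
            admissible_monomial_def m_def)
      have "((\<lambda>t. t ^ nat ?e * \<sigma>n a b c d) \<longlongrightarrow> 0 ^ nat ?e * \<sigma>n a b c d) (at 0)"
        by (intro tendsto_intros)
      moreover have "\<forall>\<^sub>F t in at 0. t ^ nat ?e * \<sigma>n a b c d = torus_act (\<phi> t) \<sigma>n a b c d"
        using pos by (simp add: eventually_at_filter act power_int_def)
      ultimately have "((\<lambda>t. torus_act (\<phi> t) \<sigma>n a b c d) \<longlongrightarrow> 0 ^ nat ?e * \<sigma>n a b c d) (at 0)"
        by (rule Lim_transform_eventually)
      moreover have "0 ^ nat ?e = (0 :: complex)" using pos by (intro zero_power) simp
      ultimately show ?thesis using False by (simp only: torus_invariant_part_def if_False mult_zero_left)
    qed
  qed
  then have "((\<lambda>t. torus_act (\<phi> t) \<sigma>n) \<longlongrightarrow> torus_invariant_part \<sigma>n) (at 0)"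
    by (intro tendsto_coordinatewise)
  ultimately show ?thesis by blast
qed

end
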